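(* Let $\Omega\subset\mathbb{R}^d$ be a Lipschitz domain and $J=(0,T)$ with $T>0$. Suppose that $\alpha\in(0,1)$ and $s\in(-1,0]$ are such that $s<1-1/\alpha$. Then there is the continuous embedding $$L_2(J;\widetilde H^1(\Omega))\cap H^\alpha(J;H^{-1}(\Omega))\hookrightarrow C(\overline J;H^s(\Omega)).$$
   Context: $\widetilde H^1(\Omega)$ is the space of $H^1(\Omega)$ functions with vanishing trace on $\partial\Omega$; $\widetilde H^0(\Omega):=L_2(\Omega)$; for $\sigma\in(0,1)$, $\widetilde H^\sigma(\Omega):=[L_2(\Omega),\widetilde H^1(\Omega)]_{\sigma,2}$ (real interpolation, K-method); for $\sigma\in[0,1]$, $H^{-\sigma}(\Omega):=\widetilde H^\sigma(\Omega)'$ is the dual with respect to the extended $L_2(\Omega)$ scalar product. For a Banach space $X$, $L_2(J;X)$ is the Bochner space of strongly measurable $f:J\to X$ with $\|f\|_{L_2(J;X)}^2=\int_J\|f(t)\|_X^2\,dt<\infty$; for $0<\gamma<1$, $H^\gamma(J;X)$ is the space of strongly measurable $f:J\to X$ with $$\|f\|_{H^\gamma(J;X)}^2:=\|f\|_{L_2(J;X)}^2+\int_J\int_J\frac{\|f(\tau)-f(t)\|_X^2}{|\tau-t|^{2\gamma+1}}\,d\tau\,dt<\infty.$$ The intersection space carries the sum of the two norms. $C(\overline J;X)$ carries the supremum norm, and the embedding means that every element of the intersection has a representative in $C(\overline J;H^s(\Omega))$ with norm bounded by a constant (independent of the element) times the norm in the intersection. *)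

theory Defs
  imports "HOL-Analysis.Analysis" "HOL-Library.Function_Algebras"
begin

section \<open>Spaces of functions as carrier sets with a norm\<close>

text \<open>
  All spaces are sets of real-valued functions together with a norm.  The function spaces over
  \<open>\<Omega>\<close> are not quotiented by almost everywhere equality, so that their norms are only seminorms:
  two functions represent the same element iff their difference has norm zero.
\<close>

record 'b nspace =
  carr :: "'b set"
  nrm :: "'b \<Rightarrow> real"

text \<open>
  The dual space.  Functionals are normalised to be zero outside of the carrier, so that equality of
  elements of the dual is equality in HOL and the norm of the dual is a norm.  Boundedness implies
  that functionals respect almost everywhere equality.
\<close>

definition dual :: "('x \<Rightarrow> real) nspace \<Rightarrow> (('x \<Rightarrow> real) \<Rightarrow> real) nspace" where
  "dual X =
    \<lparr>carr = {\<phi>. (\<forall>u\<in>carr X. \<forall>v\<in>carr X. \<phi> (u + v) = \<phi> u + \<phi> v) \<and>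
                (\<forall>c. \<forall>u\<in>carr X. \<phi> (\<lambda>x. c * u x) = c * \<phi> u) \<and>
                (\<exists>C. \<forall>u\<in>carr X. \<bar>\<phi> u\<bar> \<le> C * nrm X u) \<and>
                (\<forall>u. u \<notin> carr X \<longrightarrow> \<phi> u = 0)},
     nrm = (\<lambda>\<phi>. SUP u\<in>carr X. \<bar>\<phi> u\<bar> / nrm X u)\<rparr>"

definition K_functional ::
  "('x \<Rightarrow> real) nspace \<Rightarrow> ('x \<Rightarrow> real) nspace \<Rightarrow> real \<Rightarrow> ('x \<Rightarrow> real) \<Rightarrow> real" where
  "K_functional X0 X1 t u =
    Inf {nrm X0 u0 + t * nrm X1 u1 | u0 u1. u0 \<in> carr X0 \<and> u1 \<in> carr X1 \<and> u = u0 + u1}"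

definition K_integral ::
  "('x \<Rightarrow> real) nspace \<Rightarrow> ('x \<Rightarrow> real) nspace \<Rightarrow> real \<Rightarrow> ('x \<Rightarrow> real) \<Rightarrow> ennreal" where
  "K_integral X0 X1 \<theta> u =
    (\<integral>\<^sup>+ t. ennreal ((t powr (- \<theta>) * K_functional X0 X1 t u)\<^sup>2 / t) \<partial>lebesgue_on {0<..})"

definition interpolation_space ::
  "('x \<Rightarrow> real) nspace \<Rightarrow> ('x \<Rightarrow> real) nspace \<Rightarrow> real \<Rightarrow> ('x \<Rightarrow> real) nspace" where
  "interpolation_space X0 X1 \<theta> =
    \<lparr>carr = {u. (\<exists>u0\<in>carr X0. \<exists>u1\<in>carr X1. u = u0 + u1) \<and> K_integral X0 X1 \<theta> u < \<infinity>},
     nrm = (\<lambda>u. sqrt (enn2real (K_integral X0 X1 \<theta> u)))\<rparr>"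


section \<open>Lipschitz domains and surface measure\<close>

definition lipschitz_domain :: "'a::euclidean_space set \<Rightarrow> bool" where
  "lipschitz_domain \<Omega> \<longleftrightarrow>
    open \<Omega> \<and> connected \<Omega> \<and> \<Omega> \<noteq> {} \<and>
    (\<forall>x\<in>frontier \<Omega>. \<exists>r>0. \<exists>e \<gamma> L. norm e = 1 \<and> L-lipschitz_on {z. z \<bullet> e = 0} \<gamma> \<and>
       \<Omega> \<inter> ball x r = {y \<in> ball x r. y \<bullet> e > \<gamma> (y - (y \<bullet> e) *\<^sub>R e)})"

text \<open>
  The case distinction in the sum makes the measure of dimension \<open>0\<close> the counting measure, as
  \<open>0 ^ 0 = 1\<close>.
\<close>

definition hausdorff_outer :: "nat \<Rightarrow> 'a::euclidean_space set \<Rightarrow> ennreal" where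
  "hausdorff_outer m A =
    (SUP \<delta>\<in>{0::real<..}.
      INF C\<in>{C :: nat \<Rightarrow> 'a set. A \<subseteq> (\<Union>i. C i) \<and> (\<forall>i. bounded (C i) \<and> diameter (C i) \<le> \<delta>)}.
        \<Sum>i. if C i = {} then 0
             else ennreal (unit_ball_vol (real m) * (diameter (C i) / 2) ^ m))"

definition surface_measure :: "'a::euclidean_space measure" where
  "surface_measure = measure_of UNIV (sets borel) (hausdorff_outer (DIM('a) - 1))"


section \<open>Sobolev spaces\<close>

primrec C_k :: "nat \<Rightarrow> ('a::euclidean_space \<Rightarrow> real) \<Rightarrow> bool" where
  "C_k 0 f \<longleftrightarrow> continuous_on UNIV f"
| "C_k (Suc k) f \<longleftrightarrow>
    (\<exists>f'. (\<forall>x. (f has_derivative f' x) (at x)) \<and> (\<forall>i\<in>Basis. C_k k (\<lambda>x. f' x i)))"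

definition test_functions :: "'a::euclidean_space set \<Rightarrow> ('a \<Rightarrow> real) set" where
  "test_functions \<Omega> =
    {\<phi>. (\<forall>k. C_k k \<phi>) \<and> compact (closure {x. \<phi> x \<noteq> 0}) \<and> closure {x. \<phi> x \<noteq> 0} \<subseteq> \<Omega>}"

definition L2_space :: "'a::euclidean_space set \<Rightarrow> ('a \<Rightarrow> real) nspace" where
  "L2_space \<Omega> =
    \<lparr>carr = {u. u \<in> borel_measurable (lebesgue_on \<Omega>) \<and> integrable (lebesgue_on \<Omega>) (\<lambda>x. (u x)\<^sup>2)},
     nrm = (\<lambda>u. sqrt (LINT x|lebesgue_on \<Omega>. (u x)\<^sup>2))\<rparr>"

definition is_weak_partial ::
  "'a::euclidean_space set \<Rightarrow> 'a \<Rightarrow> ('a \<Rightarrow> real) \<Rightarrow> ('a \<Rightarrow> real) \<Rightarrow> bool" where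
  "is_weak_partial \<Omega> i u g \<longleftrightarrow>
    (\<forall>\<phi>\<in>test_functions \<Omega>.
      (LINT x|lebesgue_on \<Omega>. u x * frechet_derivative \<phi> (at x) i) =
      - (LINT x|lebesgue_on \<Omega>. g x * \<phi> x))"

text \<open>The choice is unique up to almost everywhere equality on \<open>\<Omega>\<close>.\<close>

definition weak_partial :: "'a::euclidean_space set \<Rightarrow> 'a \<Rightarrow> ('a \<Rightarrow> real) \<Rightarrow> 'a \<Rightarrow> real" where
  "weak_partial \<Omega> i u = (SOME g. g \<in> carr (L2_space \<Omega>) \<and> is_weak_partial \<Omega> i u g)"

definition H1_space :: "'a::euclidean_space set \<Rightarrow> ('a \<Rightarrow> real) nspace" where
  "H1_space \<Omega> =
    \<lparr>carr = {u \<in> carr (L2_space \<Omega>).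
              \<forall>i\<in>Basis. \<exists>g\<in>carr (L2_space \<Omega>). is_weak_partial \<Omega> i u g},
     nrm = (\<lambda>u. sqrt ((nrm (L2_space \<Omega>) u)\<^sup>2 +
                      (\<Sum>i\<in>Basis. (nrm (L2_space \<Omega>) (weak_partial \<Omega> i u))\<^sup>2)))\<rparr>"

text \<open>
  The trace operator is the continuous extension of the restriction \<open>\<phi> \<mapsto> \<phi>|\<^sub>\<partial>\<^sub>\<Omega>\<close> from smooth functions
  up to the boundary to \<open>H\<^sup>1(\<Omega>)\<close>.  Since \<open>\<Omega>\<close> may be unbounded, convergence of the boundary values is
  in \<open>L\<^sub>2\<close> on compact pieces of the boundary; for bounded \<open>\<Omega>\<close> this is convergence in \<open>L\<^sub>2(\<partial>\<Omega>)\<close>.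
\<close>

definition has_trace ::
  "'a::euclidean_space set \<Rightarrow> ('a \<Rightarrow> real) \<Rightarrow> ('a \<Rightarrow> real) \<Rightarrow> bool" where
  "has_trace \<Omega> u g \<longleftrightarrow>
    (\<exists>\<phi>. (\<forall>n::nat. \<phi> n \<in> test_functions UNIV) \<and>
      (\<lambda>n. nrm (H1_space \<Omega>) (\<phi> n - u)) \<longlonglongrightarrow> 0 \<and>
      (\<forall>K. compact K \<longrightarrow>
        (\<lambda>n. \<integral>\<^sup>+ x\<in>frontier \<Omega> \<inter> K. ennreal ((\<phi> n x - g x)\<^sup>2) \<partial>surface_measure) \<longlonglongrightarrow> 0))"

definition H1_tilde :: "'a::euclidean_space set \<Rightarrow> ('a \<Rightarrow> real) nspace" where
  "H1_tilde \<Omega> =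
    \<lparr>carr = {u \<in> carr (H1_space \<Omega>). has_trace \<Omega> u (\<lambda>_. 0)}, nrm = nrm (H1_space \<Omega>)\<rparr>"

definition H_tilde :: "'a::euclidean_space set \<Rightarrow> real \<Rightarrow> ('a \<Rightarrow> real) nspace" where
  "H_tilde \<Omega> \<sigma> =
    (if \<sigma> = 0 then L2_space \<Omega>
     else if \<sigma> = 1 then H1_tilde \<Omega>
     else interpolation_space (L2_space \<Omega>) (H1_tilde \<Omega>) \<sigma>)"

text \<open>Only used for \<open>-1 \<le> s \<le> 0\<close>.\<close>

definition H_neg :: "'a::euclidean_space set \<Rightarrow> real \<Rightarrow> (('a \<Rightarrow> real) \<Rightarrow> real) nspace" where
  "H_neg \<Omega> s = dual (H_tilde \<Omega> (- s))"

text \<open>A function \<open>v\<close> seen as an element of \<open>H\<^sup>s(\<Omega>)\<close> by means of the \<open>L\<^sub>2(\<Omega>)\<close> scalar product.\<close>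

definition as_H_neg ::
  "'a::euclidean_space set \<Rightarrow> real \<Rightarrow> ('a \<Rightarrow> real) \<Rightarrow> ('a \<Rightarrow> real) \<Rightarrow> real" where
  "as_H_neg \<Omega> s v =
    (\<lambda>w. if w \<in> carr (H_tilde \<Omega> (- s)) then LINT x|lebesgue_on \<Omega>. v x * w x else 0)"


section \<open>Spaces of vector-valued functions\<close>

definition strongly_measurable ::
  "real set \<Rightarrow> ('b::minus) nspace \<Rightarrow> (real \<Rightarrow> 'b) \<Rightarrow> bool" where
  "strongly_measurable J X f \<longleftrightarrow>
    (\<forall>t\<in>J. f t \<in> carr X) \<and>
    (\<exists>S. (\<forall>n::nat. simple_function (lebesgue_on J) (S n) \<and> S n ` J \<subseteq> carr X) \<and>
         (AE t in lebesgue_on J. (\<lambda>n. nrm X (f t - S n t)) \<longlonglongrightarrow> 0))"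

definition bochner_L2_sq :: "real set \<Rightarrow> 'b nspace \<Rightarrow> (real \<Rightarrow> 'b) \<Rightarrow> ennreal" where
  "bochner_L2_sq J X f = (\<integral>\<^sup>+ t. ennreal ((nrm X (f t))\<^sup>2) \<partial>lebesgue_on J)"

definition bochner_L2 :: "real set \<Rightarrow> ('b::minus) nspace \<Rightarrow> (real \<Rightarrow> 'b) nspace" where
  "bochner_L2 J X =
    \<lparr>carr = {f. strongly_measurable J X f \<and> bochner_L2_sq J X f < \<infinity>},
     nrm = (\<lambda>f. sqrt (enn2real (bochner_L2_sq J X f)))\<rparr>"

definition bochner_H_sq ::
  "real set \<Rightarrow> real \<Rightarrow> ('b::minus) nspace \<Rightarrow> (real \<Rightarrow> 'b) \<Rightarrow> ennreal" where
  "bochner_H_sq J \<gamma> X f =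
    bochner_L2_sq J X f +
    (\<integral>\<^sup>+ t. (\<integral>\<^sup>+ \<tau>. ennreal ((nrm X (f \<tau> - f t))\<^sup>2 / \<bar>\<tau> - t\<bar> powr (2 * \<gamma> + 1))
       \<partial>lebesgue_on J) \<partial>lebesgue_on J)"

definition bochner_H :: "real set \<Rightarrow> real \<Rightarrow> ('b::minus) nspace \<Rightarrow> (real \<Rightarrow> 'b) nspace" where
  "bochner_H J \<gamma> X =
    \<lparr>carr = {f. strongly_measurable J X f \<and> bochner_H_sq J \<gamma> X f < \<infinity>},
     nrm = (\<lambda>f. sqrt (enn2real (bochner_H_sq J \<gamma> X f)))\<rparr>"

definition continuous_space :: "real set \<Rightarrow> ('b::minus) nspace \<Rightarrow> (real \<Rightarrow> 'b) nspace" where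
  "continuous_space I X =
    \<lparr>carr = {g. (\<forall>t\<in>I. g t \<in> carr X) \<and>
                (\<forall>t\<in>I. ((\<lambda>r. nrm X (g r - g t)) \<longlongrightarrow> 0) (at t within I))},
     nrm = (\<lambda>g. SUP t\<in>I. nrm X (g t))\<rparr>"

text \<open>
  \<open>L\<^sub>2(J; H\<^sup>1\<^sub>0(\<Omega>)) \<inter> H\<^sup>\<alpha>(J; H\<^sup>-\<^sup>1(\<Omega>))\<close>, where the intersection is understood by means of the
  embedding of functions into the dual space.
\<close>

definition L2_H_intersection ::
  "'a::euclidean_space set \<Rightarrow> real set \<Rightarrow> real \<Rightarrow> (real \<Rightarrow> 'a \<Rightarrow> real) nspace" where
  "L2_H_intersection \<Omega> J \<alpha> =
    \<lparr>carr = {f \<in> carr (bochner_L2 J (H_tilde \<Omega> 1)).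
              (\<lambda>t. as_H_neg \<Omega> (- 1) (f t)) \<in> carr (bochner_H J \<alpha> (H_neg \<Omega> (- 1)))},
     nrm = (\<lambda>f. nrm (bochner_L2 J (H_tilde \<Omega> 1)) f +
                 nrm (bochner_H J \<alpha> (H_neg \<Omega> (- 1))) (\<lambda>t. as_H_neg \<Omega> (- 1) (f t)))\<rparr>"

end

theory Submission imports Defs begin

text \<open>
  Write \<open>\<sigma> = -s\<close> and \<open>\<theta> = (1 + \<sigma>) / 2\<close>; the hypothesis says that \<open>\<beta> = \<alpha> \<theta> - 1 / 2\<close> is positive.
  Duality gives \<open>\<parallel>v\<parallel>\<^sub>0\<^sup>2 \<le> \<parallel>v\<parallel>\<^sub>-\<^sub>1 \<parallel>v\<parallel>\<^sub>1\<close>, and splitting the test function as in the \<open>K\<close>-functional turns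
  this into \<open>\<parallel>v\<parallel>\<^sub>s \<le> 3 \<parallel>v\<parallel>\<^sub>-\<^sub>1\<^bsup>\<theta>\<^esup> \<parallel>v\<parallel>\<^sub>1\<^bsup>1 - \<theta>\<^esup>\<close>.  For almost every \<open>x\<close>, \<open>y\<close> the Garsia-Rodemich-Rumsey
  argument selects points \<open>q\<^sub>k\<close> converging to \<open>x\<close> (and, from the same \<open>q\<^sub>0\<close>, to \<open>y\<close>) in intervals of length
  \<open>\<ell>\<^sub>k = 2\<^bsup>-k\<^esup> \<bar>x - y\<bar>\<close> such that, with \<open>M\<close> the norm of \<open>f\<close>, \<open>\<parallel>f q\<^sub>k\<parallel>\<^sub>1\<close> is of order \<open>M \<ell>\<^sub>k\<^bsup>-1/2\<^esup>\<close> and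
  \<open>\<parallel>f q\<^sub>k\<^sub>+\<^sub>1 - f q\<^sub>k\<parallel>\<^sub>-\<^sub>1\<close> is of order \<open>M \<ell>\<^sub>k\<^bsup>\<alpha> - 1/2\<^esup>\<close>.  The increments in \<open>H\<^sup>s\<close> are then of order \<open>M \<ell>\<^sub>k\<^bsup>\<beta>\<^esup>\<close>,
  so \<open>f\<close> is \<open>\<beta>\<close>-Hoelder continuous off a null set and extends continuously.
\<close>

section \<open>Smooth bump functions\<close>

text \<open>The weight \<theta> is the one with -\<sigma> = \<theta> (-1) + (1 - \<theta>) 1, that
  is, the position of H^s between H^-1 and H^1. The obstacle is that the H^1 norm is only square
  integrable in time: no single time is controlled a priori, so each chain point has to satisfy
  several bounds at once, namely on its own H^1 norm, on its own Gagliardo integral (for the next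
  step) and on its distances in H^-1 to the previous point and to the target. An averaging argument
  provides such points. The chaining is run on the real functions t -> <f t, w>, one test function w
  at a time, with constants linear in the norm of w. The set of admissible times is determined by
  the Gagliardo integral of f alone, so one null set serves all w, and the estimates in the dual
  norm are read off from those for each w. Smooth bump functions come first because uniqueness of
  weak derivatives rests on a sufficient supply of test functions.\<close>

lemma C_k_SucI:
  assumes "\<And>x. (f has_derivative f' x) (at x)" and "\<And>i. i \<in> Basis \<Longrightarrow> C_k k (\<lambda>x. f' x i)"
  shows "C_k (Suc k) f"
  using assms by auto

text \<open>The recursion defining \<open>C_k (Suc k)\<close> does not mention
  \<open>C_k k f\<close>. The product rule needs it, since there the undifferentiated factor must be
  smooth of one order less.\<close>

lemma C_k_mono_Suc: "C_k (Suc k) f \<Longrightarrow> C_k k f"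
proof (induction k arbitrary: f)
  case 0
  then obtain f' where "\<forall>x. (f has_derivative f' x) (at x)" by auto
  then show ?case
    by (simp add: has_derivative_continuous_on[where f' = f'])
next
  case (Suc k)
  then obtain f' where f': "\<forall>x. (f has_derivative f' x) (at x)" "\<forall>i\<in>Basis. C_k (Suc k) (\<lambda>x. f' x i)"
    by (metis C_k.simps(2))
  with Suc.IH have "\<forall>i\<in>Basis. C_k k (\<lambda>x. f' x i)" by blast
  with f'(1) show ?case by (metis C_k.simps(2))
qed

lemma C_k_const: "C_k k (\<lambda>_. c)"
proof (induction k arbitrary: c)
  case (Suc k)
  show ?case by (rule C_k_SucI[where f' = "\<lambda>x h. 0"]) (auto simp: Suc simp del: C_k.simps)
qed auto

lemma C_k_add: "C_k k f \<Longrightarrow> C_k k g \<Longrightarrow> C_k k (\<lambda>x. f x + g x)"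
proof (induction k arbitrary: f g)
  case 0
  then show ?case by (simp add: continuous_on_add continuous_on_mult)
next
  case (Suc k)
  obtain f' where f': "\<forall>x. (f has_derivative f' x) (at x)" "\<forall>i\<in>Basis. C_k k (\<lambda>x. f' x i)"
    using Suc.prems by (metis C_k.simps(2))
  obtain g' where g': "\<forall>x. (g has_derivative g' x) (at x)" "\<forall>i\<in>Basis. C_k k (\<lambda>x. g' x i)"
    using Suc.prems by (metis C_k.simps(2))
  show ?case
    by (rule C_k_SucI[where f' = "\<lambda>x h. f' x h + g' x h"])
      (use f' g' Suc.IH in \<open>auto intro!: has_derivative_add\<close>)
qed

lemma C_k_mult: "C_k k f \<Longrightarrow> C_k k g \<Longrightarrow> C_k k (\<lambda>x. f x * g x)"
proof (induction k arbitrary: f g)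
  case 0
  then show ?case by (simp add: continuous_on_add continuous_on_mult)
next
  case (Suc k)
  obtain f' where f': "\<forall>x. (f has_derivative f' x) (at x)" "\<forall>i\<in>Basis. C_k k (\<lambda>x. f' x i)"
    using Suc.prems by (metis C_k.simps(2))
  obtain g' where g': "\<forall>x. (g has_derivative g' x) (at x)" "\<forall>i\<in>Basis. C_k k (\<lambda>x. g' x i)"
    using Suc.prems by (metis C_k.simps(2))
  have fg: "C_k k f" "C_k k g"
    using Suc.prems by (auto intro: C_k_mono_Suc simp del: C_k.simps)
  show ?case
  proof (rule C_k_SucI[where f' = "\<lambda>x h. f x * g' x h + f' x h * g x"])
    show "((\<lambda>x. f x * g x) has_derivative (\<lambda>h. f x * g' x h + f' x h * g x)) (at x)" for x
      using f' g' by (auto intro!: has_derivative_mult)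
    show "C_k k (\<lambda>x. f x * g' x i + f' x i * g x)" if "i \<in> Basis" for i
      using f' g' fg that by (intro C_k_add Suc.IH) auto
  qed
qed

lemma C_k_prod:
  "finite I \<Longrightarrow> (\<And>i. i \<in> I \<Longrightarrow> C_k k (f i)) \<Longrightarrow> C_k k (\<lambda>x. \<Prod>i\<in>I. f i x)"
  by (induction I rule: finite_induct) (auto intro: C_k_const C_k_mult)

lemma C_k_inner: "C_k k (\<lambda>x. x \<bullet> e)"
proof (cases k)
  case 0
  then show ?thesis by (simp add: continuous_on_inner)
next
  case (Suc k)
  show ?thesis
    unfolding Suc by (rule C_k_SucI[where f' = "\<lambda>x h. h \<bullet> e"])
      (auto intro!: derivative_eq_intros C_k_const)
qed

text \<open>Taking a whole sequence \<open>H\<close>, each member the derivative of the previous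
  one, lets the induction on \<open>k\<close> run with \<open>n\<close> arbitrary and avoids
  formulas for higher derivatives of a composition.\<close>

lemma C_k_compose_real:
  fixes H :: "nat \<Rightarrow> real \<Rightarrow> real"
  assumes H: "\<And>n x. (H n has_field_derivative H (Suc n) x) (at x)"
    and l: "\<And>k. C_k k l"
  shows "C_k k (\<lambda>x. H n (l x))"
proof (induction k arbitrary: n)
  case 0
  have "continuous_on UNIV (H n)"
    using H by (meson DERIV_isCont continuous_at_imp_continuous_on)
  moreover have "continuous_on UNIV l" using l[of 0] by simp
  ultimately show ?case
    using continuous_on_compose2[of UNIV "H n" UNIV l] by simp
next
  case (Suc k)
  obtain l' where l': "\<forall>x. (l has_derivative l' x) (at x)" "\<forall>i\<in>Basis. C_k k (\<lambda>x. l' x i)"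
    using l[of "Suc k"] by auto
  show ?case
  proof (rule C_k_SucI[where f' = "\<lambda>x h. H (Suc n) (l x) * l' x h"])
    fix x
    have "(H n has_derivative (*) (H (Suc n) (l x))) (at (l x))"
      using H by (simp add: has_field_derivative_def)
    then show "((\<lambda>x. H n (l x)) has_derivative (\<lambda>h. H (Suc n) (l x) * l' x h)) (at x)"
      using l'(1) has_derivative_compose[of l "l' x" x UNIV "H n" "(*) (H (Suc n) (l x))"] by simp
  next
    fix i :: 'a assume "i \<in> Basis"
    then show "C_k k (\<lambda>x. H (Suc n) (l x) * l' x i)"
      using Suc.IH l' by (auto intro: C_k_mult)
  qed
qed

text \<open>The functions \<open>p (1 / x) exp (- 1 / x)\<close>, \<open>p\<close> a polynomial, are closed under differentiation.\<close>

definition exp_bump :: "real poly \<Rightarrow> real \<Rightarrow> real" where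
  "exp_bump p x = (if x > 0 then poly p (1 / x) * exp (- (1 / x)) else 0)"

text \<open>With y = 1 / x, differentiating p(y) exp(-y) in x produces y^2 (p(y) - p'(y)) exp(-y),
  because dy/dx = - y^2.\<close>

definition exp_bump_step :: "real poly \<Rightarrow> real poly" where
  "exp_bump_step p = [:0, 0, 1:] * (p - pderiv p)"

lemma poly_over_exp_tendsto_0: "((\<lambda>x::real. poly p x * exp (- x)) \<longlongrightarrow> 0) at_top"
proof -
  have "((\<lambda>x::real. \<Sum>i\<le>degree p. coeff p i * (x ^ i / exp x)) \<longlongrightarrow> (\<Sum>i\<le>degree p. coeff p i * 0)) at_top"
    by (intro tendsto_sum tendsto_mult tendsto_const tendsto_power_div_exp_0)
  then show ?thesis
    by (simp add: poly_altdef exp_minus divide_inverse sum_distrib_right mult.assoc)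
qed

lemma DERIV_exp_bump: "(exp_bump p has_field_derivative exp_bump (exp_bump_step p) x) (at x)"
proof (cases x "0::real" rule: linorder_cases)
  case less
  have "((\<lambda>_. 0) has_field_derivative 0) (at x)" by simp
  moreover have "eventually (\<lambda>y. y < 0) (nhds x)"
    using less by (intro eventually_nhds_in_open[of "{..<0}", simplified]) auto
  then have "eventually (\<lambda>y. exp_bump p y = 0) (nhds x)"
    by eventually_elim (simp add: exp_bump_def)
  ultimately show ?thesis
    using less by (subst DERIV_cong_ev[where g = "\<lambda>_. 0"]) (auto simp: exp_bump_def)
next
  case greater
  have "((\<lambda>y. poly p (1 / y) * exp (- (1 / y))) has_field_derivative
      poly (exp_bump_step p) (1 / x) * exp (- (1 / x))) (at x)"
  proof -
    have inv: "((\<lambda>y. 1 / y) has_field_derivative - ((1 / x)\<^sup>2)) (at x)"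
      using greater by (auto intro!: derivative_eq_intros simp: power2_eq_square)
    have "((\<lambda>y. poly p (1 / y) * exp (- (1 / y))) has_field_derivative
        (poly (pderiv p) (1 / x) * - ((1 / x)\<^sup>2)) * exp (- (1 / x)) +
        (exp (- (1 / x)) * - (- ((1 / x)\<^sup>2))) * poly p (1 / x)) (at x)"
      by (rule DERIV_mult DERIV_chain2[OF poly_DERIV] DERIV_chain2[OF DERIV_exp] DERIV_minus inv)+
    then show ?thesis
      by (rule DERIV_cong) (simp add: exp_bump_step_def algebra_simps power2_eq_square)
  qed
  moreover have "eventually (\<lambda>y. 0 < y) (nhds x)"
    using greater by (intro eventually_nhds_in_open[of "{0<..}", simplified]) auto
  then have "eventually (\<lambda>y. exp_bump p y = poly p (1 / y) * exp (- (1 / y))) (nhds x)"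
    by eventually_elim (simp add: exp_bump_def)
  ultimately show ?thesis
    using greater by (subst DERIV_cong_ev[where g = "\<lambda>y. poly p (1 / y) * exp (- (1 / y))"])
      (auto simp: exp_bump_def)
next
  case equal
  \<comment> \<open>To the right of 0 the difference quotient again has the form p(1 / z) exp(-1 /
    z), as dividing by z multiplies the polynomial by its variable; so it tends to 0.\<close>
  have "((\<lambda>z. poly ([:0, 1:] * p) (1 / z) * exp (- (1 / z))) \<longlongrightarrow> 0) (at_right 0)"
    using filterlim_compose[OF poly_over_exp_tendsto_0[of "[:0, 1:] * p"] filterlim_inverse_at_top_right]
    by (simp add: inverse_eq_divide)
  moreover have "eventually (\<lambda>z. exp_bump p z / z = poly ([:0, 1:] * p) (1 / z) * exp (- (1 / z))) (at_right 0)"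
    by (auto simp: eventually_at_filter exp_bump_def)
  ultimately have "((\<lambda>z. exp_bump p z / z) \<longlongrightarrow> 0) (at_right 0)"
    by (subst tendsto_cong)
  moreover have "eventually (\<lambda>z. exp_bump p z / z = 0) (at_left 0)"
    by (auto simp: eventually_at_filter exp_bump_def)
  then have "((\<lambda>z. exp_bump p z / z) \<longlongrightarrow> 0) (at_left 0)"
    by (rule tendsto_eventually)
  ultimately have "((\<lambda>z. exp_bump p z / z) \<longlongrightarrow> 0) (at 0)"
    by (simp add: filterlim_split_at)
  then show ?thesis
    using equal by (simp add: DERIV_def exp_bump_def)
qed

lemma C_k_exp_bump: "(\<And>k. C_k k l) \<Longrightarrow> C_k k (\<lambda>x. exp_bump 1 (l x))"
  using C_k_compose_real[where H = "\<lambda>n. exp_bump ((exp_bump_step ^^ n) 1)" and n = 0 and l = l]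
  by (simp add: DERIV_exp_bump)

text \<open>The factor \<open>Suc n\<close> steepens the edges without moving the support: every
  member is nonzero exactly on \<open>box a b\<close>, and the sequence tends to the indicator of
  that box.\<close>

definition box_bump :: "'a::euclidean_space \<Rightarrow> 'a \<Rightarrow> nat \<Rightarrow> 'a \<Rightarrow> real" where
  "box_bump a b n x =
    (\<Prod>i\<in>Basis. exp_bump 1 (real (Suc n) * (x \<bullet> i - a \<bullet> i)) * exp_bump 1 (real (Suc n) * (b \<bullet> i - x \<bullet> i)))"

lemma C_k_box_bump: "C_k k (box_bump a b n)"
proof -
  have 1: "C_k k (\<lambda>x. real (Suc n) * (x \<bullet> i - a \<bullet> i))" for k i
    using C_k_mult[OF C_k_const[of k "real (Suc n)"] C_k_add[OF C_k_inner[of k i] C_k_const[of k "- (a \<bullet> i)"]]]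
    by simp
  have 2: "C_k k (\<lambda>x. real (Suc n) * (b \<bullet> i - x \<bullet> i))" for k i
    using C_k_mult[OF C_k_const[of k "real (Suc n)"] C_k_add[OF C_k_const[of k "b \<bullet> i"] C_k_inner[of k "- i"]]]
    by simp
  show ?thesis
    unfolding box_bump_def by (intro C_k_prod C_k_mult C_k_exp_bump 1 2) auto
qed

lemma exp_bump_1: "0 \<le> exp_bump 1 x" "exp_bump 1 x \<le> 1" "exp_bump 1 x \<noteq> 0 \<longleftrightarrow> x > 0"
  by (auto simp: exp_bump_def)

lemma box_bump_bounds: "0 \<le> box_bump a b n x" "box_bump a b n x \<le> 1"
  unfolding box_bump_def
  by (auto intro!: prod_nonneg prod_le_1 mult_le_one simp: exp_bump_1)

lemma box_bump_nonzero: "box_bump a b n x \<noteq> 0 \<longleftrightarrow> x \<in> box a b"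
  by (auto simp: box_bump_def exp_bump_1 mem_box zero_less_mult_iff)

lemma box_bump_in_test_functions: "cbox a b \<subseteq> \<Omega> \<Longrightarrow> box_bump a b n \<in> test_functions \<Omega>"
proof -
  assume "cbox a b \<subseteq> \<Omega>"
  moreover have "{x. box_bump a b n x \<noteq> 0} = box a b" by (simp add: box_bump_nonzero)
  moreover have "closure (box a b) \<subseteq> cbox a b"
    by (simp add: box_subset_cbox closure_minimal closed_cbox)
  ultimately show ?thesis
    by (auto simp: test_functions_def C_k_box_bump bounded_subset[OF bounded_cbox] compact_eq_bounded_closed)
qed

lemma exp_bump_tendsto: "(\<lambda>n. exp_bump 1 (real (Suc n) * c)) \<longlonglongrightarrow> (if c > 0 then 1 else 0)"
proof (cases "c > 0")
  case True
  have "(\<lambda>n. inverse (real (Suc n)) * inverse c) \<longlonglongrightarrow> 0 * inverse c"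
    by (intro tendsto_mult tendsto_const LIMSEQ_inverse_real_of_nat)
  then have "(\<lambda>n. exp (- (inverse (real (Suc n)) * inverse c))) \<longlonglongrightarrow> exp (- 0)"
    by (intro tendsto_exp tendsto_minus) simp
  moreover have "exp_bump 1 (real (Suc n) * c) = exp (- (inverse (real (Suc n)) * inverse c))" for n
    using True unfolding exp_bump_def
    by (simp add: inverse_eq_divide zero_less_mult_iff del: of_nat_Suc)
  ultimately show ?thesis
    using True by simp
next
  case False
  then have "exp_bump 1 (real (Suc n) * c) = 0" for n
    by (simp add: exp_bump_def zero_less_mult_iff del: of_nat_Suc)
  then show ?thesis using False by simp
qed

lemma box_bump_tendsto: "(\<lambda>n. box_bump a b n x) \<longlonglongrightarrow> indicator (box a b) x"
proof -
  have "(\<lambda>n. box_bump a b n x) \<longlonglongrightarrow>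
    (\<Prod>i\<in>Basis. (if x \<bullet> i - a \<bullet> i > 0 then 1 else 0) * (if b \<bullet> i - x \<bullet> i > 0 then 1 else 0))"
    unfolding box_bump_def by (intro tendsto_prod tendsto_mult exp_bump_tendsto)
  also have "(\<Prod>i\<in>Basis. (if x \<bullet> i - a \<bullet> i > 0 then 1 else 0) * (if b \<bullet> i - x \<bullet> i > 0 then 1 else (0::real)))
     = indicator (box a b) x"
  proof (cases "x \<in> box a b")
    case True
    then show ?thesis by (simp add: mem_box)
  next
    case False
    then obtain i where "i \<in> Basis" "\<not> (a \<bullet> i < x \<bullet> i \<and> x \<bullet> i < b \<bullet> i)"
      by (auto simp: mem_box)
    then show ?thesis
      using False by (subst prod_zero) auto
  qed
  finally show ?thesis .
qed

section \<open>The Lebesgue space of square integrable functions\<close>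

text \<open>A functional on a function space is itself a real-valued function, so this one predicate
  covers the spaces over \<Omega> and their duals alike.\<close>

definition seminormed :: "('x \<Rightarrow> real) nspace \<Rightarrow> bool" where
  "seminormed X \<longleftrightarrow>
    0 \<in> carr X \<and> (\<forall>u\<in>carr X. 0 \<le> nrm X u) \<and>
    (\<forall>u\<in>carr X. \<forall>v\<in>carr X. u + v \<in> carr X \<and> nrm X (u + v) \<le> nrm X u + nrm X v) \<and>
    (\<forall>c. \<forall>u\<in>carr X. (\<lambda>x. c * u x) \<in> carr X \<and> nrm X (\<lambda>x. c * u x) = \<bar>c\<bar> * nrm X u)"

lemma seminormedD:
  assumes "seminormed X"
  shows seminormed_zero: "0 \<in> carr X"
    and seminormed_nonneg: "u \<in> carr X \<Longrightarrow> 0 \<le> nrm X u"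
    and seminormed_add: "u \<in> carr X \<Longrightarrow> v \<in> carr X \<Longrightarrow> u + v \<in> carr X"
    and seminormed_triangle: "u \<in> carr X \<Longrightarrow> v \<in> carr X \<Longrightarrow> nrm X (u + v) \<le> nrm X u + nrm X v"
    and seminormed_scale: "u \<in> carr X \<Longrightarrow> (\<lambda>x. c * u x) \<in> carr X"
    and seminormed_scale_nrm: "u \<in> carr X \<Longrightarrow> nrm X (\<lambda>x. c * u x) = \<bar>c\<bar> * nrm X u"
  using assms unfolding seminormed_def by auto

lemma seminormed_minus:
  assumes X: "seminormed X" and u: "u \<in> carr X"
  shows "- u \<in> carr X" and "nrm X (- u) = nrm X u"
  using seminormed_scale[OF X u, of "-1"] seminormed_scale_nrm[OF X u, of "-1"]
  by (simp_all add: fun_Compl_def)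

lemma seminormed_diff:
  assumes X: "seminormed X" and u: "u \<in> carr X" and v: "v \<in> carr X"
  shows "u - v \<in> carr X" and "nrm X (u - v) \<le> nrm X u + nrm X v"
  using seminormed_add[OF X u seminormed_minus(1)[OF X v]]
    seminormed_triangle[OF X u seminormed_minus(1)[OF X v]] seminormed_minus(2)[OF X v]
  by simp_all

lemma seminormed_nrm_0: "seminormed X \<Longrightarrow> nrm X 0 = 0"
  using seminormed_scale_nrm[of X 0 0] seminormed_zero[of X] by (simp add: zero_fun_def)

lemma seminormed_reverse_triangle:
  assumes X: "seminormed X" and u: "u \<in> carr X" and v: "v \<in> carr X"
  shows "\<bar>nrm X u - nrm X v\<bar> \<le> nrm X (u - v)"
  using seminormed_triangle[OF X seminormed_diff(1)[OF X u v] v]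
    seminormed_triangle[OF X seminormed_diff(1)[OF X v u] u]
    seminormed_minus(2)[OF X seminormed_diff(1)[OF X u v]]
  by simp

section \<open>Cauchy-Schwarz and Minkowski inequalities for square integrable functions\<close>

context
  fixes M :: "'a measure" and u v :: "'a \<Rightarrow> real"
  assumes u: "u \<in> borel_measurable M" "integrable M (\<lambda>x. (u x)\<^sup>2)"
    and v: "v \<in> borel_measurable M" "integrable M (\<lambda>x. (v x)\<^sup>2)"
begin

lemma integrable_mult_square: "integrable M (\<lambda>x. u x * v x)"
proof (rule Bochner_Integration.integrable_bound)
  show "integrable M (\<lambda>x. (u x)\<^sup>2 + (v x)\<^sup>2)" using u v by simp
  show "AE x in M. norm (u x * v x) \<le> norm ((u x)\<^sup>2 + (v x)\<^sup>2)"
  proof (rule AE_I2)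
    fix x
    have "2 * \<bar>u x\<bar> * \<bar>v x\<bar> \<le> (u x)\<^sup>2 + (v x)\<^sup>2"
      using sum_squares_bound[of "\<bar>u x\<bar>" "\<bar>v x\<bar>"] by simp
    then have "\<bar>u x\<bar> * \<bar>v x\<bar> \<le> (u x)\<^sup>2 + (v x)\<^sup>2"
      using mult_nonneg_nonneg[of "\<bar>u x\<bar>" "\<bar>v x\<bar>"] by linarith
    then show "norm (u x * v x) \<le> norm ((u x)\<^sup>2 + (v x)\<^sup>2)"
      by (simp add: abs_mult)
  qed
qed (use u v in measurable)

lemma integral_square_add:
  "integrable M (\<lambda>x. (u x + t * v x)\<^sup>2)"
  "(LINT x|M. (u x + t * v x)\<^sup>2) =
    (LINT x|M. (u x)\<^sup>2) + 2 * t * (LINT x|M. u x * v x) + t\<^sup>2 * (LINT x|M. (v x)\<^sup>2)"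
proof -
  have *: "(\<lambda>x. (u x + t * v x)\<^sup>2) = (\<lambda>x. (u x)\<^sup>2 + 2 * t * (u x * v x) + t\<^sup>2 * (v x)\<^sup>2)"
    by (auto simp: power2_eq_square algebra_simps)
  show "integrable M (\<lambda>x. (u x + t * v x)\<^sup>2)"
    unfolding * using u v integrable_mult_square by auto
  show "(LINT x|M. (u x + t * v x)\<^sup>2) =
    (LINT x|M. (u x)\<^sup>2) + 2 * t * (LINT x|M. u x * v x) + t\<^sup>2 * (LINT x|M. (v x)\<^sup>2)"
    unfolding * using u v integrable_mult_square by simp
qed

text \<open>The quadratic polynomial t -> integral of (u + t v)^2 is nonnegative; its discriminant
  gives the bound.\<close>

lemma Cauchy_Schwarz_integral:
  "\<bar>LINT x|M. u x * v x\<bar> \<le> sqrt (LINT x|M. (u x)\<^sup>2) * sqrt (LINT x|M. (v x)\<^sup>2)"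
proof -
  define a where "a = (LINT x|M. (u x)\<^sup>2)"
  define b where "b = (LINT x|M. u x * v x)"
  define c where "c = (LINT x|M. (v x)\<^sup>2)"
  have nonneg: "0 \<le> a + 2 * t * b + t\<^sup>2 * c" for t
    using integral_square_add(2)[of t] Bochner_Integration.integral_nonneg[of M "\<lambda>x. (u x + t * v x)\<^sup>2"]
    by (simp add: a_def b_def c_def)
  have ac: "0 \<le> a" "0 \<le> c" by (simp_all add: a_def c_def)
  have "b\<^sup>2 \<le> a * c"
  proof (cases "c = 0")
    case True
    \<comment> \<open>For c = 0 and b nonzero the chosen t would give the value a - (a + 1) =
      -1.\<close>
    then have "b = 0"
      using nonneg[of "- (a + 1) / (2 * b)"] by (cases "b = 0") (auto simp: field_simps)
    then show ?thesis using ac by simp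
  next
    case False
    then show ?thesis
      using nonneg[of "- b / c"] ac by (simp add: field_simps power2_eq_square)
  qed
  then have "\<bar>b\<bar> \<le> sqrt a * sqrt c"
    by (metis real_sqrt_le_mono real_sqrt_abs real_sqrt_mult)
  then show ?thesis by (simp add: a_def b_def c_def)
qed

lemma Minkowski_integral:
  "sqrt (LINT x|M. (u x + v x)\<^sup>2) \<le> sqrt (LINT x|M. (u x)\<^sup>2) + sqrt (LINT x|M. (v x)\<^sup>2)"
proof (rule real_le_lsqrt)
  show "(LINT x|M. (u x + v x)\<^sup>2) \<le> (sqrt (LINT x|M. (u x)\<^sup>2) + sqrt (LINT x|M. (v x)\<^sup>2))\<^sup>2"
    using integral_square_add(2)[of 1] Cauchy_Schwarz_integral by (simp add: power2_sum)
qed simp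

end

lemma L2_space_iff:
  "u \<in> carr (L2_space \<Omega>) \<longleftrightarrow>
    u \<in> borel_measurable (lebesgue_on \<Omega>) \<and> integrable (lebesgue_on \<Omega>) (\<lambda>x. (u x)\<^sup>2)"
  by (simp add: L2_space_def)

lemma L2_space_nrm: "nrm (L2_space \<Omega>) u = sqrt (LINT x|lebesgue_on \<Omega>. (u x)\<^sup>2)"
  by (simp add: L2_space_def)

lemma L2_mult_integrable:
  "u \<in> carr (L2_space \<Omega>) \<Longrightarrow> v \<in> carr (L2_space \<Omega>) \<Longrightarrow> integrable (lebesgue_on \<Omega>) (\<lambda>x. u x * v x)"
  by (auto simp: L2_space_iff intro: integrable_mult_square)

lemma L2_Cauchy_Schwarz:
  "u \<in> carr (L2_space \<Omega>) \<Longrightarrow> v \<in> carr (L2_space \<Omega>) \<Longrightarrow>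
    \<bar>LINT x|lebesgue_on \<Omega>. u x * v x\<bar> \<le> nrm (L2_space \<Omega>) u * nrm (L2_space \<Omega>) v"
  by (simp add: L2_space_iff L2_space_nrm Cauchy_Schwarz_integral)

lemma seminormed_L2_space: "seminormed (L2_space \<Omega>)"
  unfolding seminormed_def
proof (intro conjI ballI allI)
  show "0 \<in> carr (L2_space \<Omega>)" by (simp add: L2_space_iff zero_fun_def)
next
  fix u v assume "u \<in> carr (L2_space \<Omega>)" "v \<in> carr (L2_space \<Omega>)"
  then show "u + v \<in> carr (L2_space \<Omega>)"
    and "nrm (L2_space \<Omega>) (u + v) \<le> nrm (L2_space \<Omega>) u + nrm (L2_space \<Omega>) v"
    using integral_square_add(1)[of u "lebesgue_on \<Omega>" v 1]
    by (auto simp: L2_space_iff L2_space_nrm Minkowski_integral plus_fun_def)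
next
  fix u c assume "u \<in> carr (L2_space \<Omega>)"
  then show "(\<lambda>x. c * u x) \<in> carr (L2_space \<Omega>)"
    and "nrm (L2_space \<Omega>) (\<lambda>x. c * u x) = \<bar>c\<bar> * nrm (L2_space \<Omega>) u"
    by (auto simp: L2_space_iff L2_space_nrm power_mult_distrib real_sqrt_mult)
qed (simp add: L2_space_nrm)

text \<open>Dynkin's argument: boxes are stable under intersection and generate the Borel sets. The
  hypothesis \<open>total\<close> starts the complement step, since the whole space is not a box.
  Signed densities with equal integrals over all measurable sets agree almost everywhere.\<close>

lemma AE_zero_if_box_integrals_zero:
  fixes g :: "'a::euclidean_space \<Rightarrow> real"
  assumes g: "integrable lebesgue g" and box: "\<And>a b. (LINT x:box a b|lebesgue. g x) = 0"
    and total: "(LINT x|lebesgue. g x) = 0"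
  shows "AE x in lebesgue. g x = 0"
proof -
  have set_int: "set_integrable lebesgue A g" if "A \<in> sets borel" for A
    using that g unfolding set_integrable_def by (intro integrable_mult_indicator) auto
  have int_stable: "Int_stable (range (\<lambda>(a, b). box a b :: 'a set))"
    by (auto simp: Int_stable_def box_Int_box)
  have borel0: "(LINT x:A|lebesgue. g x) = 0" if "A \<in> sigma_sets UNIV (range (\<lambda>(a, b). box a b))" for A
    using int_stable subset_UNIV[of "range (\<lambda>(a, b). box a b :: 'a set)", folded Pow_UNIV] that
  proof (induction rule: sigma_sets_induct_disjoint)
    case (basic A)
    then show ?case using box by auto
  next
    case empty
    then show ?case by (simp add: set_lebesgue_integral_def)
  next
    case (compl A)
    then have A: "A \<in> sets borel" by (simp add: borel_eq_box)
    then have "(LINT x:A \<union> (UNIV - A)|lebesgue. g x) =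
        (LINT x:A|lebesgue. g x) + (LINT x:UNIV - A|lebesgue. g x)"
      by (intro set_integral_Un set_int) auto
    moreover have "(LINT x:A \<union> (UNIV - A)|lebesgue. g x) = 0"
      using total by (simp add: set_lebesgue_integral_def)
    ultimately show ?case using compl by simp
  next
    case (union A)
    then have A: "A i \<in> sets borel" for i using union by (auto simp: borel_eq_box)
    have "(LINT x:(\<Union>i. A i)|lebesgue. g x) = (\<Sum>i. LINT x:A i|lebesgue. g x)"
      using A union(1) by (intro lebesgue_integral_countable_add set_int)
        (auto simp: disjoint_family_on_def)
    then show ?case using union by simp
  qed
  show ?thesis
  proof (rule density_unique_real[OF g integrable_zero])
    fix A :: "'a set" assume "A \<in> sets lebesgue"
    \<comment> \<open>A Lebesgue set is a Borel set up to a null set, which carries the vanishing of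
      the integrals over.\<close>
    then obtain B N N' where A: "A = B \<union> N" "N \<subseteq> N'" "N' \<in> null_sets lborel" "B \<in> sets lborel"
      by (auto elim: sets_completionE)
    have "N' \<in> null_sets lebesgue" using A by (simp add: null_sets_completionI)
    then have "AE x in lebesgue. x \<notin> N'" by (rule AE_not_in)
    then have "AE x in lebesgue. indicator A x *\<^sub>R g x = indicator B x *\<^sub>R g x"
      by eventually_elim (use A in \<open>auto simp: indicator_def\<close>)
    then have "(LINT x:A|lebesgue. g x) = (LINT x:B|lebesgue. g x)"
      unfolding set_lebesgue_integral_def using g \<open>A \<in> sets lebesgue\<close> set_int[of B] A(4)
      by (intro integral_cong_AE) (auto simp: set_integrable_def)
    then show "(LINT x:A|lebesgue. g x) = (LINT x:A|lebesgue. 0)"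
      using borel0[of B] A by (simp add: borel_eq_box set_lebesgue_integral_def)
  qed
qed

section \<open>Test functions and weak derivatives\<close>

lemma L2_if_bounded_support:
  fixes h :: "'a::euclidean_space \<Rightarrow> real"
  assumes \<Omega>: "\<Omega> \<in> sets lebesgue" and h: "h \<in> borel_measurable (lebesgue_on \<Omega>)"
    and B: "\<And>x. \<bar>h x\<bar> \<le> B" and K: "bounded K" "\<And>x. x \<notin> K \<Longrightarrow> h x = 0"
  shows "h \<in> carr (L2_space \<Omega>)"
proof -
  obtain a where a: "K \<subseteq> cbox (-a) a" using K(1) bounded_subset_cbox_symmetric by blast
  have "integrable lebesgue (\<lambda>x. indicator \<Omega> x *\<^sub>R (B\<^sup>2 * indicator (cbox (-a) a) x :: real))"
    using \<Omega> by (intro integrable_mult_indicator integrable_mult_right integrable_real_indicator)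
      (use emeasure_bounded_finite[OF bounded_cbox[of "-a" a]] in auto)
  then have I: "integrable (lebesgue_on \<Omega>) (\<lambda>x. B\<^sup>2 * indicator (cbox (-a) a) x)"
    using \<Omega> by (subst integrable_restrict_space) auto
  have "integrable (lebesgue_on \<Omega>) (\<lambda>x. (h x)\<^sup>2)"
  proof (rule Bochner_Integration.integrable_bound[OF I])
    have "(h x)\<^sup>2 \<le> B\<^sup>2 * indicator (cbox (-a) a) x" for x
      using a K(2)[of x] B[of x] power_mono[OF B[of x] abs_ge_zero, of 2]
      by (cases "x \<in> K") (auto simp: indicator_def)
    then show "AE x in lebesgue_on \<Omega>. norm ((h x)\<^sup>2) \<le> norm (B\<^sup>2 * indicator (cbox (-a) a) x)"
      by (intro AE_I2) (auto intro: order_trans[OF _ abs_ge_self])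
  qed (use h in measurable)
  with h show ?thesis by (simp add: L2_space_iff)
qed

lemma L2_if_continuous_compact_support:
  fixes h :: "'a::euclidean_space \<Rightarrow> real"
  assumes \<Omega>: "\<Omega> \<in> sets lebesgue" and h: "continuous_on UNIV h"
    and K: "compact K" "\<And>x. x \<notin> K \<Longrightarrow> h x = 0"
  shows "h \<in> carr (L2_space \<Omega>)"
proof -
  have "compact (h ` K)" using h K by (meson compact_continuous_image continuous_on_subset subset_UNIV)
  then obtain B where B: "\<And>x. x \<in> K \<Longrightarrow> \<bar>h x\<bar> \<le> B"
    by (metis bounded_real compact_imp_bounded image_eqI)
  have "\<bar>h x\<bar> \<le> \<bar>B\<bar>" for x using B[of x] K(2)[of x] by (cases "x \<in> K") auto
  moreover have "h \<in> borel_measurable (lebesgue_on \<Omega>)"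
    using \<Omega> h by (meson continuous_imp_measurable_on_sets_lebesgue continuous_on_subset subset_UNIV)
  ultimately show ?thesis
    using \<Omega> K compact_imp_bounded by (intro L2_if_bounded_support[of \<Omega> h "\<bar>B\<bar>" K]) auto
qed

lemma test_functionsD:
  assumes "\<phi> \<in> test_functions \<Omega>"
  shows "C_k k \<phi>" "compact (closure {x. \<phi> x \<noteq> 0})" "closure {x. \<phi> x \<noteq> 0} \<subseteq> \<Omega>"
  using assms by (auto simp: test_functions_def)

lemma test_functionsI:
  assumes "\<And>k. C_k k \<phi>" and K: "compact K" "K \<subseteq> \<Omega>" and zero: "\<And>x. x \<notin> K \<Longrightarrow> \<phi> x = 0"
  shows "\<phi> \<in> test_functions \<Omega>"
proof -
  have "closure {x. \<phi> x \<noteq> 0} \<subseteq> K"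
    using K zero by (intro closure_minimal) (auto simp: compact_imp_closed)
  with assms show ?thesis
    by (auto simp: test_functions_def intro: compact_closure[THEN iffD2] bounded_subset[OF compact_imp_bounded])
qed

lemma test_functions_outside: "x \<notin> closure {x. \<phi> x \<noteq> 0} \<Longrightarrow> \<phi> x = 0"
  using closure_subset[of "{x. \<phi> x \<noteq> 0}"] by blast

lemma test_functionsE:
  assumes "\<phi> \<in> test_functions \<Omega>"
  obtains K where "compact K" "K \<subseteq> \<Omega>" "\<And>x. x \<notin> K \<Longrightarrow> \<phi> x = 0"
  using test_functionsD(2,3)[OF assms] test_functions_outside by blast

lemma test_functions_subset: "\<phi> \<in> test_functions \<Omega> \<Longrightarrow> \<Omega> \<subseteq> \<Omega>' \<Longrightarrow> \<phi> \<in> test_functions \<Omega>'"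
  by (auto simp: test_functions_def)

lemma test_functions_add:
  assumes "\<phi> \<in> test_functions \<Omega>" "\<psi> \<in> test_functions \<Omega>"
  shows "(\<lambda>x. \<phi> x + \<psi> x) \<in> test_functions \<Omega>"
proof -
  obtain K where "compact K" "K \<subseteq> \<Omega>" "\<And>x. x \<notin> K \<Longrightarrow> \<phi> x = 0"
    using assms(1) by (rule test_functionsE) blast
  moreover obtain L where "compact L" "L \<subseteq> \<Omega>" "\<And>x. x \<notin> L \<Longrightarrow> \<psi> x = 0"
    using assms(2) by (rule test_functionsE) blast
  ultimately show ?thesis
    using assms[THEN test_functionsD(1)]
    by (intro test_functionsI[where K = "K \<union> L"] C_k_add) (auto simp: compact_Un)
qed

lemma test_functions_mult:
  assumes "\<And>k. C_k k \<phi>" "\<psi> \<in> test_functions \<Omega>"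
  shows "(\<lambda>x. \<phi> x * \<psi> x) \<in> test_functions \<Omega>"
proof -
  obtain K where "compact K" "K \<subseteq> \<Omega>" "\<And>x. x \<notin> K \<Longrightarrow> \<psi> x = 0"
    using assms(2) by (rule test_functionsE) blast
  then show ?thesis
    using assms(1) assms(2)[THEN test_functionsD(1)]
    by (intro test_functionsI[where K = K] C_k_mult) auto
qed

lemma test_functions_has_derivative:
  assumes "\<phi> \<in> test_functions \<Omega>"
  shows "(\<phi> has_derivative frechet_derivative \<phi> (at x)) (at x)"
  using test_functionsD(1)[OF assms, of "Suc 0"] frechet_derivative_works
  by (auto simp: differentiable_def)

lemma test_functions_partial:
  assumes \<phi>: "\<phi> \<in> test_functions \<Omega>" and i: "i \<in> Basis"
  shows "(\<lambda>x. frechet_derivative \<phi> (at x) i) \<in> test_functions \<Omega>"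
proof (rule test_functionsI)
  fix k
  obtain \<phi>' where \<phi>': "\<forall>x. (\<phi> has_derivative \<phi>' x) (at x)" "\<forall>i\<in>Basis. C_k k (\<lambda>x. \<phi>' x i)"
    using test_functionsD(1)[OF \<phi>, of "Suc k"] by auto
  then have "\<phi>' x = frechet_derivative \<phi> (at x)" for x
    using frechet_derivative_at by blast
  then show "C_k k (\<lambda>x. frechet_derivative \<phi> (at x) i)" using \<phi>'(2) i by simp
next
  fix x assume x: "x \<notin> closure {x. \<phi> x \<noteq> 0}"
  have "(\<phi> has_derivative (\<lambda>h. 0)) (at x)"
  proof (rule has_derivative_transform_within_open[OF has_derivative_const])
    show "open (- closure {x. \<phi> x \<noteq> 0})" "x \<in> - closure {x. \<phi> x \<noteq> 0}"
      using x by (simp_all add: open_Compl)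
    show "0 = \<phi> y" if "y \<in> - closure {x. \<phi> x \<noteq> 0}" for y
      using that test_functions_outside[of y \<phi>] by simp
  qed
  then have "frechet_derivative \<phi> (at x) = (\<lambda>h. 0)"
    using frechet_derivative_at by metis
  then show "frechet_derivative \<phi> (at x) i = 0" by simp
qed (use test_functionsD[OF \<phi>] in auto)

lemma test_functions_L2:
  assumes "\<Omega> \<in> sets lebesgue" "\<phi> \<in> test_functions \<Omega>'"
  shows "\<phi> \<in> carr (L2_space \<Omega>)"
proof -
  obtain K where "compact K" "\<And>x. x \<notin> K \<Longrightarrow> \<phi> x = 0"
    using assms(2) by (rule test_functionsE) blast
  then show ?thesis
    using test_functionsD(1)[OF assms(2), of 0] L2_if_continuous_compact_support[OF assms(1)] by simp
qed

text \<open>Translation invariance makes the integral of each difference quotient \<open>Q n\<close>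
  zero. The mean value theorem bounds \<open>Q n\<close> by the supremum of the derivative, and
  dominated convergence passes to the limit.\<close>

lemma integral_partial_test_function:
  fixes F :: "'a::euclidean_space \<Rightarrow> real"
  assumes F: "F \<in> test_functions UNIV" and i: "i \<in> Basis"
  shows "(LINT x|lborel. frechet_derivative F (at x) i) = 0"
proof -
  define D where "D x = frechet_derivative F (at x) i" for x
  have D: "D \<in> test_functions UNIV"
    unfolding D_def by (rule test_functions_partial[OF F i])
  have cont: "continuous_on UNIV F" "continuous_on UNIV D"
    using test_functionsD(1)[OF F, of 0] test_functionsD(1)[OF D, of 0] by simp_all
  then have meas [measurable]: "F \<in> borel_measurable borel" "D \<in> borel_measurable borel"
    by (simp_all add: borel_measurable_continuous_onI)
  obtain K where K: "compact K" "\<And>x. x \<notin> K \<Longrightarrow> F x = 0"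
    using F by (rule test_functionsE) blast
  have bound: "\<exists>B. \<forall>x. \<bar>G x\<bar> \<le> B" if G: "G \<in> test_functions UNIV" for G :: "'a \<Rightarrow> real"
  proof -
    obtain L where L: "compact L" "\<And>x. x \<notin> L \<Longrightarrow> G x = 0"
      using G by (rule test_functionsE) blast
    have "compact (G ` L)"
      using test_functionsD(1)[OF G, of 0] L(1)
      by (simp add: compact_continuous_image continuous_on_subset)
    then obtain B where B: "\<And>x. x \<in> L \<Longrightarrow> \<bar>G x\<bar> \<le> B"
      by (metis bounded_real compact_imp_bounded image_eqI)
    have "\<bar>G x\<bar> \<le> \<bar>B\<bar>" for x
      using B[of x] L(2)[of x] by (cases "x \<in> L") auto
    then show ?thesis by blast
  qed
  obtain B where B: "\<And>x. \<bar>D x\<bar> \<le> B" using bound[OF D] by blast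
  obtain r where r: "\<And>x. x \<in> K \<Longrightarrow> norm x \<le> r"
    using K(1) by (meson bounded_iff compact_imp_bounded)
  have FI: "integrable lborel F"
  proof -
    obtain BF where BF: "\<And>x. \<bar>F x\<bar> \<le> BF" using bound[OF F] by blast
    show ?thesis
    proof (rule Bochner_Integration.integrable_bound[where f = "\<lambda>x. BF * indicator (cball 0 r) x"])
      have "\<bar>F x\<bar> \<le> BF * indicator (cball 0 r) x" for x
        using BF[of x] K(2)[of x] r[of x] by (cases "x \<in> K") (auto simp: indicator_def)
      then show "AE x in lborel. norm (F x) \<le> norm (BF * indicator (cball 0 r) x)"
        by (intro AE_I2) (auto intro: order_trans[OF _ abs_ge_self])
    qed (auto intro!: integrable_mult_right integrable_real_indicator emeasure_lborel_cball_finite)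
  qed
  define Q where "Q n x = (F (inverse (real (Suc n)) *\<^sub>R i + x) - F x) * real (Suc n)" for n x
  have shift: "(LINT x|lborel. F (c + x)) = (LINT x|lborel. F x)"
      "integrable lborel (\<lambda>x. F (c + x))" for c
    using integral_distr[of "(+) c" lborel borel F] integrable_distr_eq[of "(+) c" lborel borel F] FI
    by (simp_all add: lborel_distr_plus)
  have Q0: "(LINT x|lborel. Q n x) = 0" for n
    unfolding Q_def using shift FI by simp
  have deriv: "((\<lambda>s. F (s *\<^sub>R i + x)) has_field_derivative D (s *\<^sub>R i + x)) (at s)" for s x
  proof -
    have "((\<lambda>s. F (s *\<^sub>R i + x)) has_derivative (\<lambda>h. frechet_derivative F (at (s *\<^sub>R i + x)) (h *\<^sub>R i))) (at s)"
      by (rule has_derivative_compose[OF _ test_functions_has_derivative[OF F]])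
        (auto intro!: derivative_eq_intros)
    moreover have "linear (frechet_derivative F (at (s *\<^sub>R i + x)))"
      using test_functions_has_derivative[OF F] has_derivative_linear by blast
    ultimately show ?thesis
      by (simp add: has_field_derivative_def linear_scale D_def mult.commute[of _ "frechet_derivative F _ i"])
  qed
  \<comment> \<open>The step length is at most 1, so for x outside the ball of radius r + 1 both x
    and its translate avoid the support of \<open>F\<close>.\<close>
  have Qbound: "\<bar>Q n x\<bar> \<le> B * indicator (cball 0 (r + 1)) x" for n x
  proof (cases "x \<in> cball 0 (r + 1)")
    case True
    define h where "h = inverse (real (Suc n))"
    have h: "0 < h" "h * real (Suc n) = 1" by (simp_all add: h_def)
    obtain z where "F (h *\<^sub>R i + x) - F (0 *\<^sub>R i + x) = (h - 0) * D (z *\<^sub>R i + x)"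
      using MVT2[of 0 h "\<lambda>s. F (s *\<^sub>R i + x)" "\<lambda>s. D (s *\<^sub>R i + x)"] deriv h by auto
    then have "Q n x = D (z *\<^sub>R i + x)"
      using h by (simp add: Q_def h_def del: of_nat_Suc)
    then show ?thesis using True B by simp
  next
    case False
    have "norm (inverse (real (Suc n)) *\<^sub>R i) \<le> 1"
      using i by (simp add: inverse_le_1_iff)
    then have "inverse (real (Suc n)) *\<^sub>R i + x \<notin> K" "x \<notin> K"
      using False r[of x] r[of "inverse (real (Suc n)) *\<^sub>R i + x"]
        norm_triangle_ineq4[of "inverse (real (Suc n)) *\<^sub>R i + x" "inverse (real (Suc n)) *\<^sub>R i"]
      by (auto simp del: of_nat_Suc)
    then show ?thesis using False K(2) by (simp add: Q_def)
  qed
  have "(\<lambda>n. LINT x|lborel. Q n x) \<longlonglongrightarrow> (LINT x|lborel. D x)"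
  proof (rule integral_dominated_convergence[where w = "\<lambda>x. B * indicator (cball 0 (r + 1)) x"])
    show "integrable lborel (\<lambda>x. B * indicator (cball 0 (r + 1)) x)"
      by (intro integrable_mult_right integrable_real_indicator emeasure_lborel_cball_finite) simp
    show "AE x in lborel. (\<lambda>n. Q n x) \<longlonglongrightarrow> D x"
    proof (rule AE_I2)
      fix x
      have "((\<lambda>h. (F (h *\<^sub>R i + x) - F x) / h) \<longlongrightarrow> D x) (at 0)"
        using deriv[of x 0] by (simp add: DERIV_def)
      moreover have "filterlim (\<lambda>n. inverse (real (Suc n))) (at 0) sequentially"
        by (intro filterlim_atI LIMSEQ_inverse_real_of_nat) auto
      ultimately have "(\<lambda>n. (F (inverse (real (Suc n)) *\<^sub>R i + x) - F x) / inverse (real (Suc n))) \<longlonglongrightarrow> D x"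
        by (rule filterlim_compose)
      then show "(\<lambda>n. Q n x) \<longlonglongrightarrow> D x"
        by (simp add: Q_def divide_inverse del: of_nat_Suc)
    qed
    show "AE x in lborel. norm (Q n x) \<le> B * indicator (cball 0 (r + 1)) x" for n
      using Qbound by simp
    show "Q n \<in> borel_measurable lborel" for n
      unfolding Q_def by measurable
  qed measurable
  then show ?thesis
    by (simp add: Q0 LIMSEQ_const_iff D_def)
qed

lemma integral_lebesgue_on_eq_lborel:
  fixes h :: "'a::euclidean_space \<Rightarrow> real"
  assumes "\<Omega> \<in> sets lebesgue" "h \<in> borel_measurable borel" "\<And>x. x \<notin> \<Omega> \<Longrightarrow> h x = 0"
  shows "(LINT x|lebesgue_on \<Omega>. h x) = (LINT x|lborel. h x)"
proof -
  have "(LINT x|lebesgue_on \<Omega>. h x) = (LINT x|lebesgue. indicator \<Omega> x *\<^sub>R h x)"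
    using assms(1) by (intro integral_restrict_space) auto
  also have "(\<lambda>x. indicator \<Omega> x *\<^sub>R h x) = h"
  proof
    show "indicator \<Omega> x *\<^sub>R h x = h x" for x
      using assms(3)[of x] by (cases "x \<in> \<Omega>") auto
  qed
  finally show ?thesis using assms(2) by (simp add: integral_completion)
qed

text \<open>
  As \<open>weak_partial\<close> is an arbitrary choice, even the triangle inequality of \<open>H\<^sup>1\<close> depends on the
  uniqueness of weak derivatives.
\<close>

lemma fundamental_lemma:
  fixes g :: "'a::euclidean_space \<Rightarrow> real"
  assumes \<Omega>: "open \<Omega>" and g: "g \<in> carr (L2_space \<Omega>)"
    and zero: "\<And>\<phi>. \<phi> \<in> test_functions \<Omega> \<Longrightarrow> (LINT x|lebesgue_on \<Omega>. g x * \<phi> x) = 0"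
  shows "AE x in lebesgue_on \<Omega>. g x = 0"
proof -
  have \<Omega>': "\<Omega> \<in> sets lebesgue" using \<Omega> by simp
  define G where "G x = (if x \<in> \<Omega> then g x else 0)" for x
  have ind: "indicator (box a b) \<in> carr (L2_space \<Omega>)" for a b :: 'a
  proof (rule L2_if_bounded_support[OF \<Omega>', where B = 1 and K = "box a b"])
    show "indicator (box a b) \<in> borel_measurable (lebesgue_on \<Omega>)"
      by (intro measurable_restrict_space1 borel_measurable_indicator) simp
  qed auto
  have ind_int: "integrable (lebesgue_on \<Omega>) (\<lambda>x. g x * indicator (box a b) x)" for a b :: 'a
    using g ind by (rule L2_mult_integrable)
  have G_eq: "(\<lambda>x. indicator \<Omega> x *\<^sub>R (g x * indicator (box a b) x)) = (\<lambda>x. indicator (box a b) x *\<^sub>R G x)" for a b :: 'a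
    by (auto simp: G_def indicator_def)
  have G_int: "integrable lebesgue (\<lambda>x. indicator (box a b) x *\<^sub>R G x)" for a b :: 'a
    using ind_int[of a b] \<Omega>' by (simp add: integrable_restrict_space G_eq del: real_scaleR_def)
  have box0: "(LINT x:box a b|lebesgue. G x) = 0" if "cbox a b \<subseteq> \<Omega>" for a b
  proof -
    have test: "box_bump a b n \<in> test_functions \<Omega>" for n
      using that by (rule box_bump_in_test_functions)
    have "(\<lambda>n. LINT x|lebesgue_on \<Omega>. g x * box_bump a b n x) \<longlonglongrightarrow>
        (LINT x|lebesgue_on \<Omega>. g x * indicator (box a b) x)"
    proof (rule integral_dominated_convergence[where w = "\<lambda>x. norm (g x * indicator (box a b) x)"])
      show "(\<lambda>x. g x * indicator (box a b) x) \<in> borel_measurable (lebesgue_on \<Omega>)"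
        using ind_int by (rule borel_measurable_integrable)
      show "(\<lambda>x. g x * box_bump a b n x) \<in> borel_measurable (lebesgue_on \<Omega>)" for n
        using L2_mult_integrable[OF g test_functions_L2[OF \<Omega>' test]]
        by (rule borel_measurable_integrable)
      show "integrable (lebesgue_on \<Omega>) (\<lambda>x. norm (g x * indicator (box a b) x))"
        using ind_int by (rule integrable_norm)
      show "AE x in lebesgue_on \<Omega>. (\<lambda>n. g x * box_bump a b n x) \<longlonglongrightarrow> g x * indicator (box a b) x"
        by (intro AE_I2 tendsto_mult tendsto_const box_bump_tendsto)
      show "AE x in lebesgue_on \<Omega>. norm (g x * box_bump a b n x) \<le> norm (g x * indicator (box a b) x)" for n
      proof (rule AE_I2)
        fix x
        show "norm (g x * box_bump a b n x) \<le> norm (g x * indicator (box a b) x)"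
          using box_bump_bounds[of a b n x] box_bump_nonzero[of a b n x]
          by (cases "x \<in> box a b") (auto simp: abs_mult mult_left_le)
      qed
    qed
    then have "(LINT x|lebesgue_on \<Omega>. g x * indicator (box a b) x) = 0"
      by (simp add: zero[OF test] LIMSEQ_const_iff)
    then show ?thesis
      using \<Omega>' by (simp add: set_lebesgue_integral_def integral_restrict_space G_eq del: real_scaleR_def)
  qed
  \<comment> \<open>\<open>g\<close> is only square integrable on \<Omega>, so it is cut off to a
    box inside \<Omega>. Integrating the cut-off function over any box then means integrating over
    an intersection, again a box inside \<Omega>.\<close>
  have AE_box: "AE x in lebesgue. x \<in> cbox c d \<longrightarrow> G x = 0" if cd: "cbox c d \<subseteq> \<Omega>" for c d
  proof -
    have "AE x in lebesgue. indicator (box c d) x *\<^sub>R G x = 0"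
    proof (rule AE_zero_if_box_integrals_zero[OF G_int])
      fix a b :: 'a
      obtain e f where ef: "box a b \<inter> box c d = box e f"
        using box_Int_box by blast
      have "(LINT x:box e f|lebesgue. G x) = 0"
      \<comment> \<open>If \<open>box e f\<close> is empty, \<open>cbox e f\<close> is not its
        closure in general and may leave \<Omega>, so \<open>box0\<close> does not cover this
        case.\<close>
      proof (cases "box e f = {}")
        case True
        then show ?thesis by (simp add: set_lebesgue_integral_def)
      next
        case False
        then have "cbox e f = closure (box e f)" by simp
        also have "\<dots> \<subseteq> cbox c d"
          using ef box_subset_cbox[of c d] by (intro closure_minimal closed_cbox) auto
        finally show ?thesis using cd by (intro box0) blast
      qed
      moreover have "(\<lambda>x. indicator (box a b) x *\<^sub>R (indicator (box c d) x *\<^sub>R G x)) = (\<lambda>x. indicator (box e f) x *\<^sub>R G x)"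
        unfolding ef[symmetric] by (auto simp: indicator_def)
      ultimately show "(LINT x:box a b|lebesgue. indicator (box c d) x *\<^sub>R G x) = 0"
        unfolding set_lebesgue_integral_def by simp
    next
      show "(LINT x|lebesgue. indicator (box c d) x *\<^sub>R G x) = 0"
        using box0[OF cd] by (simp add: set_lebesgue_integral_def)
    qed
    moreover have "AE x in lebesgue. x \<notin> cbox c d - box c d"
      using negligible_frontier_interval[of c d] by (intro AE_not_in) (simp add: negligible_iff_null_sets)
    ultimately show ?thesis
      by eventually_elim (auto simp: indicator_def)
  qed
  obtain \<D> where \<D>: "countable \<D>" "\<D> \<subseteq> Pow \<Omega>" "\<And>X. X \<in> \<D> \<Longrightarrow> \<exists>a b. X = cbox a b" "\<Union>\<D> = \<Omega>"
    using open_countable_Union_open_cbox[OF \<Omega>] by metis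
  have "AE x in lebesgue. \<forall>X\<in>\<D>. x \<in> X \<longrightarrow> G x = 0"
  proof (subst AE_ball_countable[OF \<D>(1)], rule ballI)
    fix X assume "X \<in> \<D>"
    then show "AE x in lebesgue. x \<in> X \<longrightarrow> G x = 0"
      using \<D>(2,3) AE_box by blast
  qed
  then have "AE x in lebesgue. x \<in> \<Omega> \<longrightarrow> g x = 0"
    by eventually_elim (use \<D>(4) in \<open>metis G_def UnionE\<close>)
  then show ?thesis
    using \<Omega>' by (simp add: AE_restrict_space_iff)
qed

text \<open>Integration by parts: the product with a test function on \<Omega> has compact support
  in \<Omega>, so the integral of its derivative is one over the whole space and vanishes. This puts
  the approximants in \<open>has_trace\<close> into H^1, where the triangle inequality is
  available.\<close>

lemma is_weak_partial_test_function:
  assumes \<Omega>: "open \<Omega>" and \<phi>: "\<phi> \<in> test_functions UNIV" and i: "i \<in> Basis"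
  shows "is_weak_partial \<Omega> i \<phi> (\<lambda>x. frechet_derivative \<phi> (at x) i)"
  unfolding is_weak_partial_def
proof
  fix \<psi> assume \<psi>: "\<psi> \<in> test_functions \<Omega>"
  have \<Omega>': "\<Omega> \<in> sets lebesgue" using \<Omega> by simp
  let ?D = "\<lambda>f x. frechet_derivative f (at x) i"
  let ?F = "\<lambda>x. \<phi> x * \<psi> x"
  have F: "?F \<in> test_functions \<Omega>"
    by (rule test_functions_mult[OF test_functionsD(1)[OF \<phi>] \<psi>])
  have DF: "?D ?F x = \<phi> x * ?D \<psi> x + ?D \<phi> x * \<psi> x" for x
  proof -
    have "(\<lambda>h. \<phi> x * frechet_derivative \<psi> (at x) h + frechet_derivative \<phi> (at x) h * \<psi> x) =
        frechet_derivative ?F (at x)"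
      using \<phi> \<psi> by (intro frechet_derivative_at has_derivative_mult test_functions_has_derivative)
    then show ?thesis by metis
  qed
  have D\<psi>: "?D \<psi> \<in> test_functions \<Omega>" and D\<phi>: "?D \<phi> \<in> test_functions UNIV" and DFt: "?D ?F \<in> test_functions \<Omega>"
    using \<phi> \<psi> F i by (auto intro: test_functions_partial)
  obtain K where K: "K \<subseteq> \<Omega>" "\<And>x. x \<notin> K \<Longrightarrow> ?D ?F x = 0"
    using DFt by (rule test_functionsE) blast
  have "(LINT x|lebesgue_on \<Omega>. ?D ?F x) = (LINT x|lborel. ?D ?F x)"
  proof (rule integral_lebesgue_on_eq_lborel[OF \<Omega>'])
    show "?D ?F \<in> borel_measurable borel"
      using test_functionsD(1)[OF DFt, of 0] by (simp add: borel_measurable_continuous_onI)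
  qed (use K in blast)
  also have "\<dots> = 0"
    by (rule integral_partial_test_function[OF test_functions_subset[OF F] i]) simp
  finally have "(LINT x|lebesgue_on \<Omega>. \<phi> x * ?D \<psi> x + ?D \<phi> x * \<psi> x) = 0"
    by (simp add: DF)
  moreover have "(LINT x|lebesgue_on \<Omega>. \<phi> x * ?D \<psi> x + ?D \<phi> x * \<psi> x) =
      (LINT x|lebesgue_on \<Omega>. \<phi> x * ?D \<psi> x) + (LINT x|lebesgue_on \<Omega>. ?D \<phi> x * \<psi> x)"
    by (intro Bochner_Integration.integral_add L2_mult_integrable test_functions_L2[OF \<Omega>' \<phi>]
        test_functions_L2[OF \<Omega>' D\<psi>] test_functions_L2[OF \<Omega>' D\<phi>] test_functions_L2[OF \<Omega>' \<psi>])
  ultimately show "(LINT x|lebesgue_on \<Omega>. \<phi> x * ?D \<psi> x) = - (LINT x|lebesgue_on \<Omega>. ?D \<phi> x * \<psi> x)"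
    by simp
qed

section \<open>Weak derivatives: linearity and uniqueness\<close>

context
  fixes \<Omega> :: "'a::euclidean_space set" and i :: 'a
  assumes \<Omega>: "open \<Omega>" and i: "i \<in> Basis"
begin

lemma weak_partial_pairing_integrable:
  assumes "u \<in> carr (L2_space \<Omega>)" "\<phi> \<in> test_functions \<Omega>"
  shows "integrable (lebesgue_on \<Omega>) (\<lambda>x. u x * frechet_derivative \<phi> (at x) i)"
    and "integrable (lebesgue_on \<Omega>) (\<lambda>x. u x * \<phi> x)"
  using assms \<Omega> i test_functions_L2[OF _ assms(2)] test_functions_L2[OF _ test_functions_partial[OF assms(2) i]]
  by (auto intro: L2_mult_integrable)

lemma is_weak_partial_add:
  assumes "u \<in> carr (L2_space \<Omega>)" "g \<in> carr (L2_space \<Omega>)" "is_weak_partial \<Omega> i u g"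
    and "v \<in> carr (L2_space \<Omega>)" "h \<in> carr (L2_space \<Omega>)" "is_weak_partial \<Omega> i v h"
  shows "is_weak_partial \<Omega> i (u + v) (g + h)"
  using assms weak_partial_pairing_integrable
  by (simp add: is_weak_partial_def distrib_right)

lemma is_weak_partial_scale:
  assumes "is_weak_partial \<Omega> i u g"
  shows "is_weak_partial \<Omega> i (\<lambda>x. c * u x) (\<lambda>x. c * g x)"
  using assms by (simp add: is_weak_partial_def mult.assoc)

lemma is_weak_partial_unique:
  assumes "g \<in> carr (L2_space \<Omega>)" "is_weak_partial \<Omega> i u g"
    and "h \<in> carr (L2_space \<Omega>)" "is_weak_partial \<Omega> i u h"
  shows "AE x in lebesgue_on \<Omega>. g x = h x"
proof -
  have "AE x in lebesgue_on \<Omega>. (g - h) x = 0"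
  proof (rule fundamental_lemma[OF \<Omega>])
    show "g - h \<in> carr (L2_space \<Omega>)"
      using assms by (intro seminormed_diff[OF seminormed_L2_space])
    show "(LINT x|lebesgue_on \<Omega>. (g - h) x * \<phi> x) = 0" if "\<phi> \<in> test_functions \<Omega>" for \<phi>
      using assms that weak_partial_pairing_integrable
      by (simp add: is_weak_partial_def left_diff_distrib)
  qed
  then show ?thesis by simp
qed

lemma weak_partial_spec:
  assumes "u \<in> carr (H1_space \<Omega>)"
  shows "weak_partial \<Omega> i u \<in> carr (L2_space \<Omega>)" "is_weak_partial \<Omega> i u (weak_partial \<Omega> i u)"
proof -
  have "\<exists>g. g \<in> carr (L2_space \<Omega>) \<and> is_weak_partial \<Omega> i u g"
    using assms i by (auto simp: H1_space_def)
  from someI_ex[OF this] show "weak_partial \<Omega> i u \<in> carr (L2_space \<Omega>)" "is_weak_partial \<Omega> i u (weak_partial \<Omega> i u)"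
    by (auto simp: weak_partial_def)
qed

text \<open>Removes the arbitrary choice in \<open>weak_partial\<close>: the norm may be computed
  from any square integrable weak derivative, in particular from sums and multiples of known
  ones.\<close>

lemma nrm_weak_partial_eq:
  assumes "g \<in> carr (L2_space \<Omega>)" "is_weak_partial \<Omega> i u g" "u \<in> carr (H1_space \<Omega>)"
  shows "nrm (L2_space \<Omega>) (weak_partial \<Omega> i u) = nrm (L2_space \<Omega>) g"
proof -
  have "AE x in lebesgue_on \<Omega>. weak_partial \<Omega> i u x = g x"
    using assms weak_partial_spec[OF assms(3)] by (intro is_weak_partial_unique)
  then have "(LINT x|lebesgue_on \<Omega>. (weak_partial \<Omega> i u x)\<^sup>2) = (LINT x|lebesgue_on \<Omega>. (g x)\<^sup>2)"
    using assms weak_partial_spec[OF assms(3)]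
    by (intro integral_cong_AE) (auto simp: L2_space_iff)
  then show ?thesis by (simp add: L2_space_nrm)
qed

end

section \<open>The seminormed space H^1\<close>

lemma H1_space_L2: "u \<in> carr (H1_space \<Omega>) \<Longrightarrow> u \<in> carr (L2_space \<Omega>)"
  by (simp add: H1_space_def)

text \<open>Writing the norm as a Euclidean norm of Euclidean norms reduces its triangle inequality
  to those of \<open>L2_set\<close> and of the plane.\<close>

lemma H1_space_nrm:
  "nrm (H1_space \<Omega>) u = sqrt ((nrm (L2_space \<Omega>) u)\<^sup>2 +
    (L2_set (\<lambda>i. nrm (L2_space \<Omega>) (weak_partial \<Omega> i u)) Basis)\<^sup>2)"
  by (simp add: H1_space_def L2_set_def sum_nonneg)

lemma L2_nrm_le_H1_nrm: "nrm (L2_space \<Omega>) u \<le> nrm (H1_space \<Omega>) u"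
  unfolding H1_space_nrm by (rule real_le_rsqrt) simp

lemma test_functions_H1:
  assumes \<Omega>: "open \<Omega>" and \<phi>: "\<phi> \<in> test_functions UNIV"
  shows "\<phi> \<in> carr (H1_space \<Omega>)"
proof -
  have "\<Omega> \<in> sets lebesgue" using \<Omega> by simp
  then show ?thesis
    using test_functions_L2[OF _ \<phi>] test_functions_L2[OF _ test_functions_partial[OF \<phi>]]
      is_weak_partial_test_function[OF \<Omega> \<phi>]
    unfolding H1_space_def by (auto intro!: bexI[of _ "\<lambda>x. frechet_derivative \<phi> (at x) _"])
qed

lemma seminormed_H1_space:
  fixes \<Omega> :: "'a::euclidean_space set"
  assumes \<Omega>: "open \<Omega>"
  shows "seminormed (H1_space \<Omega>)"
proof -
  note L2 = seminormed_L2_space[of \<Omega>]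
  have zero: "is_weak_partial \<Omega> i 0 0" for i
    by (simp add: is_weak_partial_def)
  have add: "u + v \<in> carr (H1_space \<Omega>)" if "u \<in> carr (H1_space \<Omega>)" "v \<in> carr (H1_space \<Omega>)" for u v
  proof -
    have "\<exists>g\<in>carr (L2_space \<Omega>). is_weak_partial \<Omega> i (u + v) g" if "i \<in> Basis" for i
      using \<open>u \<in> _\<close> \<open>v \<in> _\<close> that
      by (intro bexI[of _ "weak_partial \<Omega> i u + weak_partial \<Omega> i v"] is_weak_partial_add[OF \<Omega>]
          seminormed_add[OF L2] weak_partial_spec[OF \<Omega>] H1_space_L2) auto
    then show ?thesis
      using that seminormed_add[OF L2] by (simp add: H1_space_def)
  qed
  have scale: "(\<lambda>x. c * u x) \<in> carr (H1_space \<Omega>)" if "u \<in> carr (H1_space \<Omega>)" for u c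
  proof -
    have "\<exists>g\<in>carr (L2_space \<Omega>). is_weak_partial \<Omega> i (\<lambda>x. c * u x) g" if "i \<in> Basis" for i
      using \<open>u \<in> _\<close> that
      by (intro bexI[of _ "\<lambda>x. c * weak_partial \<Omega> i u x"] is_weak_partial_scale[OF \<Omega>]
          seminormed_scale[OF L2] weak_partial_spec[OF \<Omega>]) auto
    then show ?thesis
      using that seminormed_scale[OF L2] by (simp add: H1_space_def)
  qed
  show ?thesis
    unfolding seminormed_def
  proof (intro conjI ballI allI)
    show "0 \<in> carr (H1_space \<Omega>)"
      using seminormed_zero[OF L2] zero by (auto simp: H1_space_def)
    fix u assume u: "u \<in> carr (H1_space \<Omega>)"
    show "0 \<le> nrm (H1_space \<Omega>) u" by (simp add: H1_space_nrm)
    fix v assume v: "v \<in> carr (H1_space \<Omega>)"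
    show "u + v \<in> carr (H1_space \<Omega>)" by (rule add[OF u v])
    let ?n = "nrm (L2_space \<Omega>)"
    have "?n (weak_partial \<Omega> i (u + v)) \<le> ?n (weak_partial \<Omega> i u) + ?n (weak_partial \<Omega> i v)"
      if "i \<in> Basis" for i
    proof -
      have "?n (weak_partial \<Omega> i (u + v)) = ?n (weak_partial \<Omega> i u + weak_partial \<Omega> i v)"
        using u v that add[OF u v]
        by (intro nrm_weak_partial_eq[OF \<Omega>] is_weak_partial_add[OF \<Omega>]
            seminormed_add[OF L2] weak_partial_spec[OF \<Omega>] H1_space_L2) auto
      then show ?thesis
        using seminormed_triangle[OF L2 weak_partial_spec(1)[OF \<Omega> that u] weak_partial_spec(1)[OF \<Omega> that v]]
        by simp
    qed
    moreover have nn: "0 \<le> ?n w" for w by (simp add: L2_space_nrm)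
    ultimately have "L2_set (\<lambda>i. ?n (weak_partial \<Omega> i (u + v))) Basis \<le>
        L2_set (\<lambda>i. ?n (weak_partial \<Omega> i u) + ?n (weak_partial \<Omega> i v)) Basis"
      by (intro L2_set_mono)
    also have "\<dots> \<le> L2_set (\<lambda>i. ?n (weak_partial \<Omega> i u)) Basis + L2_set (\<lambda>i. ?n (weak_partial \<Omega> i v)) Basis"
      by (rule L2_set_triangle_ineq)
    finally have D: "L2_set (\<lambda>i. ?n (weak_partial \<Omega> i (u + v))) Basis \<le> \<dots>" .
    have "nrm (H1_space \<Omega>) (u + v) \<le> sqrt ((?n u + ?n v)\<^sup>2 +
       (L2_set (\<lambda>i. ?n (weak_partial \<Omega> i u)) Basis + L2_set (\<lambda>i. ?n (weak_partial \<Omega> i v)) Basis)\<^sup>2)"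
      unfolding H1_space_nrm
      using D seminormed_triangle[OF L2 H1_space_L2[OF u] H1_space_L2[OF v]] nn
      by (intro real_sqrt_le_mono add_mono power_mono) auto
    also have "\<dots> \<le> nrm (H1_space \<Omega>) u + nrm (H1_space \<Omega>) v"
      unfolding H1_space_nrm by (rule real_sqrt_sum_squares_triangle_ineq)
    finally show "nrm (H1_space \<Omega>) (u + v) \<le> nrm (H1_space \<Omega>) u + nrm (H1_space \<Omega>) v" .
  next
    fix u c assume u: "u \<in> carr (H1_space \<Omega>)"
    show "(\<lambda>x. c * u x) \<in> carr (H1_space \<Omega>)" by (rule scale[OF u])
    let ?n = "nrm (L2_space \<Omega>)"
    have "?n (weak_partial \<Omega> i (\<lambda>x. c * u x)) = \<bar>c\<bar> * ?n (weak_partial \<Omega> i u)" if "i \<in> Basis" for i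
    proof -
      have "?n (weak_partial \<Omega> i (\<lambda>x. c * u x)) = ?n (\<lambda>x. c * weak_partial \<Omega> i u x)"
        using u that scale[OF u]
        by (intro nrm_weak_partial_eq[OF \<Omega>] is_weak_partial_scale[OF \<Omega>]
            seminormed_scale[OF L2] weak_partial_spec[OF \<Omega>]) auto
      then show ?thesis
        using seminormed_scale_nrm[OF L2 weak_partial_spec(1)[OF \<Omega> that u]] by simp
    qed
    then have "L2_set (\<lambda>i. ?n (weak_partial \<Omega> i (\<lambda>x. c * u x))) Basis =
        \<bar>c\<bar> * L2_set (\<lambda>i. ?n (weak_partial \<Omega> i u)) Basis"
      by (simp add: L2_set_right_distrib cong: L2_set_cong)
    then show "nrm (H1_space \<Omega>) (\<lambda>x. c * u x) = \<bar>c\<bar> * nrm (H1_space \<Omega>) u"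
      using seminormed_scale_nrm[OF L2 H1_space_L2[OF u]]
      by (simp add: H1_space_nrm power_mult_distrib real_sqrt_mult flip: distrib_left)
  qed
qed

section \<open>Vanishing traces\<close>

text \<open>\<open>measure_of\<close> keeps the generated sigma-algebra whatever set function it is
  given. Borel measurability is what allows the boundary integrals in \<open>has_trace\<close> to be
  split and scaled.\<close>

lemma sets_surface_measure [measurable_cong]:
  "sets (surface_measure :: 'a::euclidean_space measure) = sets borel"
  using sets_measure_of[of "sets (borel :: 'a measure)" UNIV] sets.sigma_sets_eq[of "borel :: 'a measure"]
  by (simp add: surface_measure_def)

lemma test_function_diff_H1:
  assumes \<Omega>: "open \<Omega>" and "\<phi> \<in> test_functions UNIV" "u \<in> carr (H1_space \<Omega>)"
  shows "\<phi> - u \<in> carr (H1_space \<Omega>)"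
  using test_functions_H1[OF assms(1,2)] assms(3) by (rule seminormed_diff[OF seminormed_H1_space[OF \<Omega>]])

text \<open>The sums of the approximating sequences work: the H^1 part by the triangle inequality,
  the boundary part by (a + b)^2 \<le> 2 a^2 + 2 b^2. Together with scaling this makes
  \<open>H1_tilde\<close> a linear space.\<close>

lemma has_trace_zero_add:
  fixes \<Omega> :: "'a::euclidean_space set"
  assumes \<Omega>: "open \<Omega>" and u: "u \<in> carr (H1_space \<Omega>)" "has_trace \<Omega> u (\<lambda>_. 0)"
    and v: "v \<in> carr (H1_space \<Omega>)" "has_trace \<Omega> v (\<lambda>_. 0)"
  shows "has_trace \<Omega> (u + v) (\<lambda>_. 0)"
proof -
  note H1 = seminormed_H1_space[OF \<Omega>]
  obtain \<phi> where \<phi>: "\<And>n. \<phi> n \<in> test_functions UNIV"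
      "(\<lambda>n. nrm (H1_space \<Omega>) (\<phi> n - u)) \<longlonglongrightarrow> 0"
      "\<And>K. compact K \<Longrightarrow> (\<lambda>n. \<integral>\<^sup>+ x\<in>frontier \<Omega> \<inter> K. ennreal ((\<phi> n x)\<^sup>2) \<partial>surface_measure) \<longlonglongrightarrow> 0"
    using u(2) by (auto simp: has_trace_def)
  obtain \<psi> where \<psi>: "\<And>n. \<psi> n \<in> test_functions UNIV"
      "(\<lambda>n. nrm (H1_space \<Omega>) (\<psi> n - v)) \<longlonglongrightarrow> 0"
      "\<And>K. compact K \<Longrightarrow> (\<lambda>n. \<integral>\<^sup>+ x\<in>frontier \<Omega> \<inter> K. ennreal ((\<psi> n x)\<^sup>2) \<partial>surface_measure) \<longlonglongrightarrow> 0"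
    using v(2) by (auto simp: has_trace_def)
  have mem: "\<phi> n - u \<in> carr (H1_space \<Omega>)" "\<psi> n - v \<in> carr (H1_space \<Omega>)" for n
    using test_function_diff_H1[OF \<Omega>] \<phi>(1) \<psi>(1) u(1) v(1) by blast+
  show ?thesis
    unfolding has_trace_def
  proof (intro exI[of _ "\<lambda>n x. \<phi> n x + \<psi> n x"] conjI allI impI)
    show "(\<lambda>x. \<phi> n x + \<psi> n x) \<in> test_functions UNIV" for n
      using \<phi> \<psi> by (intro test_functions_add)
    show "(\<lambda>n. nrm (H1_space \<Omega>) ((\<lambda>x. \<phi> n x + \<psi> n x) - (u + v))) \<longlonglongrightarrow> 0"
    proof (rule tendsto_sandwich[OF _ _ tendsto_const])
      show "(\<lambda>n. nrm (H1_space \<Omega>) (\<phi> n - u) + nrm (H1_space \<Omega>) (\<psi> n - v)) \<longlonglongrightarrow> 0"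
        using tendsto_add[OF \<phi>(2) \<psi>(2)] by simp
      have *: "(\<lambda>x. \<phi> n x + \<psi> n x) - (u + v) = (\<phi> n - u) + (\<psi> n - v)" for n
        by (auto simp: fun_eq_iff)
      show "eventually (\<lambda>n. nrm (H1_space \<Omega>) ((\<lambda>x. \<phi> n x + \<psi> n x) - (u + v)) \<le>
          nrm (H1_space \<Omega>) (\<phi> n - u) + nrm (H1_space \<Omega>) (\<psi> n - v)) sequentially"
        unfolding * using mem by (intro always_eventually allI seminormed_triangle[OF H1])
      show "eventually (\<lambda>n. 0 \<le> nrm (H1_space \<Omega>) ((\<lambda>x. \<phi> n x + \<psi> n x) - (u + v))) sequentially"
        unfolding * using mem
        by (intro always_eventually allI seminormed_nonneg[OF H1] seminormed_add[OF H1])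
    qed
    fix K :: "'a set" assume K: "compact K"
    have A [measurable]: "frontier \<Omega> \<inter> K \<in> sets borel"
      using K by (intro sets.Int) (simp_all add: frontier_closed compact_imp_closed borel_closed)
    have meas [measurable]: "\<phi> n \<in> borel_measurable borel" "\<psi> n \<in> borel_measurable borel" for n
      using test_functionsD(1)[OF \<phi>(1), of 0] test_functionsD(1)[OF \<psi>(1), of 0]
      by (simp_all add: borel_measurable_continuous_onI)
    let ?I = "\<lambda>f. \<integral>\<^sup>+ x\<in>frontier \<Omega> \<inter> K. ennreal ((f x)\<^sup>2) \<partial>surface_measure"
    have bound: "?I (\<lambda>x. \<phi> n x + \<psi> n x) \<le> 2 * ?I (\<phi> n) + 2 * ?I (\<psi> n)" for n
    proof -
      have "?I (\<lambda>x. \<phi> n x + \<psi> n x) \<le>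
        (\<integral>\<^sup>+ x. 2 * (ennreal ((\<phi> n x)\<^sup>2) * indicator (frontier \<Omega> \<inter> K) x) +
          2 * (ennreal ((\<psi> n x)\<^sup>2) * indicator (frontier \<Omega> \<inter> K) x) \<partial>surface_measure)"
      proof (intro nn_integral_mono)
        fix x
        have "(\<phi> n x + \<psi> n x)\<^sup>2 \<le> 2 * (\<phi> n x)\<^sup>2 + 2 * (\<psi> n x)\<^sup>2"
          using sum_squares_bound[of "\<phi> n x" "\<psi> n x"] by (simp add: power2_sum)
        then have "ennreal ((\<phi> n x + \<psi> n x)\<^sup>2) \<le> 2 * ennreal ((\<phi> n x)\<^sup>2) + 2 * ennreal ((\<psi> n x)\<^sup>2)"
          by (simp add: ennreal_mult'[symmetric] ennreal_plus[symmetric] ennreal_leI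
              flip: ennreal_numeral del: ennreal_plus)
        then show "ennreal ((\<phi> n x + \<psi> n x)\<^sup>2) * indicator (frontier \<Omega> \<inter> K) x \<le>
            2 * (ennreal ((\<phi> n x)\<^sup>2) * indicator (frontier \<Omega> \<inter> K) x) +
            2 * (ennreal ((\<psi> n x)\<^sup>2) * indicator (frontier \<Omega> \<inter> K) x)"
          by (simp add: indicator_def)
      qed
      also have "\<dots> = 2 * ?I (\<phi> n) + 2 * ?I (\<psi> n)"
        by (subst nn_integral_add) (auto simp: nn_integral_cmult)
      finally show ?thesis .
    qed
    have "(\<lambda>n. 2 * ?I (\<phi> n) + 2 * ?I (\<psi> n)) \<longlonglongrightarrow> 2 * 0 + 2 * 0"
      by (intro tendsto_add ennreal_tendsto_cmult \<phi>(3) \<psi>(3) K) simp_all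
    then have lim: "(\<lambda>n. 2 * ?I (\<phi> n) + 2 * ?I (\<psi> n)) \<longlonglongrightarrow> 0"
      by simp
    have "(\<lambda>n. ?I (\<lambda>x. \<phi> n x + \<psi> n x)) \<longlonglongrightarrow> 0"
      by (rule tendsto_sandwich[OF _ _ tendsto_const lim]; rule always_eventually; rule allI)
        (simp, rule bound)
    then show "(\<lambda>n. \<integral>\<^sup>+ x\<in>frontier \<Omega> \<inter> K. ennreal ((\<phi> n x + \<psi> n x - 0)\<^sup>2) \<partial>surface_measure) \<longlonglongrightarrow> 0"
      by simp
  qed
qed

lemma has_trace_zero_scale:
  fixes \<Omega> :: "'a::euclidean_space set"
  assumes \<Omega>: "open \<Omega>" and u: "u \<in> carr (H1_space \<Omega>)" "has_trace \<Omega> u (\<lambda>_. 0)"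
  shows "has_trace \<Omega> (\<lambda>x. c * u x) (\<lambda>_. 0)"
proof -
  note H1 = seminormed_H1_space[OF \<Omega>]
  obtain \<phi> where \<phi>: "\<And>n. \<phi> n \<in> test_functions UNIV"
      "(\<lambda>n. nrm (H1_space \<Omega>) (\<phi> n - u)) \<longlonglongrightarrow> 0"
      "\<And>K. compact K \<Longrightarrow> (\<lambda>n. \<integral>\<^sup>+ x\<in>frontier \<Omega> \<inter> K. ennreal ((\<phi> n x)\<^sup>2) \<partial>surface_measure) \<longlonglongrightarrow> 0"
    using u(2) by (auto simp: has_trace_def)
  have mem: "\<phi> n - u \<in> carr (H1_space \<Omega>)" for n
    using test_function_diff_H1[OF \<Omega>] \<phi>(1) u(1) by blast
  show ?thesis
    unfolding has_trace_def
  proof (intro exI[of _ "\<lambda>n x. c * \<phi> n x"] conjI allI impI)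
    show "(\<lambda>x. c * \<phi> n x) \<in> test_functions UNIV" for n
      using \<phi> by (intro test_functions_mult C_k_const)
    have *: "(\<lambda>x. c * \<phi> n x) - (\<lambda>x. c * u x) = (\<lambda>x. c * (\<phi> n - u) x)" for n
      by (auto simp: fun_eq_iff right_diff_distrib)
    show "(\<lambda>n. nrm (H1_space \<Omega>) ((\<lambda>x. c * \<phi> n x) - (\<lambda>x. c * u x))) \<longlonglongrightarrow> 0"
      unfolding * using tendsto_mult_right_zero[OF \<phi>(2)] by (simp only: seminormed_scale_nrm[OF H1 mem])
    fix K :: "'a set" assume K: "compact K"
    have A [measurable]: "frontier \<Omega> \<inter> K \<in> sets borel"
      using K by (intro sets.Int) (simp_all add: frontier_closed compact_imp_closed borel_closed)
    have meas [measurable]: "\<phi> n \<in> borel_measurable borel" for n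
      using test_functionsD(1)[OF \<phi>(1), of 0] by (simp add: borel_measurable_continuous_onI)
    let ?I = "\<lambda>f. \<integral>\<^sup>+ x\<in>frontier \<Omega> \<inter> K. ennreal ((f x)\<^sup>2) \<partial>surface_measure"
    have "?I (\<lambda>x. c * \<phi> n x) = ennreal (c\<^sup>2) * ?I (\<phi> n)" for n
      by (subst nn_integral_cmult[symmetric]) (simp_all add: power_mult_distrib ennreal_mult' mult.assoc)
    moreover have "(\<lambda>n. ennreal (c\<^sup>2) * ?I (\<phi> n)) \<longlonglongrightarrow> ennreal (c\<^sup>2) * 0"
      by (intro ennreal_tendsto_cmult \<phi>(3) K) simp
    ultimately show "(\<lambda>n. \<integral>\<^sup>+ x\<in>frontier \<Omega> \<inter> K. ennreal ((c * \<phi> n x - 0)\<^sup>2) \<partial>surface_measure) \<longlonglongrightarrow> 0"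
      by simp
  qed
qed

lemma seminormed_H1_tilde:
  assumes \<Omega>: "open \<Omega>"
  shows "seminormed (H1_tilde \<Omega>)"
proof -
  note H1 = seminormed_H1_space[OF \<Omega>]
  have zero: "has_trace \<Omega> 0 (\<lambda>_. 0)"
    unfolding has_trace_def
  proof (intro exI[of _ "\<lambda>n x. 0"] conjI allI impI)
    show "(\<lambda>x. 0) \<in> test_functions UNIV"
      by (simp add: test_functions_def C_k_const)
    show "(\<lambda>n. nrm (H1_space \<Omega>) ((\<lambda>x. 0) - 0)) \<longlonglongrightarrow> 0"
      using seminormed_nrm_0[OF H1] by (simp add: zero_fun_def fun_diff_def)
  qed simp
  show ?thesis
    using H1 zero has_trace_zero_add[OF \<Omega>] has_trace_zero_scale[OF \<Omega>]
    unfolding seminormed_def H1_tilde_def by simp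
qed

section \<open>Dual spaces and interpolation\<close>

lemma dual_iff:
  "\<phi> \<in> carr (dual X) \<longleftrightarrow>
    (\<forall>u\<in>carr X. \<forall>v\<in>carr X. \<phi> (u + v) = \<phi> u + \<phi> v) \<and>
    (\<forall>c. \<forall>u\<in>carr X. \<phi> (\<lambda>x. c * u x) = c * \<phi> u) \<and>
    (\<exists>C. \<forall>u\<in>carr X. \<bar>\<phi> u\<bar> \<le> C * nrm X u) \<and>
    (\<forall>u. u \<notin> carr X \<longrightarrow> \<phi> u = 0)"
  by (simp add: dual_def)

text \<open>The supremum contains quotients by a vanishing seminorm. In HOL these are 0 and do no
  harm, because the boundedness of \<phi> forces it to vanish there as well; boundedness also makes
  the supremum a genuine one.\<close>

lemma dual_nrm_bound:
  assumes X: "\<And>u. u \<in> carr X \<Longrightarrow> 0 \<le> nrm X u"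
    and \<phi>: "\<phi> \<in> carr (dual X)" and u: "u \<in> carr X"
  shows "\<bar>\<phi> u\<bar> \<le> nrm (dual X) \<phi> * nrm X u"
proof -
  obtain C where "\<forall>u\<in>carr X. \<bar>\<phi> u\<bar> \<le> C * nrm X u"
    using \<phi> by (auto simp: dual_def)
  then have C: "\<bar>\<phi> u\<bar> \<le> C * nrm X u" if "u \<in> carr X" for u using that by blast
  show ?thesis
  proof (cases "nrm X u = 0")
    case True
    then show ?thesis using C[OF u] by simp
  next
    case False
    then have pos: "0 < nrm X u" using X[OF u] by simp
    have "\<bar>\<phi> w\<bar> / nrm X w \<le> \<bar>C\<bar>" if "w \<in> carr X" for w
      using order_trans[OF C[OF that] mult_right_mono[OF abs_ge_self X[OF that]]] X[OF that]
      by (cases "nrm X w = 0") (auto simp: divide_le_eq)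
    then have "bdd_above ((\<lambda>u. \<bar>\<phi> u\<bar> / nrm X u) ` carr X)"
      by (rule bdd_aboveI2)
    then have "\<bar>\<phi> u\<bar> / nrm X u \<le> nrm (dual X) \<phi>"
      using u by (auto simp: dual_def intro: cSUP_upper)
    then show ?thesis using pos by (simp add: divide_le_eq)
  qed
qed

lemma dual_nrm_le:
  assumes "carr X \<noteq> {}" and X: "\<And>u. u \<in> carr X \<Longrightarrow> 0 \<le> nrm X u" and "0 \<le> C"
    and C: "\<And>u. u \<in> carr X \<Longrightarrow> \<bar>\<phi> u\<bar> \<le> C * nrm X u"
  shows "nrm (dual X) \<phi> \<le> C"
proof -
  have "\<bar>\<phi> w\<bar> / nrm X w \<le> C" if "w \<in> carr X" for w
    using C[OF that] X[OF that] \<open>0 \<le> C\<close> by (cases "nrm X w = 0") (auto simp: divide_le_eq)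
  then show ?thesis using \<open>carr X \<noteq> {}\<close> by (auto simp: dual_def intro: cSUP_least)
qed

text \<open>A negative supremum would make \<phi> vanish on the carrier by
  \<open>dual_nrm_bound\<close>; but then all quotients are 0, and so is their supremum over the
  nonempty carrier.\<close>

lemma dual_nrm_nonneg:
  assumes "carr X \<noteq> {}" and X: "\<And>u. u \<in> carr X \<Longrightarrow> 0 \<le> nrm X u" and \<phi>: "\<phi> \<in> carr (dual X)"
  shows "0 \<le> nrm (dual X) \<phi>"
proof (rule ccontr)
  assume neg: "\<not> ?thesis"
  have *: "\<phi> w = 0" if "w \<in> carr X" for w
    using dual_nrm_bound[of X \<phi> w, OF X \<phi> that] X[OF that] neg
    by (smt (verit) mult_nonpos_nonneg)
  then have "nrm (dual X) \<phi> = (SUP u\<in>carr X. 0)"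
    by (simp add: dual_def)
  then show False using neg assms(1) by simp
qed

lemma seminormed_dual:
  assumes ne: "carr X \<noteq> {}" and X: "\<And>u. u \<in> carr X \<Longrightarrow> 0 \<le> nrm X u"
  shows "seminormed (dual X)"
  unfolding seminormed_def
proof (intro conjI ballI allI)
  show "0 \<in> carr (dual X)"
    by (auto simp: dual_def intro!: exI[of _ 0])
next
  fix \<phi> assume "\<phi> \<in> carr (dual X)"
  then show "0 \<le> nrm (dual X) \<phi>" using ne X by (intro dual_nrm_nonneg)
next
  fix \<phi> \<psi> assume \<phi>: "\<phi> \<in> carr (dual X)" and \<psi>: "\<psi> \<in> carr (dual X)"
  have b: "\<bar>(\<phi> + \<psi>) u\<bar> \<le> (nrm (dual X) \<phi> + nrm (dual X) \<psi>) * nrm X u" if "u \<in> carr X" for u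
    using dual_nrm_bound[of X \<phi> u, OF X \<phi> that] dual_nrm_bound[of X \<psi> u, OF X \<psi> that]
    by (simp add: distrib_right)
  show "\<phi> + \<psi> \<in> carr (dual X)"
    unfolding dual_iff
  proof (intro conjI)
    show "\<exists>C. \<forall>u\<in>carr X. \<bar>(\<phi> + \<psi>) u\<bar> \<le> C * nrm X u"
      using b by blast
  qed (use \<phi> \<psi> in \<open>auto simp: dual_iff algebra_simps\<close>)
  show "nrm (dual X) (\<phi> + \<psi>) \<le> nrm (dual X) \<phi> + nrm (dual X) \<psi>"
    using dual_nrm_nonneg[of X, OF ne X] \<phi> \<psi> b by (intro dual_nrm_le[OF ne X] add_nonneg_nonneg)
next
  fix c \<phi> assume \<phi>: "\<phi> \<in> carr (dual X)"
  \<comment> \<open>Only one inequality is shown, for all scalars and functionals; equality follows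
    by applying it to \<open>c\<close> and then to \<open>1 / c\<close>.\<close>
  have scale: "(\<lambda>u. c * \<phi> u) \<in> carr (dual X)" "nrm (dual X) (\<lambda>u. c * \<phi> u) \<le> \<bar>c\<bar> * nrm (dual X) \<phi>"
    if \<phi>: "\<phi> \<in> carr (dual X)" for c \<phi>
  proof -
    have b: "\<bar>c * \<phi> u\<bar> \<le> (\<bar>c\<bar> * nrm (dual X) \<phi>) * nrm X u" if "u \<in> carr X" for u
      using mult_left_mono[OF dual_nrm_bound[of X \<phi> u, OF X \<phi> that], of "\<bar>c\<bar>"]
      by (simp add: abs_mult mult.assoc)
    show "(\<lambda>u. c * \<phi> u) \<in> carr (dual X)"
      unfolding dual_iff
    proof (intro conjI)
      show "\<exists>C. \<forall>u\<in>carr X. \<bar>c * \<phi> u\<bar> \<le> C * nrm X u"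
        using b by blast
    qed (use \<phi> in \<open>auto simp: dual_iff algebra_simps\<close>)
    show "nrm (dual X) (\<lambda>u. c * \<phi> u) \<le> \<bar>c\<bar> * nrm (dual X) \<phi>"
      using b dual_nrm_nonneg[of X, OF ne X \<phi>] by (intro dual_nrm_le[OF ne X]) auto
  qed
  show "(\<lambda>u. c * \<phi> u) \<in> carr (dual X)" by (rule scale(1)[OF \<phi>])
  show "nrm (dual X) (\<lambda>u. c * \<phi> u) = \<bar>c\<bar> * nrm (dual X) \<phi>"
  proof (cases "c = 0")
    case True
    then show ?thesis
      using scale(2)[OF \<phi>, of c] dual_nrm_nonneg[of X, OF ne X scale(1)[OF \<phi>, of c]] by simp
  next
    case False
    then have "nrm (dual X) \<phi> \<le> \<bar>1 / c\<bar> * nrm (dual X) (\<lambda>u. c * \<phi> u)"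
      using scale(2)[OF scale(1)[OF \<phi>, of c], of "1 / c"] by simp
    then show ?thesis
      using False scale(2)[OF \<phi>, of c] by (simp add: field_simps)
  qed
qed

section \<open>The K-functional and real interpolation spaces\<close>

context
  fixes X0 X1 :: "('x \<Rightarrow> real) nspace"
  assumes X0: "seminormed X0" and X1: "seminormed X1"
begin

lemma K_functional_le:
  assumes "0 \<le> t" "u0 \<in> carr X0" "u1 \<in> carr X1"
  shows "K_functional X0 X1 t (u0 + u1) \<le> nrm X0 u0 + t * nrm X1 u1"
  unfolding K_functional_def
proof (rule cInf_lower)
  show "bdd_below {nrm X0 u0' + t * nrm X1 u1' |u0' u1'. u0' \<in> carr X0 \<and> u1' \<in> carr X1 \<and> u0 + u1 = u0' + u1'}"
    using assms seminormed_nonneg[OF X0] seminormed_nonneg[OF X1]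
    by (intro bdd_belowI[of _ 0]) auto
qed (use assms in blast)

text \<open>The decomposition in the first three hypotheses makes the set nonempty; a real
  \<open>Inf\<close> of the empty set would carry no information.\<close>

lemma K_functional_greatest:
  assumes "u0 \<in> carr X0" "u1 \<in> carr X1" "u = u0 + u1"
    and "\<And>u0 u1. u0 \<in> carr X0 \<Longrightarrow> u1 \<in> carr X1 \<Longrightarrow> u = u0 + u1 \<Longrightarrow> c \<le> nrm X0 u0 + t * nrm X1 u1"
  shows "c \<le> K_functional X0 X1 t u"
  unfolding K_functional_def using assms by (intro cInf_greatest) blast+

lemma K_functional_nonneg:
  assumes "0 \<le> t" "u0 \<in> carr X0" "u1 \<in> carr X1" "u = u0 + u1"
  shows "0 \<le> K_functional X0 X1 t u"
  using assms seminormed_nonneg[OF X0] seminormed_nonneg[OF X1]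
  by (intro K_functional_greatest[OF assms(2-4)]) auto

lemma K_functional_mono:
  assumes "0 \<le> s" "s \<le> t" "u0 \<in> carr X0" "u1 \<in> carr X1" "u = u0 + u1"
  shows "K_functional X0 X1 s u \<le> K_functional X0 X1 t u"
proof (rule K_functional_greatest[OF assms(3-5)])
  fix v0 v1 assume v: "v0 \<in> carr X0" "v1 \<in> carr X1" "u = v0 + v1"
  have "K_functional X0 X1 s u \<le> nrm X0 v0 + s * nrm X1 v1"
    using v assms K_functional_le by blast
  also have "\<dots> \<le> nrm X0 v0 + t * nrm X1 v1"
    using assms seminormed_nonneg[OF X1 v(2)] by (simp add: mult_right_mono)
  finally show "K_functional X0 X1 s u \<le> nrm X0 v0 + t * nrm X1 v1" .
qed

lemma K_functional_add:
  assumes t: "0 \<le> t" and u: "u0 \<in> carr X0" "u1 \<in> carr X1" "u = u0 + u1"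
    and v: "v0 \<in> carr X0" "v1 \<in> carr X1" "v = v0 + v1"
  shows "K_functional X0 X1 t (u + v) \<le> K_functional X0 X1 t u + K_functional X0 X1 t v"
proof -
  have 1: "K_functional X0 X1 t (u + v) \<le> (nrm X0 a0 + t * nrm X1 a1) + (nrm X0 b0 + t * nrm X1 b1)"
    if "a0 \<in> carr X0" "a1 \<in> carr X1" "u = a0 + a1" "b0 \<in> carr X0" "b1 \<in> carr X1" "v = b0 + b1"
    for a0 a1 b0 b1
  proof -
    have "u + v = (a0 + b0) + (a1 + b1)" using that by (simp add: algebra_simps)
    then have "K_functional X0 X1 t (u + v) \<le> nrm X0 (a0 + b0) + t * nrm X1 (a1 + b1)"
      using K_functional_le[OF t seminormed_add[OF X0] seminormed_add[OF X1]] that by metis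
    also have "\<dots> \<le> (nrm X0 a0 + nrm X0 b0) + t * (nrm X1 a1 + nrm X1 b1)"
      using that t seminormed_triangle[OF X0] seminormed_triangle[OF X1]
      by (intro add_mono mult_left_mono) auto
    finally show ?thesis by (simp add: algebra_simps)
  qed
  \<comment> \<open>The two infima are taken one after the other: over the decompositions of
    \<open>v\<close> here, over those of \<open>u\<close> below.\<close>
  have 2: "K_functional X0 X1 t (u + v) - (nrm X0 a0 + t * nrm X1 a1) \<le> K_functional X0 X1 t v"
    if "a0 \<in> carr X0" "a1 \<in> carr X1" "u = a0 + a1" for a0 a1
  proof (rule K_functional_greatest[OF v])
    show "K_functional X0 X1 t (u + v) - (nrm X0 a0 + t * nrm X1 a1) \<le> nrm X0 b0 + t * nrm X1 b1"
      if "b0 \<in> carr X0" "b1 \<in> carr X1" "v = b0 + b1" for b0 b1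
      using 1[OF \<open>a0 \<in> _\<close> \<open>a1 \<in> _\<close> \<open>u = a0 + a1\<close> that] by simp
  qed
  have "K_functional X0 X1 t (u + v) - K_functional X0 X1 t v \<le> K_functional X0 X1 t u"
  proof (rule K_functional_greatest[OF u])
    show "K_functional X0 X1 t (u + v) - K_functional X0 X1 t v \<le> nrm X0 a0 + t * nrm X1 a1"
      if "a0 \<in> carr X0" "a1 \<in> carr X1" "u = a0 + a1" for a0 a1
      using 2[OF that] by simp
  qed
  then show ?thesis by simp
qed

lemma K_functional_scale:
  assumes t: "0 \<le> t" and u: "u0 \<in> carr X0" "u1 \<in> carr X1" "u = u0 + u1"
  shows "K_functional X0 X1 t (\<lambda>x. c * u x) \<le> \<bar>c\<bar> * K_functional X0 X1 t u"
proof -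
  have 1: "K_functional X0 X1 t (\<lambda>x. c * u x) \<le> \<bar>c\<bar> * (nrm X0 a0 + t * nrm X1 a1)"
    if "a0 \<in> carr X0" "a1 \<in> carr X1" "u = a0 + a1" for a0 a1
  proof -
    have "(\<lambda>x. c * u x) = (\<lambda>x. c * a0 x) + (\<lambda>x. c * a1 x)"
      using that by (auto simp: algebra_simps)
    then have "K_functional X0 X1 t (\<lambda>x. c * u x) \<le> nrm X0 (\<lambda>x. c * a0 x) + t * nrm X1 (\<lambda>x. c * a1 x)"
      using K_functional_le[OF t seminormed_scale[OF X0 that(1)] seminormed_scale[OF X1 that(2)]] by metis
    then show ?thesis
      using seminormed_scale_nrm[OF X0 that(1)] seminormed_scale_nrm[OF X1 that(2)]
      by (simp add: algebra_simps)
  qed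
  show ?thesis
  proof (cases "c = 0")
    case True
    then show ?thesis using 1[OF u] by simp
  next
    case False
    have "K_functional X0 X1 t (\<lambda>x. c * u x) / \<bar>c\<bar> \<le> K_functional X0 X1 t u"
    proof (rule K_functional_greatest[OF u])
      show "K_functional X0 X1 t (\<lambda>x. c * u x) / \<bar>c\<bar> \<le> nrm X0 a0 + t * nrm X1 a1"
        if "a0 \<in> carr X0" "a1 \<in> carr X1" "u = a0 + a1" for a0 a1
        using 1[OF that] False by (simp add: field_simps)
    qed
    then show ?thesis using False by (simp add: field_simps)
  qed
qed

text \<open>As a function of \<open>t\<close> the K-functional is increasing, hence Borel
  measurable.\<close>

lemma K_integrand_measurable:
  assumes "u0 \<in> carr X0" "u1 \<in> carr X1" "u = u0 + u1"
  shows "(\<lambda>t. ennreal ((t powr (- \<theta>) * K_functional X0 X1 t u)\<^sup>2 / t)) \<in> borel_measurable (lebesgue_on {0<..})"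
proof -
  have "mono_on {0<..} (\<lambda>t. K_functional X0 X1 t u)"
    using K_functional_mono[OF _ _ assms] by (auto simp: mono_on_def)
  then have "(\<lambda>t. K_functional X0 X1 t u) \<in> borel_measurable (restrict_space borel {0<..})"
    by (rule borel_measurable_mono_on_fnc)
  then have [measurable]: "(\<lambda>t. K_functional X0 X1 t u) \<in> borel_measurable (lebesgue_on {0<..})"
    by (auto simp: measurable_def sets_restrict_space space_restrict_space)
  have [measurable]: "(\<lambda>t::real. t) \<in> borel_measurable (lebesgue_on {0<..})"
    by (intro measurable_restrict_space1 measurable_completion) simp
  show ?thesis by measurable
qed

lemma interpolation_space_iff:
  "u \<in> carr (interpolation_space X0 X1 \<theta>) \<longleftrightarrow>
    (\<exists>u0\<in>carr X0. \<exists>u1\<in>carr X1. u = u0 + u1) \<and> K_integral X0 X1 \<theta> u < \<infinity>"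
  by (simp add: interpolation_space_def)

text \<open>Membership means finiteness of the integral, for which subadditivity of K and (a + b)^2
  \<le> 2 a^2 + 2 b^2 suffice.\<close>

lemma interpolation_space_add:
  assumes "u \<in> carr (interpolation_space X0 X1 \<theta>)" "v \<in> carr (interpolation_space X0 X1 \<theta>)"
  shows "u + v \<in> carr (interpolation_space X0 X1 \<theta>)"
proof -
  obtain u0 u1 where u: "u0 \<in> carr X0" "u1 \<in> carr X1" "u = u0 + u1" "K_integral X0 X1 \<theta> u < \<infinity>"
    using assms(1) by (auto simp: interpolation_space_iff)
  obtain v0 v1 where v: "v0 \<in> carr X0" "v1 \<in> carr X1" "v = v0 + v1" "K_integral X0 X1 \<theta> v < \<infinity>"
    using assms(2) by (auto simp: interpolation_space_iff)
  let ?I = "\<lambda>w t. (t powr (- \<theta>) * K_functional X0 X1 t w)\<^sup>2 / t"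
  have uv: "u + v = (u0 + v0) + (u1 + v1)" using u v by (simp add: algebra_simps)
  have mem: "u0 + v0 \<in> carr X0" "u1 + v1 \<in> carr X1"
    using u v by (auto intro: seminormed_add[OF X0] seminormed_add[OF X1])
  have "K_integral X0 X1 \<theta> (u + v) \<le>
      (\<integral>\<^sup>+ t. 2 * ennreal (?I u t) + 2 * ennreal (?I v t) \<partial>lebesgue_on {0<..})"
    unfolding K_integral_def
  proof (intro nn_integral_mono)
    fix t :: real assume "t \<in> space (lebesgue_on {0<..})"
    then have t: "0 < t" by (simp add: space_restrict_space)
    let ?p = "t powr (- \<theta>)"
    let ?K = "K_functional X0 X1 t"
    have "?K (u + v) \<le> ?K u + ?K v"
      using t u v by (intro K_functional_add) auto
    then have "?p * ?K (u + v) \<le> ?p * ?K u + ?p * ?K v"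
      by (metis distrib_left mult_left_mono powr_ge_zero)
    moreover have "0 \<le> ?p * ?K (u + v)"
      using t K_functional_nonneg[OF _ mem uv] by simp
    ultimately have "(?p * ?K (u + v))\<^sup>2 \<le> (?p * ?K u + ?p * ?K v)\<^sup>2"
      by (intro power_mono)
    also have "\<dots> \<le> 2 * (?p * ?K u)\<^sup>2 + 2 * (?p * ?K v)\<^sup>2"
      using sum_squares_bound[of "?p * ?K u" "?p * ?K v"] unfolding power2_sum by linarith
    finally have "?I (u + v) t \<le> 2 * ?I u t + 2 * ?I v t"
      using t by (simp add: field_simps)
    then have "ennreal (?I (u + v) t) \<le> ennreal (2 * ?I u t + 2 * ?I v t)"
      by (rule ennreal_leI)
    also have "\<dots> = 2 * ennreal (?I u t) + 2 * ennreal (?I v t)"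
      using t by (subst ennreal_plus) (auto simp: ennreal_mult' simp del: times_divide_eq_right)
    finally show "ennreal (?I (u + v) t) \<le> 2 * ennreal (?I u t) + 2 * ennreal (?I v t)" .
  qed
  also have "\<dots> = 2 * K_integral X0 X1 \<theta> u + 2 * K_integral X0 X1 \<theta> v"
    using K_integrand_measurable[OF u(1-3), of \<theta>] K_integrand_measurable[OF v(1-3), of \<theta>]
    unfolding K_integral_def by (subst nn_integral_add) (auto simp: nn_integral_cmult)
  also have "\<dots> < \<infinity>"
    using u(4) v(4) by (simp add: ennreal_mult_less_top)
  finally show ?thesis
    using uv mem by (auto simp: interpolation_space_iff)
qed

lemma interpolation_space_scale:
  assumes "u \<in> carr (interpolation_space X0 X1 \<theta>)"
  shows "(\<lambda>x. c * u x) \<in> carr (interpolation_space X0 X1 \<theta>)"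
proof -
  obtain u0 u1 where u: "u0 \<in> carr X0" "u1 \<in> carr X1" "u = u0 + u1" "K_integral X0 X1 \<theta> u < \<infinity>"
    using assms(1) by (auto simp: interpolation_space_iff)
  let ?I = "\<lambda>w t. (t powr (- \<theta>) * K_functional X0 X1 t w)\<^sup>2 / t"
  have cu: "(\<lambda>x. c * u x) = (\<lambda>x. c * u0 x) + (\<lambda>x. c * u1 x)"
    using u by (auto simp: algebra_simps)
  have mem: "(\<lambda>x. c * u0 x) \<in> carr X0" "(\<lambda>x. c * u1 x) \<in> carr X1"
    using u by (auto intro: seminormed_scale[OF X0] seminormed_scale[OF X1])
  have "K_integral X0 X1 \<theta> (\<lambda>x. c * u x) \<le> (\<integral>\<^sup>+ t. ennreal (c\<^sup>2) * ennreal (?I u t) \<partial>lebesgue_on {0<..})"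
    unfolding K_integral_def
  proof (intro nn_integral_mono)
    fix t :: real assume "t \<in> space (lebesgue_on {0<..})"
    then have t: "0 < t" by (simp add: space_restrict_space)
    let ?p = "t powr (- \<theta>)"
    let ?K = "K_functional X0 X1 t"
    have "?p * ?K (\<lambda>x. c * u x) \<le> \<bar>c\<bar> * (?p * ?K u)"
      using t u mult_left_mono[OF K_functional_scale[of t u0 u1 u c], of ?p] by (simp add: algebra_simps)
    moreover have "0 \<le> ?p * ?K (\<lambda>x. c * u x)"
      using t K_functional_nonneg[OF _ mem cu] by simp
    ultimately have "(?p * ?K (\<lambda>x. c * u x))\<^sup>2 \<le> (\<bar>c\<bar> * (?p * ?K u))\<^sup>2"
      by (intro power_mono)
    then have "?I (\<lambda>x. c * u x) t \<le> c\<^sup>2 * ?I u t"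
      using t by (simp add: power_mult_distrib divide_right_mono)
    then have "ennreal (?I (\<lambda>x. c * u x) t) \<le> ennreal (c\<^sup>2 * ?I u t)"
      by (rule ennreal_leI)
    also have "\<dots> = ennreal (c\<^sup>2) * ennreal (?I u t)"
      by (rule ennreal_mult') simp
    finally show "ennreal (?I (\<lambda>x. c * u x) t) \<le> ennreal (c\<^sup>2) * ennreal (?I u t)" .
  qed
  also have "\<dots> = ennreal (c\<^sup>2) * K_integral X0 X1 \<theta> u"
    using K_integrand_measurable[OF u(1-3), of \<theta>]
    unfolding K_integral_def by (rule nn_integral_cmult)
  also have "\<dots> < \<infinity>"
    using u(4) by (simp add: ennreal_mult_less_top)
  finally show ?thesis
    using cu mem by (auto simp: interpolation_space_iff)
qed

lemma interpolation_space_zero: "0 \<in> carr (interpolation_space X0 X1 \<theta>)"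
proof -
  have K0: "K_functional X0 X1 t 0 = 0" if "0 < t" for t
    using K_functional_le[of t 0 0] K_functional_nonneg[of t 0 0 0] that
      seminormed_zero[OF X0] seminormed_zero[OF X1] seminormed_nrm_0[OF X0] seminormed_nrm_0[OF X1]
    by simp
  have "K_integral X0 X1 \<theta> 0 = (\<integral>\<^sup>+ t. 0 \<partial>lebesgue_on {0::real<..})"
    unfolding K_integral_def by (intro nn_integral_cong) (simp add: space_restrict_space K0)
  then show ?thesis
    using seminormed_zero[OF X0] seminormed_zero[OF X1]
    by (auto simp: interpolation_space_iff intro!: bexI[of _ 0])
qed

text \<open>Since \<open>K\<close> is increasing, the part of the integral over \<open>[t, 2 t]\<close> bounds \<open>K t\<close>.\<close>

lemma K_functional_le_interpolation_nrm:
  assumes \<theta>: "0 \<le> \<theta>" "\<theta> \<le> 1" and t: "0 < t" and u: "u \<in> carr (interpolation_space X0 X1 \<theta>)"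
  shows "K_functional X0 X1 t u \<le> 3 * t powr \<theta> * nrm (interpolation_space X0 X1 \<theta>) u"
proof -
  obtain u0 u1 where u01: "u0 \<in> carr X0" "u1 \<in> carr X1" "u = u0 + u1" and fin: "K_integral X0 X1 \<theta> u < \<infinity>"
    using u by (auto simp: interpolation_space_iff)
  let ?k = "K_functional X0 X1 t u"
  \<comment> \<open>The least possible value of the integrand on [t, 2 t]: the powers of the
    variable decrease, so they are taken at 2 t, and K increases, so it is taken at t.\<close>
  define c where "c = ((2 * t) powr (- \<theta>) * ?k)\<^sup>2 / (2 * t)"
  have k: "0 \<le> ?k" using t u01 by (intro K_functional_nonneg) auto
  have c: "0 \<le> c" using t by (simp add: c_def)
  have "emeasure (lebesgue_on {0<..}) {t..2 * t} = ennreal t"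
    using t by (subst emeasure_restrict_space) auto
  moreover have "{t..2 * t} \<in> sets (lebesgue_on {0<..})"
    using t by (auto simp: sets_restrict_space intro!: image_eqI[of _ _ "{t..2 * t}"])
  ultimately have "ennreal (c * t) = (\<integral>\<^sup>+ r. ennreal c * indicator {t..2 * t} r \<partial>lebesgue_on {0<..})"
    using c by (simp add: nn_integral_cmult_indicator ennreal_mult')
  also have "\<dots> \<le> K_integral X0 X1 \<theta> u"
    unfolding K_integral_def
  proof (intro nn_integral_mono)
    fix r :: real
    have "c \<le> (r powr (- \<theta>) * K_functional X0 X1 r u)\<^sup>2 / r" if r: "t \<le> r" "r \<le> 2 * t"
    proof -
      have "(2 * t) powr (- \<theta>) \<le> r powr (- \<theta>)"
        using r t \<theta> by (intro powr_mono2') auto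
      moreover have "?k \<le> K_functional X0 X1 r u"
        using r t u01 by (intro K_functional_mono) auto
      ultimately have "(2 * t) powr (- \<theta>) * ?k \<le> r powr (- \<theta>) * K_functional X0 X1 r u"
        using k by (intro mult_mono) auto
      then show ?thesis
        unfolding c_def using r t k by (intro frac_le power_mono) auto
    qed
    then show "ennreal c * indicator {t..2 * t} r \<le>
        ennreal ((r powr (- \<theta>) * K_functional X0 X1 r u)\<^sup>2 / r)"
      by (simp add: indicator_def ennreal_leI)
  qed
  finally have "ennreal (c * t) \<le> ennreal (enn2real (K_integral X0 X1 \<theta> u))"
    using fin by simp
  then have "c * t \<le> (nrm (interpolation_space X0 X1 \<theta>) u)\<^sup>2"
    by (simp add: interpolation_space_def)
  moreover have "c * t = ((2 * t) powr (- \<theta>))\<^sup>2 * ?k\<^sup>2 / 2"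
    using t by (simp add: c_def power_mult_distrib)
  moreover have "(2 * t) powr (- \<theta>) \<ge> inverse (2 * t powr \<theta>)"
  proof -
    have "(2 * t) powr \<theta> \<le> 2 * t powr \<theta>"
      using t \<theta> powr_mono[of \<theta> 1 2] by (simp add: powr_mult)
    then show ?thesis
      unfolding powr_minus using t by (intro le_imp_inverse_le) auto
  qed
  then have "(inverse (2 * t powr \<theta>))\<^sup>2 \<le> ((2 * t) powr (- \<theta>))\<^sup>2"
    by (intro power_mono) auto
  then have "(inverse (2 * t powr \<theta>))\<^sup>2 * ?k\<^sup>2 \<le> ((2 * t) powr (- \<theta>))\<^sup>2 * ?k\<^sup>2"
    by (rule mult_right_mono) simp
  ultimately have "(inverse (2 * t powr \<theta>))\<^sup>2 * ?k\<^sup>2 \<le> 2 * (nrm (interpolation_space X0 X1 \<theta>) u)\<^sup>2"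
    by simp
  then have "?k\<^sup>2 \<le> 2 * (nrm (interpolation_space X0 X1 \<theta>) u)\<^sup>2 * (2 * t powr \<theta>)\<^sup>2"
    using t by (simp add: field_simps power_mult_distrib)
  \<comment> \<open>The 8 is 2 times 4: the 2 is the quotient of 2 t by the length t of the
    interval, the 4 is the square of the bound 2 for \<open>2 powr \<theta>\<close>. Rounding up to
    9 yields the constant 3.\<close>
  also have "\<dots> = 8 * (t powr \<theta> * nrm (interpolation_space X0 X1 \<theta>) u)\<^sup>2"
    by (simp add: power_mult_distrib algebra_simps)
  also have "\<dots> \<le> (3 * t powr \<theta> * nrm (interpolation_space X0 X1 \<theta>) u)\<^sup>2"
    by (simp add: power_mult_distrib)
  finally show ?thesis
    by (rule power2_le_imp_le) (simp add: interpolation_space_def)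
qed

end

section \<open>The scale \<open>H_tilde\<close> and the interpolation inequality for the
  pairing\<close>

lemma H_tilde_0: "H_tilde \<Omega> 0 = L2_space \<Omega>" and H_tilde_1: "H_tilde \<Omega> 1 = H1_tilde \<Omega>"
  and H_tilde_between: "0 < \<sigma> \<Longrightarrow> \<sigma> < 1 \<Longrightarrow> H_tilde \<Omega> \<sigma> = interpolation_space (L2_space \<Omega>) (H1_tilde \<Omega>) \<sigma>"
  by (simp_all add: H_tilde_def)

lemma H1_tilde_L2: "u \<in> carr (H1_tilde \<Omega>) \<Longrightarrow> u \<in> carr (L2_space \<Omega>)"
  by (simp add: H1_tilde_def H1_space_L2)

lemma L2_nrm_le_H1_tilde_nrm: "nrm (L2_space \<Omega>) u \<le> nrm (H1_tilde \<Omega>) u"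
  by (simp add: H1_tilde_def L2_nrm_le_H1_nrm)

lemma H_tilde_props:
  assumes \<Omega>: "open \<Omega>" and \<sigma>: "0 \<le> \<sigma>" "\<sigma> < 1"
  shows H_tilde_zero: "0 \<in> carr (H_tilde \<Omega> \<sigma>)"
    and H_tilde_add: "\<And>u v. u \<in> carr (H_tilde \<Omega> \<sigma>) \<Longrightarrow> v \<in> carr (H_tilde \<Omega> \<sigma>) \<Longrightarrow> u + v \<in> carr (H_tilde \<Omega> \<sigma>)"
    and H_tilde_scale: "\<And>u c. u \<in> carr (H_tilde \<Omega> \<sigma>) \<Longrightarrow> (\<lambda>x. c * u x) \<in> carr (H_tilde \<Omega> \<sigma>)"
    and H_tilde_L2: "\<And>u. u \<in> carr (H_tilde \<Omega> \<sigma>) \<Longrightarrow> u \<in> carr (L2_space \<Omega>)"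
    and H_tilde_nonneg: "\<And>u. 0 \<le> nrm (H_tilde \<Omega> \<sigma>) u"
proof -
  note L2 = seminormed_L2_space[of \<Omega>] and H1 = seminormed_H1_tilde[OF \<Omega>]
  have "0 \<in> carr (H_tilde \<Omega> \<sigma>) \<and>
    (\<forall>u v. u \<in> carr (H_tilde \<Omega> \<sigma>) \<longrightarrow> v \<in> carr (H_tilde \<Omega> \<sigma>) \<longrightarrow> u + v \<in> carr (H_tilde \<Omega> \<sigma>)) \<and>
    (\<forall>u c. u \<in> carr (H_tilde \<Omega> \<sigma>) \<longrightarrow> (\<lambda>x. c * u x) \<in> carr (H_tilde \<Omega> \<sigma>)) \<and>
    (\<forall>u. u \<in> carr (H_tilde \<Omega> \<sigma>) \<longrightarrow> u \<in> carr (L2_space \<Omega>)) \<and>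
    (\<forall>u. 0 \<le> nrm (H_tilde \<Omega> \<sigma>) u)"
  proof (cases "\<sigma> = 0")
    case True
    then show ?thesis
      using seminormed_zero[OF L2] seminormed_add[OF L2] seminormed_scale[OF L2]
      by (simp add: H_tilde_0 L2_space_nrm)
  next
    case False
    then have "0 < \<sigma>" using \<sigma> by simp
    moreover have "u \<in> carr (L2_space \<Omega>)" if "u \<in> carr (interpolation_space (L2_space \<Omega>) (H1_tilde \<Omega>) \<sigma>)" for u
      using that seminormed_add[OF L2] H1_tilde_L2 by (auto simp: interpolation_space_def)
    ultimately show ?thesis
      using \<sigma> interpolation_space_zero[OF L2 H1] interpolation_space_add[OF L2 H1] interpolation_space_scale[OF L2 H1]
      by (simp add: H_tilde_between) (simp add: interpolation_space_def)
  qed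
  then show "0 \<in> carr (H_tilde \<Omega> \<sigma>)"
    and "\<And>u v. u \<in> carr (H_tilde \<Omega> \<sigma>) \<Longrightarrow> v \<in> carr (H_tilde \<Omega> \<sigma>) \<Longrightarrow> u + v \<in> carr (H_tilde \<Omega> \<sigma>)"
    and "\<And>u c. u \<in> carr (H_tilde \<Omega> \<sigma>) \<Longrightarrow> (\<lambda>x. c * u x) \<in> carr (H_tilde \<Omega> \<sigma>)"
    and "\<And>u. u \<in> carr (H_tilde \<Omega> \<sigma>) \<Longrightarrow> u \<in> carr (L2_space \<Omega>)"
    and "\<And>u. 0 \<le> nrm (H_tilde \<Omega> \<sigma>) u"
    by blast+
qed

text \<open>Here \<open>e\<close> stands for the H^-1 norm of \<open>v\<close>, \<open>V\<close> for
  a bound on its H^1 norm and \<open>p\<close> for its L2 norm. The K-functional at e / p gives p (e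
  / p)^\<sigma> = p^(1-\<sigma>) e^\<sigma>, and p^2 \<le> e V turns the exponent of e into \<sigma>
  + (1 - \<sigma>) / 2 = (1 + \<sigma>) / 2.\<close>

lemma H_tilde_pairing_bound:
  assumes \<Omega>: "open \<Omega>" and \<sigma>: "0 \<le> \<sigma>" "\<sigma> < 1"
    and v: "v \<in> carr (L2_space \<Omega>)" and e: "0 \<le> e" and V: "0 \<le> V"
    and weak: "\<And>z. z \<in> carr (H1_tilde \<Omega>) \<Longrightarrow> \<bar>LINT x|lebesgue_on \<Omega>. v x * z x\<bar> \<le> e * nrm (H1_tilde \<Omega>) z"
    and L2v: "(nrm (L2_space \<Omega>) v)\<^sup>2 \<le> e * V"
    and w: "w \<in> carr (H_tilde \<Omega> \<sigma>)"
  shows "\<bar>LINT x|lebesgue_on \<Omega>. v x * w x\<bar> \<le>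
    3 * (e powr ((1 + \<sigma>) / 2) * V powr ((1 - \<sigma>) / 2)) * nrm (H_tilde \<Omega> \<sigma>) w"
proof -
  note L2 = seminormed_L2_space[of \<Omega>] and H1 = seminormed_H1_tilde[OF \<Omega>]
  define p where "p = nrm (L2_space \<Omega>) v"
  have p0: "0 \<le> p" unfolding p_def by (rule seminormed_nonneg[OF L2 v])
  have wL2: "w \<in> carr (L2_space \<Omega>)" by (rule H_tilde_L2[OF \<Omega> \<sigma> w])
  have nn: "0 \<le> nrm (H_tilde \<Omega> \<sigma>) w" by (rule H_tilde_nonneg[OF \<Omega> \<sigma>])
  have CS: "\<bar>LINT x|lebesgue_on \<Omega>. v x * w x\<bar> \<le> p * nrm (L2_space \<Omega>) w"
    unfolding p_def by (rule L2_Cauchy_Schwarz[OF v wL2])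
  show ?thesis
  proof (cases "p = 0")
    case True
    then have "\<bar>LINT x|lebesgue_on \<Omega>. v x * w x\<bar> \<le> 0" using CS by simp
    also have "0 \<le> 3 * (e powr ((1 + \<sigma>) / 2) * V powr ((1 - \<sigma>) / 2)) * nrm (H_tilde \<Omega> \<sigma>) w"
      using nn by simp
    finally show ?thesis .
  next
    case False
    then have p: "0 < p" using p0 by simp
    then have "0 < p\<^sup>2" by simp
    \<comment> \<open>A nonzero \<open>p\<close> makes \<open>e\<close> and \<open>V\<close>
      positive, so that the laws of \<open>powr\<close> apply.\<close>
    with L2v have "0 < e * V" unfolding p_def by linarith
    with e V have eV: "0 < e" "0 < V" by (auto simp: zero_less_mult_iff)
    have p_le: "p powr (1 - \<sigma>) \<le> e powr ((1 - \<sigma>) / 2) * V powr ((1 - \<sigma>) / 2)"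
    proof -
      have "p powr (1 - \<sigma>) = (p\<^sup>2) powr ((1 - \<sigma>) / 2)"
        using p powr_powr[of p 2 "(1 - \<sigma>) / 2"] by (simp add: diff_divide_distrib)
      also have "\<dots> \<le> (e * V) powr ((1 - \<sigma>) / 2)"
        using L2v \<sigma> by (intro powr_mono2) (auto simp: p_def)
      finally show ?thesis using eV by (simp add: powr_mult)
    qed
    have "\<bar>LINT x|lebesgue_on \<Omega>. v x * w x\<bar> \<le> 3 * (p powr (1 - \<sigma>) * e powr \<sigma>) * nrm (H_tilde \<Omega> \<sigma>) w"
    proof (cases "\<sigma> = 0")
      case True
      then show ?thesis
        using CS p eV seminormed_nonneg[OF L2 wL2] by (simp add: H_tilde_0)
    next
      case False
      then have \<sigma>0: "0 < \<sigma>" using \<sigma> by simp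
      have wi: "w \<in> carr (interpolation_space (L2_space \<Omega>) (H1_tilde \<Omega>) \<sigma>)"
        using w \<sigma>0 \<sigma> by (simp add: H_tilde_between)
      then obtain w0 w1 where w01: "w0 \<in> carr (L2_space \<Omega>)" "w1 \<in> carr (H1_tilde \<Omega>)" "w = w0 + w1"
        by (auto simp: interpolation_space_def)
      \<comment> \<open>For w = a + b the pairing is at most p |a| + e |b| in the two norms, which
        is p times the expression whose infimum is K at the parameter e / p.\<close>
      have "\<bar>LINT x|lebesgue_on \<Omega>. v x * w x\<bar> / p \<le> K_functional (L2_space \<Omega>) (H1_tilde \<Omega>) (e / p) w"
      proof (rule K_functional_greatest[OF L2 H1 w01])
        fix a b assume ab: "a \<in> carr (L2_space \<Omega>)" "b \<in> carr (H1_tilde \<Omega>)" "w = a + b"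
        have "(LINT x|lebesgue_on \<Omega>. v x * w x) = (LINT x|lebesgue_on \<Omega>. v x * a x) + (LINT x|lebesgue_on \<Omega>. v x * b x)"
          using ab L2_mult_integrable[OF v ab(1)] L2_mult_integrable[OF v H1_tilde_L2[OF ab(2)]]
          by (simp add: distrib_left)
        then have "\<bar>LINT x|lebesgue_on \<Omega>. v x * w x\<bar> \<le> p * nrm (L2_space \<Omega>) a + e * nrm (H1_tilde \<Omega>) b"
          using L2_Cauchy_Schwarz[OF v ab(1)] weak[OF ab(2)] unfolding p_def by linarith
        then show "\<bar>LINT x|lebesgue_on \<Omega>. v x * w x\<bar> / p \<le> nrm (L2_space \<Omega>) a + e / p * nrm (H1_tilde \<Omega>) b"
          using p by (simp add: field_simps)
      qed
      also have "\<dots> \<le> 3 * (e / p) powr \<sigma> * nrm (H_tilde \<Omega> \<sigma>) w"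
        using K_functional_le_interpolation_nrm[OF L2 H1 _ _ _ wi, of "e / p"] \<sigma>0 \<sigma> eV p
        by (simp add: H_tilde_between)
      finally have "\<bar>LINT x|lebesgue_on \<Omega>. v x * w x\<bar> \<le> 3 * (p * (e / p) powr \<sigma>) * nrm (H_tilde \<Omega> \<sigma>) w"
        using p by (simp add: field_simps)
      also have "p * (e / p) powr \<sigma> = p powr (1 - \<sigma>) * e powr \<sigma>"
        using p eV by (simp add: powr_divide powr_diff)
      finally show ?thesis .
    qed
    also have "\<dots> \<le> 3 * (e powr ((1 + \<sigma>) / 2) * V powr ((1 - \<sigma>) / 2)) * nrm (H_tilde \<Omega> \<sigma>) w"
    proof -
      have "p powr (1 - \<sigma>) * e powr \<sigma> \<le> (e powr ((1 - \<sigma>) / 2) * V powr ((1 - \<sigma>) / 2)) * e powr \<sigma>"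
        using p_le by (rule mult_right_mono) simp
      also have "\<dots> = (e powr ((1 - \<sigma>) / 2) * e powr \<sigma>) * V powr ((1 - \<sigma>) / 2)"
        by simp
      also have "e powr ((1 - \<sigma>) / 2) * e powr \<sigma> = e powr ((1 + \<sigma>) / 2)"
        by (simp add: powr_add[symmetric] field_simps)
      finally show ?thesis
        using nn by (intro mult_right_mono mult_left_mono) auto
    qed
    finally show ?thesis .
  qed
qed

section \<open>The chaining argument\<close>

text \<open>Averaging: if every point of \<open>A\<close> between \<open>a\<close> and
  \<open>b\<close> violated one of the bounds, the sum of the \<open>h i / c i\<close> would be at
  least (n + 1) / (b - a) almost everywhere there, although its integral is at most n. The surplus
  in \<open>Suc n\<close> yields the contradiction; for n = 0 the statement is the density of
  \<open>A\<close>.\<close>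

lemma select_good_point:
  fixes h :: "nat \<Rightarrow> real \<Rightarrow> ennreal" and c :: "nat \<Rightarrow> real"
  assumes ab: "0 \<le> a" "a < b" "b \<le> T"
    and A: "AE t in lebesgue_on {0<..<T}. t \<in> A"
    and h: "\<And>i. i < n \<Longrightarrow> h i \<in> borel_measurable (lebesgue_on {0<..<T})"
    and c: "\<And>i. i < n \<Longrightarrow> 0 < c i"
    and int: "\<And>i. i < n \<Longrightarrow> (\<integral>\<^sup>+ t. h i t \<partial>lebesgue_on {0<..<T}) \<le> ennreal (c i)"
  shows "\<exists>q\<in>A. a < q \<and> q < b \<and> (\<forall>i<n. h i q \<le> ennreal (real (Suc n) * c i / (b - a)))"
proof (rule ccontr)
  assume "\<not> ?thesis"
  then have bad: "\<exists>i<n. ennreal (real (Suc n) * c i / (b - a)) < h i q" if "q \<in> A" "a < q" "q < b" for q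
    using that by (auto simp: not_le)
  let ?M = "lebesgue_on {0<..<T}"
  have le: "AE q in ?M. ennreal (real (Suc n) / (b - a)) * indicator {a<..<b} q \<le> (\<Sum>i<n. ennreal (1 / c i) * h i q)"
    using A
  proof eventually_elim
    case (elim q)
    show ?case
    proof (cases "a < q \<and> q < b")
      case True
      then obtain i where i: "i < n" "ennreal (real (Suc n) * c i / (b - a)) < h i q"
        using bad elim by blast
      have "real (Suc n) / (b - a) = 1 / c i * (real (Suc n) * c i / (b - a))"
        using c[OF i(1)] by simp
      then have "ennreal (real (Suc n) / (b - a)) = ennreal (1 / c i) * ennreal (real (Suc n) * c i / (b - a))"
        using c[OF i(1)] ab by (subst ennreal_mult[symmetric]) (auto simp del: of_nat_Suc)
      also have "\<dots> \<le> ennreal (1 / c i) * h i q"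
        using i by (intro mult_left_mono) auto
      also have "\<dots> \<le> (\<Sum>i<n. ennreal (1 / c i) * h i q)"
        using i by (intro member_le_sum) auto
      finally show ?thesis using True by simp
    qed simp
  qed
  have "{a<..<b} \<in> sets ?M"
    using ab by (auto simp: sets_restrict_space intro!: image_eqI[of _ _ "{a<..<b}"])
  moreover have "emeasure ?M {a<..<b} = ennreal (b - a)"
    using ab by (subst emeasure_restrict_space) auto
  ultimately have "ennreal (real (Suc n)) = (\<integral>\<^sup>+ q. ennreal (real (Suc n) / (b - a)) * indicator {a<..<b} q \<partial>?M)"
    using ab by (simp add: nn_integral_cmult_indicator ennreal_mult[symmetric] del: of_nat_Suc)
  also have "\<dots> \<le> (\<integral>\<^sup>+ q. (\<Sum>i<n. ennreal (1 / c i) * h i q) \<partial>?M)"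
    by (rule nn_integral_mono_AE[OF le])
  also have "\<dots> = (\<Sum>i<n. ennreal (1 / c i) * (\<integral>\<^sup>+ q. h i q \<partial>?M))"
    using h by (subst nn_integral_sum) (auto simp: nn_integral_cmult)
  also have "\<dots> \<le> (\<Sum>i<n. ennreal (1 / c i) * ennreal (c i))"
    using int by (intro sum_mono mult_left_mono) auto
  also have "\<dots> = (\<Sum>i<n. 1)"
    using c by (intro sum.cong refl) (auto simp: ennreal_mult[symmetric] less_imp_le less_imp_neq[symmetric])
  also have "\<dots> = ennreal (real n)"
    by (simp add: ennreal_of_nat_eq_real_of_nat)
  finally show False by simp
qed

text \<open>A scalar abstraction of the problem: \<open>f\<close> is the pairing with one fixed test
  function, \<open>E\<close> the distance in H^-1, \<open>V\<close> the norm in H^1 and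
  \<open>D\<close> a measurable version of the inner Gagliardo integral. \<open>M\<close> is
  positive because \<open>select_good_point\<close> divides by its bounds.\<close>

locale chaining =
  fixes T \<alpha> \<theta> M C :: real and A :: "real set" and E :: "real \<Rightarrow> real \<Rightarrow> real"
    and V :: "real \<Rightarrow> real" and D :: "real \<Rightarrow> ennreal" and f :: "real \<Rightarrow> real"
  assumes T: "0 < T" and \<alpha>: "0 < \<alpha>" "\<alpha> \<le> 1" and \<theta>: "0 \<le> \<theta>" "\<theta> \<le> 1" "\<alpha> * \<theta> > 1 / 2"
    and M: "0 < M" and C: "0 \<le> C"
    and A_subset: "A \<subseteq> {0<..<T}" and A_AE: "AE t in lebesgue_on {0<..<T}. t \<in> A"
    and V_measurable: "V \<in> borel_measurable (lebesgue_on {0<..<T})"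
    and D_measurable: "D \<in> borel_measurable (lebesgue_on {0<..<T})"
    and E_measurable: "\<And>p. p \<in> A \<Longrightarrow> (\<lambda>t. E t p) \<in> borel_measurable (lebesgue_on {0<..<T})"
    and V_nonneg: "\<And>t. t \<in> A \<Longrightarrow> 0 \<le> V t"
    and E_nonneg: "\<And>t p. t \<in> A \<Longrightarrow> p \<in> A \<Longrightarrow> 0 \<le> E t p" and E_refl: "\<And>t. t \<in> A \<Longrightarrow> E t t = 0"
    and V_bound: "(\<integral>\<^sup>+ t. ennreal ((V t)\<^sup>2) \<partial>lebesgue_on {0<..<T}) \<le> ennreal (M\<^sup>2)"
    and D_bound: "(\<integral>\<^sup>+ t. D t \<partial>lebesgue_on {0<..<T}) \<le> ennreal (M\<^sup>2)"
    and D_finite: "\<And>p. p \<in> A \<Longrightarrow> D p < \<infinity>"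
    and E_bound: "\<And>p. p \<in> A \<Longrightarrow>
      (\<integral>\<^sup>+ t. ennreal ((E t p)\<^sup>2 / \<bar>t - p\<bar> powr (2 * \<alpha> + 1)) \<partial>lebesgue_on {0<..<T}) \<le> D p"
    and f_bound: "\<And>x y. x \<in> A \<Longrightarrow> y \<in> A \<Longrightarrow>
      \<bar>f x - f y\<bar> \<le> C * (E x y powr \<theta> * (V x + V y) powr (1 - \<theta>))"
begin

definition \<beta> :: real where "\<beta> = \<alpha> * \<theta> - 1 / 2"

lemma \<beta>_pos: "0 < \<beta>" using \<theta> by (simp add: \<beta>_def)

lemma E_quotient_measurable:
  assumes "p \<in> A"
  shows "(\<lambda>t. ennreal ((E t p)\<^sup>2 / \<bar>t - p\<bar> powr (2 * \<alpha> + 1))) \<in> borel_measurable (lebesgue_on {0<..<T})"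
proof -
  have [measurable]: "(\<lambda>t::real. t) \<in> borel_measurable (lebesgue_on {0<..<T})"
    by (intro measurable_restrict_space1 measurable_completion) simp
  note E_measurable[OF assms, measurable]
  show ?thesis by measurable
qed

text \<open>At q = p the quotient is 0 by the convention on division and says nothing about
  \<open>E\<close>; \<open>E_refl\<close> covers that case.\<close>

lemma E_le_of_quotient:
  assumes q: "q \<in> A" "p \<in> A" and l: "0 < l" "\<bar>q - p\<bar> \<le> l" and c: "0 \<le> c"
    and le: "ennreal ((E q p)\<^sup>2 / \<bar>q - p\<bar> powr (2 * \<alpha> + 1)) \<le> ennreal c"
  shows "(E q p)\<^sup>2 \<le> c * l powr (2 * \<alpha> + 1)"
proof (cases "q = p")
  case True
  then show ?thesis using E_refl q c by simp
next
  case False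
  then have pos: "0 < \<bar>q - p\<bar> powr (2 * \<alpha> + 1)" by simp
  have "(E q p)\<^sup>2 / \<bar>q - p\<bar> powr (2 * \<alpha> + 1) \<le> c"
    using le c by (simp add: ennreal_le_iff)
  then have "(E q p)\<^sup>2 \<le> c * \<bar>q - p\<bar> powr (2 * \<alpha> + 1)"
    using pos by (simp add: divide_le_eq)
  also have "\<dots> \<le> c * l powr (2 * \<alpha> + 1)"
    using l c \<alpha> by (intro mult_left_mono powr_mono2) auto
  finally show ?thesis .
qed

text \<open>Used with two rates: a = \<alpha> - 1/2 between consecutive chain points, which makes
  the exponent \<beta>, and a = \<alpha> between a chain point and the limit point.\<close>

lemma f_diff_le:
  assumes "x \<in> A" "y \<in> A" and l: "0 < l" and "0 \<le> e" "0 \<le> v"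
    and E: "E x y \<le> e * l powr a" and V: "V x + V y \<le> v * l powr (- (1 / 2))"
  shows "\<bar>f x - f y\<bar> \<le> C * (e powr \<theta> * v powr (1 - \<theta>)) * l powr (a * \<theta> - (1 - \<theta>) / 2)"
proof -
  have "\<bar>f x - f y\<bar> \<le> C * (E x y powr \<theta> * (V x + V y) powr (1 - \<theta>))"
    using assms by (intro f_bound)
  also have "\<dots> \<le> C * ((e * l powr a) powr \<theta> * (v * l powr (- (1 / 2))) powr (1 - \<theta>))"
    using assms C \<theta> E_nonneg[of x y] V_nonneg[of x] V_nonneg[of y]
    by (intro mult_left_mono mult_mono powr_mono2) auto
  also have "(e * l powr a) powr \<theta> * (v * l powr (- (1 / 2))) powr (1 - \<theta>) =
      e powr \<theta> * v powr (1 - \<theta>) * (l powr (a * \<theta>) * l powr (- (1 / 2) * (1 - \<theta>)))"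
    using assms by (simp add: powr_mult powr_powr)
  also have "l powr (a * \<theta>) * l powr (- (1 / 2) * (1 - \<theta>)) = l powr (a * \<theta> - (1 - \<theta>) / 2)"
    by (simp add: powr_add[symmetric])
  finally show ?thesis by (simp add: mult.assoc)
qed

lemma V_le_of_square:
  assumes "q \<in> A" "0 < l" "0 \<le> c" and le: "ennreal ((V q)\<^sup>2) \<le> ennreal (c\<^sup>2 * M\<^sup>2 / l)"
  shows "V q \<le> c * M * l powr (- (1 / 2))"
proof -
  have "(l powr (- (1 / 2)))\<^sup>2 = l powr (- 1)"
    by (simp add: power2_eq_square flip: powr_add)
  then have l: "(l powr (- (1 / 2)))\<^sup>2 = 1 / l"
    using assms(2) by (simp add: powr_minus_divide)
  have "(V q)\<^sup>2 \<le> c\<^sup>2 * M\<^sup>2 / l"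
    using le assms(2) by (simp add: ennreal_le_iff)
  also have "\<dots> = (c * M * l powr (- (1 / 2)))\<^sup>2"
    by (simp add: power_mult_distrib l)
  finally show ?thesis
    using assms M by (intro power2_le_imp_le[of "V q"]) auto
qed

text \<open>
  All points but \<open>t\<close> are chosen to satisfy quantitative bounds; for \<open>t\<close> only \<open>D t < \<infinity>\<close> is known,
  which is why it enters through the limit.
\<close>

lemma chain_to_point:
  assumes t: "t \<in> A" and h: "0 < h" and a: "\<And>k. 0 \<le> a k" "\<And>k. a k + h / 2 ^ k \<le> T"
    "\<And>k. a k \<le> t" "\<And>k. t \<le> a k + h / 2 ^ k"
    and q0: "q0 \<in> A" "a 0 < q0" "q0 < a 0 + h"
      "ennreal ((V q0)\<^sup>2) \<le> ennreal (5 * M\<^sup>2 / h)" "D q0 \<le> ennreal (5 * M\<^sup>2 / h)"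
  shows "\<bar>f q0 - f t\<bar> \<le> 20 / (1 - 2 powr (- \<beta>)) * C * M * h powr \<beta>"
proof -
  define l where "l k = h / 2 ^ k" for k :: nat
  have l: "0 < l k" "l (Suc k) = l k / 2" for k using h by (simp_all add: l_def)
  \<comment> \<open>The summand 1 in the witness makes the bound positive even if \<open>D t\<close>
    is 0, as the selection requires.\<close>
  obtain ct where ct: "0 < ct" "D t \<le> ennreal ct"
  proof
    have "D t = ennreal (enn2real (D t))" using D_finite[OF t] by simp
    also have "\<dots> \<le> ennreal (enn2real (D t) + 1)" by (intro ennreal_leI) simp
    finally show "D t \<le> ennreal (enn2real (D t) + 1)" .
    show "0 < enn2real (D t) + 1" by (simp add: add_nonneg_pos)
  qed
  \<comment> \<open>The starting point is prescribed, being shared by two chains with different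
    targets; hence the quotient at \<open>t\<close> is controlled only from k = 1 on.\<close>
  define good where "good k q \<longleftrightarrow> q \<in> A \<and> a k < q \<and> q < a k + l k \<and>
     ennreal ((V q)\<^sup>2) \<le> ennreal (5 * M\<^sup>2 / l k) \<and> D q \<le> ennreal (5 * M\<^sup>2 / l k) \<and>
     (k = 0 \<longrightarrow> q = q0) \<and>
     (0 < k \<longrightarrow> ennreal ((E q t)\<^sup>2 / \<bar>q - t\<bar> powr (2 * \<alpha> + 1)) \<le> ennreal (5 * ct / l k))" for k q
  define step where "step k q q' \<longleftrightarrow>
     ennreal ((E q' q)\<^sup>2 / \<bar>q' - q\<bar> powr (2 * \<alpha> + 1)) \<le> ennreal (5 * (5 * M\<^sup>2 / l k) / l (Suc k))" for k q q'
  have "\<exists>q. \<forall>k. good k (q k) \<and> step k (q k) (q (Suc k))"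
  proof (rule dependent_nat_choice)
    show "\<exists>q. good 0 q"
      using q0 by (auto simp: good_def l_def)
  next
    fix p k assume p: "good k p"
    then have pA: "p \<in> A" and Dp: "D p \<le> ennreal (5 * M\<^sup>2 / l k)" by (auto simp: good_def)
    \<comment> \<open>Four quantities are controlled at once, so \<open>Suc 4\<close> is the origin
      of every 5 here. The integral of the last one is at most \<open>D p\<close>, which
      \<open>good k p\<close> has kept small: this is why \<open>D\<close> is among the controlled
      quantities.\<close>
    define hh where "hh i = (if i = 0 then (\<lambda>q. ennreal ((V q)\<^sup>2)) else if i = 1 then D
      else if i = 2 then (\<lambda>q. ennreal ((E q t)\<^sup>2 / \<bar>q - t\<bar> powr (2 * \<alpha> + 1)))
      else (\<lambda>q. ennreal ((E q p)\<^sup>2 / \<bar>q - p\<bar> powr (2 * \<alpha> + 1))))" for i :: nat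
    define c where "c i = (if i = 0 then M\<^sup>2 else if i = 1 then M\<^sup>2
      else if i = 2 then ct else 5 * M\<^sup>2 / l k)" for i :: nat
    have "\<exists>q\<in>A. a (Suc k) < q \<and> q < a (Suc k) + l (Suc k) \<and>
        (\<forall>i<4. hh i q \<le> ennreal (real (Suc 4) * c i / ((a (Suc k) + l (Suc k)) - a (Suc k))))"
    proof (rule select_good_point[OF _ _ _ A_AE])
      show "0 \<le> a (Suc k)" "a (Suc k) < a (Suc k) + l (Suc k)" "a (Suc k) + l (Suc k) \<le> T"
        using a(1,2)[of "Suc k"] l(1)[of "Suc k"] unfolding l_def by auto
      show "hh i \<in> borel_measurable (lebesgue_on {0<..<T})" if "i < 4" for i
        using V_measurable D_measurable E_quotient_measurable[OF t] E_quotient_measurable[OF pA]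
        by (auto simp: hh_def)
      show "0 < c i" for i using M ct l by (simp add: c_def)
      show "(\<integral>\<^sup>+ t. hh i t \<partial>lebesgue_on {0<..<T}) \<le> ennreal (c i)" for i
        using V_bound D_bound order_trans[OF E_bound[OF t] ct(2)] order_trans[OF E_bound[OF pA] Dp]
        by (auto simp: hh_def c_def)
    qed
    then obtain q where q: "q \<in> A" "a (Suc k) < q" "q < a (Suc k) + l (Suc k)"
      "\<And>i. i < 4 \<Longrightarrow> hh i q \<le> ennreal (5 * c i / l (Suc k))"
      by auto
    have "good (Suc k) q \<and> step k p q"
      using q(1-3) q(4)[of 0] q(4)[of 1] q(4)[of 2] q(4)[of 3] by (simp add: good_def step_def hh_def c_def)
    then show "\<exists>q. good (Suc k) q \<and> step k p q" by blast
  qed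
  then obtain q where q: "\<And>k. good k (q k)" "\<And>k. step k (q k) (q (Suc k))" by blast
  have qA: "q k \<in> A" for k using q(1)[of k] by (simp add: good_def)
  have q_0: "q 0 = q0" using q(1)[of 0] by (simp add: good_def)
  have qt: "\<bar>q k - t\<bar> \<le> l k" for k
    using q(1)[of k] a(3,4)[of k] by (auto simp: good_def l_def)
  have Vq: "V (q k) \<le> 3 * M * l k powr (- (1 / 2))" for k
  proof (rule V_le_of_square[OF qA l(1)])
    have "5 * M\<^sup>2 / l k \<le> 3\<^sup>2 * M\<^sup>2 / l k" using l(1)[of k] by (intro divide_right_mono) auto
    then show "ennreal ((V (q k))\<^sup>2) \<le> ennreal (3\<^sup>2 * M\<^sup>2 / l k)"
      using q(1)[of k] ennreal_leI order_trans unfolding good_def by blast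
  qed simp
  \<comment> \<open>The later point measured at the earlier scale: halving the length turns 5 into
    10, which is at most 16.\<close>
  have Vq': "V (q (Suc k)) \<le> 4 * M * l k powr (- (1 / 2))" for k
  proof (rule V_le_of_square[OF qA l(1)])
    have "5 * M\<^sup>2 / l (Suc k) \<le> 4\<^sup>2 * M\<^sup>2 / l k" 
      unfolding l(2) using l(1)[of k] by (simp add: divide_right_mono)
    then show "ennreal ((V (q (Suc k)))\<^sup>2) \<le> ennreal (4\<^sup>2 * M\<^sup>2 / l k)"
      using q(1)[of "Suc k"] ennreal_leI order_trans unfolding good_def by blast
  qed simp
  have step_bound: "\<bar>f (q (Suc k)) - f (q k)\<bar> \<le> 20 * C * M * l k powr \<beta>" for k
  proof -
    have dist: "\<bar>q (Suc k) - q k\<bar> \<le> 2 * l k"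
      using qt[of k] qt[of "Suc k"] l[of k] by linarith
    have "(E (q (Suc k)) (q k))\<^sup>2 \<le> (5 * (5 * M\<^sup>2 / l k) / l (Suc k)) * (2 * l k) powr (2 * \<alpha> + 1)"
      by (rule E_le_of_quotient[OF qA qA _ dist _ q(2)[of k, unfolded step_def]])
        (use l(1)[of k] l(1)[of "Suc k"] in auto)
    \<comment> \<open>The 50 is 5 times 5, doubled because \<open>l (Suc k)\<close> is half of
      \<open>l k\<close>; the 8 bounds 2 to the power 2 \<alpha> + 1. Their product is 400, the
      square of 20.\<close>
    also have "\<dots> \<le> (50 * M\<^sup>2 / (l k)\<^sup>2) * (8 * l k powr (2 * \<alpha> + 1))"
    proof (rule mult_mono)
      have "(2::real) powr (2 * \<alpha> + 1) \<le> 2 powr 3" using \<alpha> by (intro powr_mono) auto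
      then show "(2 * l k) powr (2 * \<alpha> + 1) \<le> 8 * l k powr (2 * \<alpha> + 1)"
        using l[of k] by (simp add: powr_mult mult_right_mono)
    qed (use l[of k] in \<open>auto simp: power2_eq_square field_simps\<close>)
    also have "\<dots> = (20 * M * l k powr (\<alpha> - 1 / 2))\<^sup>2"
    proof -
      have "(l k powr (\<alpha> - 1 / 2))\<^sup>2 = l k powr (2 * \<alpha> - 1)"
        by (simp add: power2_eq_square flip: powr_add)
      also have "\<dots> = l k powr (2 * \<alpha> + 1) / (l k)\<^sup>2"
        using l(1)[of k] powr_diff[of "l k" "2 * \<alpha> + 1" 2] by simp
      finally show ?thesis by (simp add: power_mult_distrib)
    qed
    finally have "E (q (Suc k)) (q k) \<le> 20 * M * l k powr (\<alpha> - 1 / 2)"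
      by (rule power2_le_imp_le) (use M in auto)
    \<comment> \<open>The sum is at most 7 M; it is weakened to 20 M so that both factors have the
      same constant and their powers \<theta> and 1 - \<theta> multiply to 20 M.\<close>
    moreover have "V (q (Suc k)) + V (q k) \<le> 20 * M * l k powr (- (1 / 2))"
    proof -
      have "0 \<le> M * l k powr (- (1 / 2))" using M by simp
      then show ?thesis using Vq[of k] Vq'[of k] by linarith
    qed
    ultimately have "\<bar>f (q (Suc k)) - f (q k)\<bar> \<le>
       C * ((20 * M) powr \<theta> * (20 * M) powr (1 - \<theta>)) * l k powr ((\<alpha> - 1 / 2) * \<theta> - (1 - \<theta>) / 2)"
      using M by (intro f_diff_le[OF qA qA l(1)]) auto
    also have "(20 * M) powr \<theta> * (20 * M) powr (1 - \<theta>) = 20 * M"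
      using M by (simp add: powr_add[symmetric])
    also have "(\<alpha> - 1 / 2) * \<theta> - (1 - \<theta>) / 2 = \<beta>"
      by (simp add: \<beta>_def field_simps)
    finally show ?thesis by (simp add: mult_ac)
  qed
  define r where "r = (2::real) powr (- \<beta>)"
  have r: "0 < r" "r < 1"
    using \<beta>_pos powr_less_mono[of "- \<beta>" 0 2] by (simp_all add: r_def)
  have l_powr: "l k powr \<gamma> = h powr \<gamma> * (2 powr (- \<gamma>)) ^ k" for k \<gamma>
  proof -
    have "l k = h * 2 powr (- real k)"
      by (simp add: l_def powr_minus powr_realpow divide_inverse)
    then have "l k powr \<gamma> = h powr \<gamma> * 2 powr (- real k * \<gamma>)"
      using h by (simp add: powr_mult powr_powr)
    also have "2 powr (- real k * \<gamma>) = (2 powr (- \<gamma>)) powr real k"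
      by (simp add: powr_powr mult.commute)
    finally show ?thesis by (simp add: powr_realpow)
  qed
  have telescope: "\<bar>f q0 - f (q k)\<bar> \<le> 20 / (1 - r) * C * M * h powr \<beta>" for k
  proof -
    have "\<bar>f q0 - f (q k)\<bar> \<le> (\<Sum>j<k. 20 * C * M * h powr \<beta> * r ^ j)"
    proof (induction k)
      case 0
      then show ?case by (simp add: q_0)
    next
      case (Suc k)
      have "\<bar>f q0 - f (q (Suc k))\<bar> \<le> \<bar>f q0 - f (q k)\<bar> + \<bar>f (q (Suc k)) - f (q k)\<bar>" by linarith
      then show ?case
        using Suc step_bound[of k] by (simp add: l_powr r_def mult.assoc)
    qed
    also have "\<dots> = 20 * C * M * h powr \<beta> * (\<Sum>j<k. r ^ j)"
      by (simp add: sum_distrib_left)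
    also have "\<dots> \<le> 20 * C * M * h powr \<beta> * (1 / (1 - r))"
    proof (rule mult_left_mono)
      have "(\<Sum>j<k. r ^ j) = (1 - r ^ k) / (1 - r)" using r by (simp add: sum_gp_strict)
      also have "\<dots> \<le> 1 / (1 - r)" using r by (intro divide_right_mono) auto
      finally show "(\<Sum>j<k. r ^ j) \<le> 1 / (1 - r)" .
    qed (use C M in auto)
    finally show ?thesis by simp
  qed
  \<comment> \<open>Here the constants may depend on \<open>t\<close>, since only convergence
    matters. The index is \<open>Suc k\<close> because \<open>good 0\<close> says nothing about the
    quotient at \<open>t\<close>.\<close>
  have lim: "(\<lambda>k. \<bar>f (q (Suc k)) - f t\<bar>) \<longlonglongrightarrow> 0"
  proof (rule tendsto_sandwich[OF _ _ tendsto_const])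
    define \<gamma> where "\<gamma> = \<alpha> * \<theta> - (1 - \<theta>) / 2"
    \<comment> \<open>The fixed number \<open>V t\<close> is absorbed into the growing factor:
      \<open>l k\<close> never exceeds \<open>h\<close>, so 1 is at most the square root of h / l
      k.\<close>
    define v where "v = 3 * M + V t * h powr (1 / 2)"
    have \<gamma>: "0 < \<gamma>" using \<theta> by (simp add: \<gamma>_def field_simps)
    let ?K = "C * (sqrt (5 * ct) powr \<theta> * v powr (1 - \<theta>)) * h powr \<gamma>"
    have "\<bar>f (q (Suc k)) - f t\<bar> \<le> ?K * (2 powr (- \<gamma>)) ^ Suc k" for k
    proof -
      have "(E (q (Suc k)) t)\<^sup>2 \<le> (5 * ct / l (Suc k)) * l (Suc k) powr (2 * \<alpha> + 1)"
      proof (rule E_le_of_quotient[OF qA t l(1) qt])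
        show "ennreal ((E (q (Suc k)) t)\<^sup>2 / \<bar>q (Suc k) - t\<bar> powr (2 * \<alpha> + 1)) \<le> ennreal (5 * ct / l (Suc k))"
          using q(1)[of "Suc k"] by (simp add: good_def)
      qed (use ct l(1)[of "Suc k"] in simp)
      also have "\<dots> = (sqrt (5 * ct) * l (Suc k) powr \<alpha>)\<^sup>2"
      proof -
        have "(l (Suc k) powr \<alpha>)\<^sup>2 = l (Suc k) powr (2 * \<alpha>)"
          by (simp add: power2_eq_square flip: powr_add)
        then show ?thesis
          using ct l(1)[of "Suc k"] by (simp add: power_mult_distrib powr_add)
      qed
      finally have "E (q (Suc k)) t \<le> sqrt (5 * ct) * l (Suc k) powr \<alpha>"
        by (rule power2_le_imp_le) (use ct in auto)
      moreover have "V (q (Suc k)) + V t \<le> v * l (Suc k) powr (- (1 / 2))"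
      proof -
        have "1 \<le> h powr (1 / 2) * l (Suc k) powr (- (1 / 2))"
        proof -
          have "l (Suc k) \<le> h" using h by (simp add: l_def divide_le_eq mult_le_cancel_left1 one_le_power[of 2 "Suc k", simplified])
          then have "l (Suc k) powr (1 / 2) \<le> h powr (1 / 2)"
            using l(1)[of "Suc k"] by (intro powr_mono2) auto
          then show ?thesis using l(1)[of "Suc k"] by (simp add: powr_minus field_simps)
        qed
        then have "V t * 1 \<le> V t * (h powr (1 / 2) * l (Suc k) powr (- (1 / 2)))"
          using V_nonneg[OF t] by (intro mult_left_mono)
        then show ?thesis
          using Vq[of "Suc k"] by (simp add: v_def algebra_simps)
      qed
      ultimately have "\<bar>f (q (Suc k)) - f t\<bar> \<le>
          C * (sqrt (5 * ct) powr \<theta> * v powr (1 - \<theta>)) * l (Suc k) powr \<gamma>"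
        unfolding \<gamma>_def using ct M V_nonneg[OF t]
        by (intro f_diff_le[OF qA t l(1)]) (auto simp: v_def)
      then show ?thesis by (simp add: l_powr mult.assoc)
    qed
    then show "eventually (\<lambda>k. \<bar>f (q (Suc k)) - f t\<bar> \<le> ?K * (2 powr (- \<gamma>)) ^ Suc k) sequentially"
      by (intro always_eventually allI)
    have "(2::real) powr (- \<gamma>) < 1" using \<gamma> powr_less_mono[of "- \<gamma>" 0 2] by simp
    then have "(\<lambda>k. (2 powr (- \<gamma>)) ^ Suc k) \<longlonglongrightarrow> (0::real)"
      by (intro LIMSEQ_Suc LIMSEQ_realpow_zero) auto
    then show "(\<lambda>k. ?K * (2 powr (- \<gamma>)) ^ Suc k) \<longlonglongrightarrow> 0"
      by (rule tendsto_mult_right_zero)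
  qed simp
  have "\<bar>f q0 - f t\<bar> \<le> 20 / (1 - r) * C * M * h powr \<beta> + \<bar>f (q (Suc k)) - f t\<bar>" for k
    using telescope[of "Suc k"] by linarith
  moreover have "(\<lambda>k. 20 / (1 - r) * C * M * h powr \<beta> + \<bar>f (q (Suc k)) - f t\<bar>) \<longlonglongrightarrow>
      20 / (1 - r) * C * M * h powr \<beta> + 0"
    by (intro tendsto_add tendsto_const lim)
  ultimately show ?thesis
    unfolding r_def using LIMSEQ_le_const by (metis (no_types, lifting) add.right_neutral)
qed

text \<open>One point between x and y starts both chains. The intervals [x, x + h / 2^k] shrink to x
  and [y - h / 2^k, y] shrink to y, and for k = 0 both are [x, y]. The 40 is twice the 20 of a
  single chain.\<close>

lemma Hoelder_bound_less:
  assumes x: "x \<in> A" and y: "y \<in> A" and "x < y"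
  shows "\<bar>f x - f y\<bar> \<le> 40 / (1 - 2 powr (- \<beta>)) * C * M * \<bar>x - y\<bar> powr \<beta>"
proof -
  define h where "h = y - x"
  have h: "0 < h" using assms by (simp add: h_def)
  have J: "0 < x" "y < T" using A_subset x y by auto
  have hk: "h / 2 ^ k \<le> h" for k :: nat
    using h by (simp add: divide_le_eq mult_le_cancel_left1)
  define hh where "hh i = (if i = 0 then (\<lambda>q. ennreal ((V q)\<^sup>2)) else D)" for i :: nat
  have "\<exists>q\<in>A. x < q \<and> q < y \<and> (\<forall>i<2. hh i q \<le> ennreal (real (Suc 2) * M\<^sup>2 / (y - x)))"
    using J V_measurable D_measurable M V_bound D_bound \<open>x < y\<close>
    by (intro select_good_point[OF _ _ _ A_AE]) (auto simp: hh_def)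
  then obtain q where q: "q \<in> A" "x < q" "q < y" "\<And>i. i < 2 \<Longrightarrow> hh i q \<le> ennreal (3 * M\<^sup>2 / h)"
    by (auto simp: h_def)
  \<comment> \<open>Two selected conditions give the factor 3; it is weakened to the 5 that
    \<open>chain_to_point\<close> assumes.\<close>
  have "3 * M\<^sup>2 / h \<le> 5 * M\<^sup>2 / h" using h by (intro divide_right_mono) auto
  then have "hh i q \<le> ennreal (5 * M\<^sup>2 / h)" if "i < 2" for i
    using q(4)[OF that] ennreal_leI order_trans by blast
  from this[of 0] this[of 1] have q5: "ennreal ((V q)\<^sup>2) \<le> ennreal (5 * M\<^sup>2 / h)" "D q \<le> ennreal (5 * M\<^sup>2 / h)"
    by (simp_all add: hh_def)
  have "\<bar>f q - f x\<bar> \<le> 20 / (1 - 2 powr (- \<beta>)) * C * M * h powr \<beta>"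
  proof (rule chain_to_point[OF x h, where a = "\<lambda>_. x"])
    show "x + h / 2 ^ k \<le> T" for k using hk[of k] J by (simp add: h_def)
  qed (use J h q q5 in \<open>auto simp: h_def\<close>)
  moreover have "\<bar>f q - f y\<bar> \<le> 20 / (1 - 2 powr (- \<beta>)) * C * M * h powr \<beta>"
  proof (rule chain_to_point[OF y h, where a = "\<lambda>k. y - h / 2 ^ k"])
    show "0 \<le> y - h / 2 ^ k" for k using hk[of k] J by (simp add: h_def)
  qed (use J h q q5 in \<open>auto simp: h_def\<close>)
  ultimately have "\<bar>f x - f y\<bar> \<le> 2 * (20 / (1 - 2 powr (- \<beta>)) * C * M * h powr \<beta>)" by linarith
  then show ?thesis using \<open>x < y\<close> by (simp add: h_def)
qed

lemma Hoelder_bound: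
  assumes "x \<in> A" "y \<in> A"
  shows "\<bar>f x - f y\<bar> \<le> 40 / (1 - 2 powr (- \<beta>)) * C * M * \<bar>x - y\<bar> powr \<beta>"
  using Hoelder_bound_less[OF assms] Hoelder_bound_less[OF assms(2,1)]
  by (cases x y rule: linorder_cases) (simp_all add: abs_minus_commute)

end

section \<open>The continuous representative\<close>

lemma borel_measurable_lebesgue_on_AE:
  fixes f g :: "'a::euclidean_space \<Rightarrow> real"
  assumes S: "S \<in> sets lebesgue" and f: "f \<in> borel_measurable (lebesgue_on S)"
    and ae: "AE x in lebesgue_on S. f x = g x"
  shows "g \<in> borel_measurable (lebesgue_on S)"
proof -
  have "(\<lambda>x. if x \<in> S then g x else 0) \<in> borel_measurable lebesgue"
  proof (rule borel_measurable_AE)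
    show "(\<lambda>x. if x \<in> S then f x else 0) \<in> borel_measurable lebesgue"
      using f S by (simp add: borel_measurable_if)
    have "AE x in lebesgue. x \<in> S \<longrightarrow> f x = g x"
      using ae S by (simp add: AE_restrict_space_iff)
    then show "AE x in lebesgue. (if x \<in> S then f x else 0) = (if x \<in> S then g x else 0)"
      by eventually_elim simp
  qed
  then show ?thesis using S by (simp add: borel_measurable_if)
qed

lemma strongly_measurableE:
  assumes "strongly_measurable J X f"
  obtains S where "\<And>n. simple_function (lebesgue_on J) (S n)" "\<And>n t. t \<in> J \<Longrightarrow> S n t \<in> carr X"
    "AE t in lebesgue_on J. (\<lambda>n. nrm X (f t - S n t)) \<longlonglongrightarrow> 0"
proof -
  from assms obtain S where S: "\<forall>n::nat. simple_function (lebesgue_on J) (S n) \<and> S n ` J \<subseteq> carr X"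
      "AE t in lebesgue_on J. (\<lambda>n. nrm X (f t - S n t)) \<longlonglongrightarrow> 0"
    unfolding strongly_measurable_def by (elim conjE exE)
  show ?thesis
    by (rule that[of S]) (use S in auto)
qed

text \<open>Any function of a simple function is simple, in particular its norm; the reverse
  triangle inequality passes to the limit, and completeness of Lebesgue measure takes care of the
  exceptional null set.\<close>

lemma nrm_strongly_measurable:
  assumes X: "seminormed X" and J: "J \<in> sets lebesgue" and f: "strongly_measurable J X f"
  shows "(\<lambda>t. nrm X (f t)) \<in> borel_measurable (lebesgue_on J)"
proof -
  obtain S where S: "\<And>n. simple_function (lebesgue_on J) (S n)" "\<And>n t. t \<in> J \<Longrightarrow> S n t \<in> carr X"
      "AE t in lebesgue_on J. (\<lambda>n. nrm X (f t - S n t)) \<longlonglongrightarrow> 0"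
    using f by (rule strongly_measurableE) blast
  have fJ: "f t \<in> carr X" if "t \<in> J" for t using f that by (simp add: strongly_measurable_def)
  have lim: "AE t in lebesgue_on J. lim (\<lambda>n. nrm X (S n t)) = nrm X (f t)"
    using S(3) AE_space
  proof eventually_elim
    case (elim t)
    then have t: "t \<in> J" using J by (simp add: space_restrict_space)
    have "(\<lambda>n. nrm X (S n t) - nrm X (f t)) \<longlonglongrightarrow> 0"
    proof (rule Lim_null_comparison[OF _ elim(1)])
      show "eventually (\<lambda>n. norm (nrm X (S n t) - nrm X (f t)) \<le> nrm X (f t - S n t)) sequentially"
        using seminormed_reverse_triangle[OF X fJ[OF t] S(2)[OF t]]
        by (intro always_eventually allI) (simp add: abs_minus_commute)
    qed
    then have "(\<lambda>n. nrm X (S n t)) \<longlonglongrightarrow> nrm X (f t)" by (simp add: LIM_zero_iff)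
    then show ?case by (rule limI)
  qed
  have "(\<lambda>t. nrm X (S n t)) \<in> borel_measurable (lebesgue_on J)" for n
    by (rule borel_measurable_simple_function[OF simple_function_compose1[OF S(1), of "nrm X"]])
  then have "(\<lambda>t. lim (\<lambda>n. nrm X (S n t))) \<in> borel_measurable (lebesgue_on J)"
    by (rule borel_measurable_lim_metric)
  from borel_measurable_lebesgue_on_AE[OF J this lim] show ?thesis .
qed

lemma strongly_measurable_diff_const:
  assumes X: "seminormed X" and f: "strongly_measurable J X f" and c: "c \<in> carr X"
  shows "strongly_measurable J X (\<lambda>t. f t - c)"
proof -
  obtain S where S: "\<And>n. simple_function (lebesgue_on J) (S n)" "\<And>n t. t \<in> J \<Longrightarrow> S n t \<in> carr X"
      "AE t in lebesgue_on J. (\<lambda>n. nrm X (f t - S n t)) \<longlonglongrightarrow> 0"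
    using f by (rule strongly_measurableE) blast
  have "simple_function (lebesgue_on J) (\<lambda>t. S n t - c)" for n
    by (rule simple_function_compose1[OF S(1), of "\<lambda>u. u - c"])
  moreover have "(\<lambda>t. S n t - c) ` J \<subseteq> carr X" for n
    using S(2) seminormed_diff(1)[OF X _ c] by auto
  moreover have "f t - c \<in> carr X" if "t \<in> J" for t
    using f that seminormed_diff(1)[OF X _ c] by (simp add: strongly_measurable_def)
  ultimately show ?thesis
    using S(3) unfolding strongly_measurable_def
    by (intro conjI ballI exI[of _ "\<lambda>n t. S n t - c"] allI) simp_all
qed

lemma simple_function_measurable_image:
  assumes "simple_function M s"
  shows "s \<in> measurable M (count_space (s ` space M))"
  using assms by (subst measurable_count_space_eq2) (auto simp: simple_function_def)

text \<open>
  Joint measurability of the integrand is not immediate from the definition, so it is replaced by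
  the limit of its values on the simple approximations.
\<close>

lemma inner_integral_ae_measurable:
  fixes F :: "real \<Rightarrow> 'x \<Rightarrow> real"
  assumes X: "seminormed X" and J: "J \<in> lmeasurable" and F: "strongly_measurable J X F"
  obtains D where "D \<in> borel_measurable (lebesgue_on J)"
    "AE t in lebesgue_on J. D t = (\<integral>\<^sup>+ \<tau>. ennreal ((nrm X (F \<tau> - F t))\<^sup>2 / \<bar>\<tau> - t\<bar> powr c) \<partial>lebesgue_on J)"
proof -
  let ?M = "lebesgue_on J"
  have J': "J \<in> sets lebesgue" using J by (simp add: fmeasurable_def)
  interpret finite_measure ?M using J by (rule finite_measure_lebesgue_on)
  obtain S where S: "\<And>n. simple_function ?M (S n)" "\<And>n t. t \<in> J \<Longrightarrow> S n t \<in> carr X"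
      "AE t in ?M. (\<lambda>n. nrm X (F t - S n t)) \<longlonglongrightarrow> 0"
    using F by (rule strongly_measurableE) blast
  have FJ: "F t \<in> carr X" if "t \<in> J" for t using F that by (simp add: strongly_measurable_def)
  note SJ = S(2)
  define G where "G t \<tau> = lim (\<lambda>n. nrm X (S n \<tau> - S n t))" for t \<tau>
  have lim_eq: "G t \<tau> = nrm X (F \<tau> - F t)"
    if t: "t \<in> J" "(\<lambda>n. nrm X (F t - S n t)) \<longlonglongrightarrow> 0" and \<tau>: "\<tau> \<in> J" "(\<lambda>n. nrm X (F \<tau> - S n \<tau>)) \<longlonglongrightarrow> 0" for t \<tau>
  proof -
    have "(\<lambda>n. nrm X (S n \<tau> - S n t) - nrm X (F \<tau> - F t)) \<longlonglongrightarrow> 0"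
    proof (rule Lim_null_comparison)
      show "(\<lambda>n. nrm X (F \<tau> - S n \<tau>) + nrm X (F t - S n t)) \<longlonglongrightarrow> 0"
        using tendsto_add[OF \<tau>(2) t(2)] by simp
      have "norm (nrm X (S n \<tau> - S n t) - nrm X (F \<tau> - F t)) \<le> nrm X (F \<tau> - S n \<tau>) + nrm X (F t - S n t)" for n
      proof -
        note d = seminormed_diff(1)[OF X]
        have "norm (nrm X (S n \<tau> - S n t) - nrm X (F \<tau> - F t)) \<le> nrm X ((F \<tau> - F t) - (S n \<tau> - S n t))"
          using seminormed_reverse_triangle[OF X d[OF FJ FJ] d[OF SJ SJ]] t(1) \<tau>(1)
          by (simp add: abs_minus_commute)
        also have "(F \<tau> - F t) - (S n \<tau> - S n t) = (F \<tau> - S n \<tau>) - (F t - S n t)"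
          by (simp add: algebra_simps)
        also have "nrm X \<dots> \<le> nrm X (F \<tau> - S n \<tau>) + nrm X (F t - S n t)"
          using t(1) \<tau>(1) by (intro seminormed_diff(2)[OF X] d FJ SJ)
        finally show ?thesis .
      qed
      then show "eventually (\<lambda>n. norm (nrm X (S n \<tau> - S n t) - nrm X (F \<tau> - F t)) \<le>
          nrm X (F \<tau> - S n \<tau>) + nrm X (F t - S n t)) sequentially"
        by (intro always_eventually allI)
    qed
    then show ?thesis unfolding G_def by (intro limI) (simp add: LIM_zero_iff)
  qed
  \<comment> \<open>\<open>S n\<close> has finitely many values; fixing its value at
    \<open>snd z\<close> leaves a simple function of \<open>fst z\<close>.\<close>
  have pair: "(\<lambda>z. nrm X (S n (snd z) - S n (fst z))) \<in> borel_measurable (?M \<Otimes>\<^sub>M ?M)" for n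
  proof (rule measurable_compose_countable'[where g = "\<lambda>z. S n (snd z)" and I = "S n ` space ?M"])
    have s: "S n \<in> measurable ?M (count_space (S n ` space ?M))"
      by (rule simple_function_measurable_image[OF S(1)])
    show "(\<lambda>z. S n (snd z)) \<in> measurable (?M \<Otimes>\<^sub>M ?M) (count_space (S n ` space ?M))"
      by (rule measurable_compose[OF measurable_snd s])
    show "countable (S n ` space ?M)"
      using simple_functionD(1)[OF S(1)] by (rule countable_finite)
    show "(\<lambda>z. nrm X (i - S n (fst z))) \<in> borel_measurable (?M \<Otimes>\<^sub>M ?M)" for i
      by (rule measurable_compose[OF measurable_fst borel_measurable_simple_function])
        (rule simple_function_compose1[OF S(1), of "\<lambda>u. nrm X (i - u)"])
  qed
  have G: "(\<lambda>z. G (fst z) (snd z)) \<in> borel_measurable (?M \<Otimes>\<^sub>M ?M)"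
    unfolding G_def by (rule borel_measurable_lim_metric[OF pair])
  have id: "(\<lambda>t::real. t) \<in> borel_measurable ?M"
    by (intro measurable_restrict_space1 measurable_completion) simp
  note [measurable] = G measurable_compose[OF measurable_fst id] measurable_compose[OF measurable_snd id]
  define D where "D t = (\<integral>\<^sup>+ \<tau>. ennreal ((G t \<tau>)\<^sup>2 / \<bar>\<tau> - t\<bar> powr c) \<partial>?M)" for t
  show ?thesis
  proof (rule that)
    have "(\<lambda>z. ennreal ((G (fst z) (snd z))\<^sup>2 / \<bar>snd z - fst z\<bar> powr c)) \<in> borel_measurable (?M \<Otimes>\<^sub>M ?M)"
      by measurable
    then show "D \<in> borel_measurable ?M"
      unfolding D_def by (intro borel_measurable_nn_integral) (simp add: case_prod_beta')
    show "AE t in ?M. D t = (\<integral>\<^sup>+ \<tau>. ennreal ((nrm X (F \<tau> - F t))\<^sup>2 / \<bar>\<tau> - t\<bar> powr c) \<partial>?M)"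
      using S(3) AE_space
    proof eventually_elim
      case (elim t)
      then have t: "t \<in> J" using J' by (simp add: space_restrict_space)
      have "AE \<tau> in ?M. G t \<tau> = nrm X (F \<tau> - F t)"
        using S(3) AE_space
      proof eventually_elim
        case (elim \<tau>)
        then show ?case
          using lim_eq[OF t \<open>(\<lambda>n. nrm X (F t - S n t)) \<longlonglongrightarrow> 0\<close>] J' by (simp add: space_restrict_space)
      qed
      then show ?case
        unfolding D_def by (intro nn_integral_cong_AE) (auto elim: eventually_mono)
    qed
  qed
qed

text \<open>The limits are taken for each \<open>w\<close> separately, using completeness of the
  reals. The Hoelder bound is linear in \<open>nrm X w\<close>, so it survives in the limit and
  becomes continuity in the dual norm.\<close>

lemma dual_extension:
  fixes X :: "('x \<Rightarrow> real) nspace" and \<Phi> :: "real \<Rightarrow> ('x \<Rightarrow> real) \<Rightarrow> real"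
  assumes X: "0 \<in> carr X" "\<And>u v. u \<in> carr X \<Longrightarrow> v \<in> carr X \<Longrightarrow> u + v \<in> carr X"
      "\<And>u c. u \<in> carr X \<Longrightarrow> (\<lambda>x. c * u x) \<in> carr X" "\<And>u. 0 \<le> nrm X u"
    and T: "0 \<le> T" and dense: "\<And>t \<epsilon>. t \<in> {0..T} \<Longrightarrow> 0 < \<epsilon> \<Longrightarrow> \<exists>a\<in>A. \<bar>a - t\<bar> < \<epsilon>"
    and A: "A \<subseteq> {0..T}" and \<Phi>: "\<And>t. t \<in> A \<Longrightarrow> \<Phi> t \<in> carr (dual X)"
    and L: "0 \<le> L" and \<beta>: "0 < \<beta>" and B: "0 \<le> B"
    and Hoelder: "\<And>x y w. x \<in> A \<Longrightarrow> y \<in> A \<Longrightarrow> w \<in> carr X \<Longrightarrow> \<bar>\<Phi> x w - \<Phi> y w\<bar> \<le> L * \<bar>x - y\<bar> powr \<beta> * nrm X w"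
    and bound: "\<And>x w. x \<in> A \<Longrightarrow> w \<in> carr X \<Longrightarrow> \<bar>\<Phi> x w\<bar> \<le> B * nrm X w"
  shows "\<exists>g\<in>carr (continuous_space {0..T} (dual X)). (\<forall>t\<in>A. g t = \<Phi> t) \<and>
    nrm (continuous_space {0..T} (dual X)) g \<le> B"
proof -
  have ne: "carr X \<noteq> {}" using X(1) by blast
  have "\<exists>a. \<forall>n. a n \<in> A \<and> \<bar>a n - t\<bar> < inverse (real (Suc n))" if "t \<in> {0..T}" for t
  proof (intro choice allI)
    show "\<exists>a. a \<in> A \<and> \<bar>a - t\<bar> < inverse (real (Suc n))" for n
      using dense[OF that, of "inverse (real (Suc n))"] by auto
  qed
  then obtain a where a: "\<And>t n. t \<in> {0..T} \<Longrightarrow> a t n \<in> A"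
      "\<And>t n. t \<in> {0..T} \<Longrightarrow> \<bar>a t n - t\<bar> < inverse (real (Suc n))"
    by metis
  have a_lim: "a t \<longlonglongrightarrow> t" if "t \<in> {0..T}" for t
  proof -
    have "(\<lambda>n. a t n - t) \<longlonglongrightarrow> 0"
      by (rule Lim_null_comparison[OF _ LIMSEQ_inverse_real_of_nat])
        (use a(2)[OF that] in \<open>auto intro!: always_eventually less_imp_le simp del: of_nat_Suc\<close>)
    then show ?thesis by (simp add: LIM_zero_iff)
  qed
  have powr_lim: "(\<lambda>n. L * \<bar>p n - q n\<bar> powr \<beta> * c) \<longlonglongrightarrow> L * \<bar>t - r\<bar> powr \<beta> * c"
    if "p \<longlonglongrightarrow> t" "q \<longlonglongrightarrow> r" for p q :: "nat \<Rightarrow> real" and t r c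
    using that \<beta> by (intro tendsto_intros tendsto_powr') auto
  have conv: "convergent (\<lambda>n. \<Phi> (a t n) w)" if t: "t \<in> {0..T}" and w: "w \<in> carr X" for t w
  proof (rule real_Cauchy_convergent, rule metric_CauchyI)
    fix \<epsilon> :: real assume \<epsilon>: "0 < \<epsilon>"
    have "(\<lambda>n. L * (2 * inverse (real (Suc n))) powr \<beta> * nrm X w) \<longlonglongrightarrow> L * (2 * 0) powr \<beta> * nrm X w"
      using \<beta> by (intro tendsto_intros tendsto_powr' LIMSEQ_inverse_real_of_nat) (auto simp del: of_nat_Suc)
    then have "(\<lambda>n. L * (2 * inverse (real (Suc n))) powr \<beta> * nrm X w) \<longlonglongrightarrow> 0" by simp
    then have "eventually (\<lambda>n. L * (2 * inverse (real (Suc n))) powr \<beta> * nrm X w < \<epsilon>) sequentially"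
      using \<epsilon> by (rule order_tendstoD(2))
    then obtain N where N: "L * (2 * inverse (real (Suc N))) powr \<beta> * nrm X w < \<epsilon>"
      by (auto simp: eventually_sequentially)
    show "\<exists>N. \<forall>m\<ge>N. \<forall>n\<ge>N. dist (\<Phi> (a t m) w) (\<Phi> (a t n) w) < \<epsilon>"
    proof (intro exI[of _ N] allI impI)
      fix m n assume mn: "N \<le> m" "N \<le> n"
      have "inverse (real (Suc k)) \<le> inverse (real (Suc N))" if "N \<le> k" for k
        using that by (intro le_imp_inverse_le) auto
      then have "\<bar>a t m - a t n\<bar> \<le> 2 * inverse (real (Suc N))"
        using a(2)[OF t, of m] a(2)[OF t, of n] mn by (smt (verit))
      then have "\<bar>a t m - a t n\<bar> powr \<beta> \<le> (2 * inverse (real (Suc N))) powr \<beta>"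
        using \<beta> by (intro powr_mono2) auto
      then have "L * \<bar>a t m - a t n\<bar> powr \<beta> * nrm X w \<le> L * (2 * inverse (real (Suc N))) powr \<beta> * nrm X w"
        using L X(4) by (intro mult_right_mono mult_left_mono)
      then show "dist (\<Phi> (a t m) w) (\<Phi> (a t n) w) < \<epsilon>"
        using Hoelder[OF a(1)[OF t] a(1)[OF t] w, of m n] N by (simp add: dist_real_def)
    qed
  qed
  \<comment> \<open>The value 0 outside the carrier is the normalisation that \<open>dual\<close>
    demands.\<close>
  define g where "g t w = (if w \<in> carr X then lim (\<lambda>n. \<Phi> (a t n) w) else 0)" for t w
  have g_lim: "(\<lambda>n. \<Phi> (a t n) w) \<longlonglongrightarrow> g t w" if "t \<in> {0..T}" "w \<in> carr X" for t w
    using conv[OF that] that by (simp add: g_def convergent_LIMSEQ_iff)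
  have g_Hoelder: "\<bar>g t w - g r w\<bar> \<le> L * \<bar>t - r\<bar> powr \<beta> * nrm X w"
    if "t \<in> {0..T}" "r \<in> {0..T}" "w \<in> carr X" for t r w
  proof (rule LIMSEQ_le)
    show "(\<lambda>n. \<bar>\<Phi> (a t n) w - \<Phi> (a r n) w\<bar>) \<longlonglongrightarrow> \<bar>g t w - g r w\<bar>"
      using that by (intro tendsto_intros g_lim)
    show "(\<lambda>n. L * \<bar>a t n - a r n\<bar> powr \<beta> * nrm X w) \<longlonglongrightarrow> L * \<bar>t - r\<bar> powr \<beta> * nrm X w"
      using that by (intro powr_lim a_lim)
    show "\<exists>N. \<forall>n\<ge>N. \<bar>\<Phi> (a t n) w - \<Phi> (a r n) w\<bar> \<le> L * \<bar>a t n - a r n\<bar> powr \<beta> * nrm X w"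
      using that a(1) Hoelder by blast
  qed
  have g_bound: "\<bar>g t w\<bar> \<le> B * nrm X w" if "t \<in> {0..T}" "w \<in> carr X" for t w
  proof (rule LIMSEQ_le_const2)
    show "(\<lambda>n. \<bar>\<Phi> (a t n) w\<bar>) \<longlonglongrightarrow> \<bar>g t w\<bar>"
      using that by (intro tendsto_intros g_lim)
    show "\<exists>N. \<forall>n\<ge>N. \<bar>\<Phi> (a t n) w\<bar> \<le> B * nrm X w"
      using that a(1) bound by blast
  qed
  have \<Phi>_add: "\<Phi> t (u + v) = \<Phi> t u + \<Phi> t v" if "t \<in> A" "u \<in> carr X" "v \<in> carr X" for t u v
    using \<Phi>[OF that(1)] that by (simp add: dual_iff)
  have \<Phi>_scale: "\<Phi> t (\<lambda>x. c * u x) = c * \<Phi> t u" if "t \<in> A" "u \<in> carr X" for t u c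
    using \<Phi>[OF that(1)] that by (simp add: dual_iff)
  have g_dual: "g t \<in> carr (dual X)" if t: "t \<in> {0..T}" for t
    unfolding dual_iff
  proof (intro conjI ballI allI impI)
    fix u v assume uv: "u \<in> carr X" "v \<in> carr X"
    have "(\<lambda>n. \<Phi> (a t n) (u + v)) \<longlonglongrightarrow> g t u + g t v"
      using tendsto_add[OF g_lim[OF t uv(1)] g_lim[OF t uv(2)]] \<Phi>_add[OF a(1)[OF t] uv] by simp
    then show "g t (u + v) = g t u + g t v"
      using g_lim[OF t X(2)[OF uv]] LIMSEQ_unique by blast
  next
    fix c u assume u: "u \<in> carr X"
    have "(\<lambda>n. \<Phi> (a t n) (\<lambda>x. c * u x)) \<longlonglongrightarrow> c * g t u"
      using tendsto_mult_left[OF g_lim[OF t u], of c] \<Phi>_scale[OF a(1)[OF t] u] by simp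
    then show "g t (\<lambda>x. c * u x) = c * g t u"
      using g_lim[OF t X(3)[OF u]] LIMSEQ_unique by blast
  next
    show "\<exists>C. \<forall>u\<in>carr X. \<bar>g t u\<bar> \<le> C * nrm X u" using g_bound[OF t] by blast
  next
    show "g t u = 0" if "u \<notin> carr X" for u using that by (simp add: g_def)
  qed
  \<comment> \<open>The chosen sequence need not be constant at points of \<open>A\<close>; the
    Hoelder bound identifies its limit with the old value.\<close>
  have g_eq: "g t = \<Phi> t" if t: "t \<in> A" for t
  proof
    fix w
    show "g t w = \<Phi> t w"
    proof (cases "w \<in> carr X")
      case True
      have tT: "t \<in> {0..T}" using t A by blast
      have "(\<lambda>n. \<Phi> (a t n) w - \<Phi> t w) \<longlonglongrightarrow> 0"
      proof (rule Lim_null_comparison)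
        show "eventually (\<lambda>n. norm (\<Phi> (a t n) w - \<Phi> t w) \<le> L * \<bar>a t n - t\<bar> powr \<beta> * nrm X w) sequentially"
          using Hoelder[OF a(1)[OF tT] t True] by (intro always_eventually) simp
        show "(\<lambda>n. L * \<bar>a t n - t\<bar> powr \<beta> * nrm X w) \<longlonglongrightarrow> 0"
          using powr_lim[OF a_lim[OF tT] tendsto_const[of t]] by simp
      qed
      then have "(\<lambda>n. \<Phi> (a t n) w) \<longlonglongrightarrow> \<Phi> t w" by (simp add: LIM_zero_iff)
      then show ?thesis using g_lim[OF tT True] LIMSEQ_unique by blast
    next
      case False
      then show ?thesis using \<Phi>[OF t] by (simp add: g_def dual_iff)
    qed
  qed
  have cont: "((\<lambda>r. nrm (dual X) (g r - g t)) \<longlongrightarrow> 0) (at t within {0..T})" if t: "t \<in> {0..T}" for t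
  proof (rule tendsto_sandwich[OF _ _ tendsto_const])
    have "((\<lambda>r. L * \<bar>r - t\<bar> powr \<beta>) \<longlongrightarrow> L * \<bar>t - t\<bar> powr \<beta>) (at t within {0..T})"
      using \<beta> by (intro tendsto_intros tendsto_powr') auto
    then show "((\<lambda>r. L * \<bar>r - t\<bar> powr \<beta>) \<longlongrightarrow> 0) (at t within {0..T})" by simp
    have "nrm (dual X) (g r - g t) \<le> L * \<bar>r - t\<bar> powr \<beta>" if r: "r \<in> {0..T}" for r
      using L g_Hoelder[OF r t] X(4) by (intro dual_nrm_le[OF ne]) auto
    then show "eventually (\<lambda>r. nrm (dual X) (g r - g t) \<le> L * \<bar>r - t\<bar> powr \<beta>) (at t within {0..T})"
      by (auto simp: eventually_at_filter)
    have "0 \<le> nrm (dual X) (g r - g t)" if r: "r \<in> {0..T}" for r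
      using X(4) ne seminormed_diff(1)[OF seminormed_dual g_dual[OF r] g_dual[OF t]]
      by (intro dual_nrm_nonneg) auto
    then show "eventually (\<lambda>r. 0 \<le> nrm (dual X) (g r - g t)) (at t within {0..T})"
      by (auto simp: eventually_at_filter)
  qed
  show ?thesis
  proof (intro bexI[of _ g] conjI ballI)
    show "g \<in> carr (continuous_space {0..T} (dual X))"
      using g_dual cont by (simp add: continuous_space_def)
    have "nrm (dual X) (g t) \<le> B" if "t \<in> {0..T}" for t
      using B g_bound[OF that] X(4) by (intro dual_nrm_le[OF ne]) auto
    then show "nrm (continuous_space {0..T} (dual X)) g \<le> B"
      using T by (auto simp: continuous_space_def intro!: cSUP_least)
  qed (rule g_eq)
qed

text \<open>The chaining needs a positive bound, whereas the norm \<open>N\<close> of the given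
  function may be 0; estimates are proved for all \<open>M\<close> above \<open>N\<close> and then
  carried over to \<open>N\<close>.\<close>

lemma le_mult_of_greater:
  fixes a c N :: real
  assumes "0 \<le> c" and "\<And>M. N < M \<Longrightarrow> a \<le> c * M"
  shows "a \<le> c * N"
proof (rule field_le_epsilon)
  fix e :: real assume e: "0 < e"
  have "a \<le> c * (N + e / (c + 1))" using assms e by simp
  also have "\<dots> = c * N + c / (c + 1) * e" by (simp add: distrib_left)
  also have "c / (c + 1) * e \<le> e" using assms(1) e by (simp add: field_simps)
  finally show "a \<le> c * N + e" by simp
qed

section \<open>The embedding for a fixed element of the intersection space\<close>

context
  fixes \<Omega> :: "'a::euclidean_space set" and T \<alpha> \<sigma> N :: real and f :: "real \<Rightarrow> 'a \<Rightarrow> real"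
  assumes \<Omega>: "open \<Omega>" and T: "0 < T" and \<alpha>: "0 < \<alpha>" "\<alpha> < 1"
    and \<sigma>: "0 \<le> \<sigma>" "\<sigma> < 1" "1 / \<alpha> < 1 + \<sigma>"
    and f: "f \<in> carr (L2_H_intersection \<Omega> {0<..<T} \<alpha>)"
    and N: "N = nrm (L2_H_intersection \<Omega> {0<..<T} \<alpha>) f"
begin

abbreviation (input) "J \<equiv> {0<..<T}"
abbreviation (input) "F t \<equiv> as_H_neg \<Omega> (- 1) (f t)"
abbreviation (input) "V t \<equiv> nrm (H1_tilde \<Omega>) (f t)"
abbreviation (input) "E x y \<equiv> nrm (dual (H1_tilde \<Omega>)) (F x - F y)"
abbreviation (input) "\<beta> \<equiv> \<alpha> * ((1 + \<sigma>) / 2) - 1 / 2"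

lemma seminormed_H_minus_1: "seminormed (dual (H1_tilde \<Omega>))"
proof (rule seminormed_dual)
  show "carr (H1_tilde \<Omega>) \<noteq> {}"
    using seminormed_zero[OF seminormed_H1_tilde[OF \<Omega>]] by blast
qed (rule seminormed_nonneg[OF seminormed_H1_tilde[OF \<Omega>]])

lemma intersection_facts:
  shows f_sm: "strongly_measurable J (H1_tilde \<Omega>) f"
    and F_sm: "strongly_measurable J (dual (H1_tilde \<Omega>)) (\<lambda>t. F t)"
    and N_nonneg: "0 \<le> N"
    and L2_le: "bochner_L2_sq J (H1_tilde \<Omega>) f \<le> ennreal (N\<^sup>2)"
    and Gagliardo_le: "(\<integral>\<^sup>+ t. (\<integral>\<^sup>+ \<tau>. ennreal ((E \<tau> t)\<^sup>2 / \<bar>\<tau> - t\<bar> powr (2 * \<alpha> + 1))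
       \<partial>lebesgue_on J) \<partial>lebesgue_on J) \<le> ennreal (N\<^sup>2)"
proof -
  let ?b1 = "bochner_L2_sq J (H1_tilde \<Omega>) f"
  let ?b2 = "bochner_H_sq J \<alpha> (dual (H1_tilde \<Omega>)) (\<lambda>t. F t)"
  have *: "strongly_measurable J (H1_tilde \<Omega>) f" "?b1 < \<infinity>"
      "strongly_measurable J (dual (H1_tilde \<Omega>)) (\<lambda>t. F t)" "?b2 < \<infinity>"
    using f by (auto simp: L2_H_intersection_def bochner_L2_def bochner_H_def H_neg_def H_tilde_1)
  then show "strongly_measurable J (H1_tilde \<Omega>) f" "strongly_measurable J (dual (H1_tilde \<Omega>)) (\<lambda>t. F t)"
    by blast+
  have Neq: "N = sqrt (enn2real ?b1) + sqrt (enn2real ?b2)"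
    unfolding N by (simp add: L2_H_intersection_def bochner_L2_def bochner_H_def H_neg_def H_tilde_1)
  then show "0 \<le> N" by simp
  have "?b1 = ennreal ((sqrt (enn2real ?b1))\<^sup>2)" using *(2) by simp
  also have "\<dots> \<le> ennreal (N\<^sup>2)" unfolding Neq by (intro ennreal_leI power_mono) auto
  finally show "?b1 \<le> ennreal (N\<^sup>2)" .
  have "(\<integral>\<^sup>+ t. (\<integral>\<^sup>+ \<tau>. ennreal ((E \<tau> t)\<^sup>2 / \<bar>\<tau> - t\<bar> powr (2 * \<alpha> + 1)) \<partial>lebesgue_on J) \<partial>lebesgue_on J) \<le> ?b2"
    unfolding bochner_H_sq_def by simp
  also have "?b2 = ennreal ((sqrt (enn2real ?b2))\<^sup>2)" using *(4) by simp
  also have "\<dots> \<le> ennreal (N\<^sup>2)" unfolding Neq by (intro ennreal_leI power_mono) auto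
  finally show "(\<integral>\<^sup>+ t. (\<integral>\<^sup>+ \<tau>. ennreal ((E \<tau> t)\<^sup>2 / \<bar>\<tau> - t\<bar> powr (2 * \<alpha> + 1)) \<partial>lebesgue_on J) \<partial>lebesgue_on J) \<le> ennreal (N\<^sup>2)" .
qed

lemma f_H1: "t \<in> J \<Longrightarrow> f t \<in> carr (H1_tilde \<Omega>)" and F_dual: "t \<in> J \<Longrightarrow> F t \<in> carr (dual (H1_tilde \<Omega>))"
  using f_sm F_sm by (simp_all add: strongly_measurable_def)

text \<open>The H^1 norm is inserted for both \<open>e\<close> and \<open>V\<close>, so that the
  exponents add up to 1. This serves to anchor the supremum bound at one well chosen time.\<close>

lemma pairing_bounded:
  assumes t: "t \<in> J" and w: "w \<in> carr (H_tilde \<Omega> \<sigma>)"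
  shows "\<bar>LINT x|lebesgue_on \<Omega>. f t x * w x\<bar> \<le> 3 * V t * nrm (H_tilde \<Omega> \<sigma>) w"
proof -
  note H1 = seminormed_H1_tilde[OF \<Omega>] and L2 = seminormed_L2_space[of \<Omega>]
  have v: "f t \<in> carr (L2_space \<Omega>)" by (rule H1_tilde_L2[OF f_H1[OF t]])
  have V: "0 \<le> V t" by (rule seminormed_nonneg[OF H1 f_H1[OF t]])
  have "\<bar>LINT x|lebesgue_on \<Omega>. f t x * w x\<bar> \<le>
      3 * (V t powr ((1 + \<sigma>) / 2) * V t powr ((1 - \<sigma>) / 2)) * nrm (H_tilde \<Omega> \<sigma>) w"
  proof (rule H_tilde_pairing_bound[OF \<Omega> \<sigma>(1,2) v V V _ _ w])
    show "\<bar>LINT x|lebesgue_on \<Omega>. f t x * z x\<bar> \<le> V t * nrm (H1_tilde \<Omega>) z" if z: "z \<in> carr (H1_tilde \<Omega>)" for z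
      using L2_Cauchy_Schwarz[OF v H1_tilde_L2[OF z]] L2_nrm_le_H1_tilde_nrm[of \<Omega> "f t"]
        L2_nrm_le_H1_tilde_nrm[of \<Omega> z] seminormed_nonneg[OF L2 H1_tilde_L2[OF z]] V
      by (meson mult_mono order_trans)
    show "(nrm (L2_space \<Omega>) (f t))\<^sup>2 \<le> V t * V t"
      using L2_nrm_le_H1_tilde_nrm[of \<Omega> "f t"] seminormed_nonneg[OF L2 v]
      by (simp add: power2_eq_square mult_mono)
  qed
  also have "V t powr ((1 + \<sigma>) / 2) * V t powr ((1 - \<sigma>) / 2) = V t powr 1"
    by (simp add: powr_add[symmetric] field_simps)
  finally show ?thesis using V by simp
qed

text \<open>This is the hypothesis \<open>f_bound\<close> of \<open>chaining\<close>. The functional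
  \<open>F x - F y\<close> acts on \<open>H1_tilde\<close> as the pairing with
  \<open>f x - f y\<close>, whose dual norm therefore plays the role of \<open>e\<close>.\<close>

lemma pairing_difference:
  assumes t: "x \<in> J" "y \<in> J" and w: "w \<in> carr (H_tilde \<Omega> \<sigma>)"
  shows "\<bar>(LINT z|lebesgue_on \<Omega>. f x z * w z) - (LINT z|lebesgue_on \<Omega>. f y z * w z)\<bar> \<le>
    3 * nrm (H_tilde \<Omega> \<sigma>) w * (E x y powr ((1 + \<sigma>) / 2) * (V x + V y) powr (1 - (1 + \<sigma>) / 2))"
proof -
  note H1 = seminormed_H1_tilde[OF \<Omega>] and L2 = seminormed_L2_space[of \<Omega>]
  note D = seminormed_H_minus_1
  have vx: "f x \<in> carr (L2_space \<Omega>)" and vy: "f y \<in> carr (L2_space \<Omega>)"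
    using t f_H1 H1_tilde_L2 by blast+
  have v: "f x - f y \<in> carr (L2_space \<Omega>)" by (rule seminormed_diff[OF L2 vx vy])
  have V: "0 \<le> V x" "0 \<le> V y" using t f_H1 seminormed_nonneg[OF H1] by blast+
  have Fm: "F x - F y \<in> carr (dual (H1_tilde \<Omega>))" by (rule seminormed_diff[OF D F_dual[OF t(1)] F_dual[OF t(2)]])
  have diff: "(LINT z|lebesgue_on \<Omega>. (f x - f y) z * u z) =
      (LINT z|lebesgue_on \<Omega>. f x z * u z) - (LINT z|lebesgue_on \<Omega>. f y z * u z)"
    if "u \<in> carr (L2_space \<Omega>)" for u
    using L2_mult_integrable[OF vx that] L2_mult_integrable[OF vy that] by (simp add: left_diff_distrib)
  have weak: "\<bar>LINT z|lebesgue_on \<Omega>. (f x - f y) z * u z\<bar> \<le> E x y * nrm (H1_tilde \<Omega>) u"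
    if u: "u \<in> carr (H1_tilde \<Omega>)" for u
  proof -
    have "(LINT z|lebesgue_on \<Omega>. (f x - f y) z * u z) = (F x - F y) u"
      using diff[OF H1_tilde_L2[OF u]] u by (simp add: as_H_neg_def H_tilde_1)
    then show ?thesis
      using dual_nrm_bound[of "H1_tilde \<Omega>", OF seminormed_nonneg[OF H1] Fm u] by simp
  qed
  have "\<bar>LINT z|lebesgue_on \<Omega>. (f x - f y) z * w z\<bar> \<le>
      3 * (E x y powr ((1 + \<sigma>) / 2) * (V x + V y) powr ((1 - \<sigma>) / 2)) * nrm (H_tilde \<Omega> \<sigma>) w"
  proof (rule H_tilde_pairing_bound[OF \<Omega> \<sigma>(1,2) v _ _ weak _ w])
    show "0 \<le> E x y" by (rule seminormed_nonneg[OF D Fm])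
    show "0 \<le> V x + V y" using V by simp
    \<comment> \<open>The functional is evaluated at \<open>f x\<close> and \<open>f y\<close> separately to have the norms of these on the right.\<close>
    have "(nrm (L2_space \<Omega>) (f x - f y))\<^sup>2 = (LINT z|lebesgue_on \<Omega>. (f x - f y) z * (f x - f y) z)"
      by (simp add: L2_space_nrm power2_eq_square)
    also have "\<dots> = (LINT z|lebesgue_on \<Omega>. (f x - f y) z * f x z) - (LINT z|lebesgue_on \<Omega>. (f x - f y) z * f y z)"
      using L2_mult_integrable[OF v vx] L2_mult_integrable[OF v vy]
      by (subst Bochner_Integration.integral_diff[symmetric]) (simp_all add: right_diff_distrib)
    also have "\<dots> \<le> E x y * V x + E x y * V y"
      using weak[OF f_H1[OF t(1)]] weak[OF f_H1[OF t(2)]] by linarith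
    finally show "(nrm (L2_space \<Omega>) (f x - f y))\<^sup>2 \<le> E x y * (V x + V y)"
      by (simp add: distrib_left)
  qed
  moreover have "(1 - \<sigma>) / 2 = 1 - (1 + \<sigma>) / 2" by (simp add: field_simps)
  ultimately show ?thesis
    using diff[OF H_tilde_L2[OF \<Omega> \<sigma>(1,2) w]] by (simp add: mult_ac)
qed

text \<open>In the constant, the first summand bounds the value at a time where the H^1 norm is at
  most its average size, the second the Hoelder variation over an interval of length
  \<open>T\<close>; 120 is the 3 of the interpolation inequality times the 40 of the
  chaining.\<close>

lemma continuous_representative:
  "\<exists>g\<in>carr (continuous_space {0..T} (dual (H_tilde \<Omega> \<sigma>))).
    (AE t in lebesgue_on J. g t = as_H_neg \<Omega> (- \<sigma>) (f t)) \<and>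
    nrm (continuous_space {0..T} (dual (H_tilde \<Omega> \<sigma>))) g \<le>
      (3 * sqrt (2 / T) + 120 / (1 - 2 powr (- \<beta>)) * T powr \<beta>) * N"
proof -
  note H1 = seminormed_H1_tilde[OF \<Omega>] and D1 = seminormed_H_minus_1
  let ?M = "lebesgue_on J"
  let ?c = "2 * \<alpha> + 1"
  define K where "K = 40 / (1 - 2 powr (- \<beta>))"
  have J: "J \<in> lmeasurable" "J \<in> sets lebesgue" by simp_all
  have \<theta>: "\<alpha> * ((1 + \<sigma>) / 2) > 1 / 2" using \<sigma>(3) \<alpha> by (simp add: field_simps)
  have "(2::real) powr (- \<beta>) < 1" using \<theta> powr_less_mono[of "- \<beta>" 0 2] by simp
  then have K: "0 \<le> K" by (simp add: K_def)
  obtain D where D: "D \<in> borel_measurable ?M"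
    "AE t in ?M. D t = (\<integral>\<^sup>+ \<tau>. ennreal ((E \<tau> t)\<^sup>2 / \<bar>\<tau> - t\<bar> powr ?c) \<partial>?M)"
    by (rule inner_integral_ae_measurable[OF D1 J(1) F_sm])
  \<comment> \<open>This set depends on \<open>f\<close> but on no test function, so one null set is
    discarded for all \<open>w\<close> together.\<close>
  define A where "A = {t \<in> J. D t = (\<integral>\<^sup>+ \<tau>. ennreal ((E \<tau> t)\<^sup>2 / \<bar>\<tau> - t\<bar> powr ?c) \<partial>?M) \<and> D t < \<infinity>}"
  have "(\<integral>\<^sup>+ t. D t \<partial>?M) = (\<integral>\<^sup>+ t. (\<integral>\<^sup>+ \<tau>. ennreal ((E \<tau> t)\<^sup>2 / \<bar>\<tau> - t\<bar> powr ?c) \<partial>?M) \<partial>?M)"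
    by (rule nn_integral_cong_AE[OF D(2)])
  then have D_le: "(\<integral>\<^sup>+ t. D t \<partial>?M) \<le> ennreal (N\<^sup>2)" using Gagliardo_le by simp
  then have "(\<integral>\<^sup>+ t. D t \<partial>?M) \<noteq> \<infinity>" by (auto simp: top_unique)
  then have "AE t in ?M. D t \<noteq> \<infinity>" by (rule nn_integral_noteq_infinite[OF D(1)])
  with D(2) AE_space have A_AE: "AE t in ?M. t \<in> A"
    by eventually_elim (auto simp: A_def space_restrict_space less_top)
  have V_meas: "(\<lambda>t. V t) \<in> borel_measurable ?M"
    by (rule nrm_strongly_measurable[OF H1 J(2) f_sm])
  have ch: "chaining T \<alpha> ((1 + \<sigma>) / 2) M (3 * nrm (H_tilde \<Omega> \<sigma>) w) A (\<lambda>x y. E x y) (\<lambda>t. V t) D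
      (\<lambda>t. LINT z|lebesgue_on \<Omega>. f t z * w z)" if M: "N < M" and w: "w \<in> carr (H_tilde \<Omega> \<sigma>)" for M w
  proof
    have NM: "ennreal (N\<^sup>2) \<le> ennreal (M\<^sup>2)" using M N_nonneg by (intro ennreal_leI power_mono) auto
    show "0 < M" using M N_nonneg by simp
    show "0 \<le> 3 * nrm (H_tilde \<Omega> \<sigma>) w" using H_tilde_nonneg[OF \<Omega> \<sigma>(1,2)] by simp
    show "(\<lambda>t. E t p) \<in> borel_measurable ?M" if "p \<in> A" for p
      using that by (intro nrm_strongly_measurable[OF D1 J(2)] strongly_measurable_diff_const[OF D1 F_sm] F_dual)
        (simp add: A_def)
    show "0 \<le> V t" if "t \<in> A" for t
      using that seminormed_nonneg[OF H1 f_H1] by (simp add: A_def)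
    show "0 \<le> E t p" if "t \<in> A" "p \<in> A" for t p
      using that by (intro seminormed_nonneg[OF D1] seminormed_diff[OF D1] F_dual) (simp_all add: A_def)
    show "E t t = 0" for t using seminormed_nrm_0[OF D1] by simp
    show "(\<integral>\<^sup>+ t. ennreal ((V t)\<^sup>2) \<partial>?M) \<le> ennreal (M\<^sup>2)"
      using L2_le NM unfolding bochner_L2_sq_def by (rule order_trans)
    show "(\<integral>\<^sup>+ t. D t \<partial>?M) \<le> ennreal (M\<^sup>2)" using D_le NM by (rule order_trans)
    show "\<bar>(LINT z|lebesgue_on \<Omega>. f x z * w z) - (LINT z|lebesgue_on \<Omega>. f y z * w z)\<bar> \<le>
      3 * nrm (H_tilde \<Omega> \<sigma>) w * (E x y powr ((1 + \<sigma>) / 2) * (V x + V y) powr (1 - (1 + \<sigma>) / 2))"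
      if "x \<in> A" "y \<in> A" for x y
      using that w by (intro pairing_difference) (simp_all add: A_def)
  qed (use T \<alpha> \<sigma> \<theta> A_AE V_meas D in \<open>auto simp: A_def\<close>)
  have Hoelder: "\<bar>(LINT z|lebesgue_on \<Omega>. f x z * w z) - (LINT z|lebesgue_on \<Omega>. f y z * w z)\<bar> \<le>
      3 * K * N * \<bar>x - y\<bar> powr \<beta> * nrm (H_tilde \<Omega> \<sigma>) w"
    if xy: "x \<in> A" "y \<in> A" and w: "w \<in> carr (H_tilde \<Omega> \<sigma>)" for x y w
  proof -
    have "\<bar>(LINT z|lebesgue_on \<Omega>. f x z * w z) - (LINT z|lebesgue_on \<Omega>. f y z * w z)\<bar> \<le>
      (3 * K * \<bar>x - y\<bar> powr \<beta> * nrm (H_tilde \<Omega> \<sigma>) w) * N"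
    proof (rule le_mult_of_greater)
      show "0 \<le> 3 * K * \<bar>x - y\<bar> powr \<beta> * nrm (H_tilde \<Omega> \<sigma>) w"
        using K H_tilde_nonneg[OF \<Omega> \<sigma>(1,2)] by simp
      fix M assume "N < M"
      from chaining.Hoelder_bound[OF ch[OF this w] xy]
      show "\<bar>(LINT z|lebesgue_on \<Omega>. f x z * w z) - (LINT z|lebesgue_on \<Omega>. f y z * w z)\<bar> \<le>
          (3 * K * \<bar>x - y\<bar> powr \<beta> * nrm (H_tilde \<Omega> \<sigma>) w) * M"
        unfolding chaining.\<beta>_def[OF ch[OF \<open>N < M\<close> w]] K_def by (simp add: mult_ac)
    qed
    then show ?thesis by (simp add: mult_ac)
  qed
  have bound: "\<bar>LINT z|lebesgue_on \<Omega>. f x z * w z\<bar> \<le> (3 * sqrt (2 / T) + 3 * K * T powr \<beta>) * N * nrm (H_tilde \<Omega> \<sigma>) w"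
    if x: "x \<in> A" and w: "w \<in> carr (H_tilde \<Omega> \<sigma>)" for x w
  proof -
    have nn: "0 \<le> nrm (H_tilde \<Omega> \<sigma>) w" by (rule H_tilde_nonneg[OF \<Omega> \<sigma>(1,2)])
    have "\<bar>LINT z|lebesgue_on \<Omega>. f x z * w z\<bar> \<le>
        ((3 * sqrt (2 / T) + 3 * K * T powr \<beta>) * nrm (H_tilde \<Omega> \<sigma>) w) * N"
    proof (rule le_mult_of_greater)
      show "0 \<le> (3 * sqrt (2 / T) + 3 * K * T powr \<beta>) * nrm (H_tilde \<Omega> \<sigma>) w"
        using K T nn by simp
      fix M assume M: "N < M"
      then have M0: "0 < M" using N_nonneg by simp
      \<comment> \<open>A single condition, hence the factor \<open>Suc 1\<close> = 2 under the root
        in \<open>sqrt (2 / T)\<close>.\<close>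
      have "\<exists>q\<in>A. 0 < q \<and> q < T \<and> (\<forall>i<1::nat. ennreal ((V q)\<^sup>2) \<le> ennreal (real (Suc 1) * M\<^sup>2 / (T - 0)))"
      proof (rule select_good_point[where h = "\<lambda>_ q. ennreal ((V q)\<^sup>2)" and c = "\<lambda>_. M\<^sup>2", OF _ _ _ A_AE])
        show "(\<integral>\<^sup>+ t. ennreal ((V t)\<^sup>2) \<partial>?M) \<le> ennreal (M\<^sup>2)"
          by (rule chaining.V_bound[OF ch[OF M w]])
      qed (use T M0 V_meas in auto)
      then obtain q where q: "q \<in> A" "ennreal ((V q)\<^sup>2) \<le> ennreal (2 * M\<^sup>2 / T)" by auto
      have qJ: "q \<in> J" "x \<in> J" using q(1) x by (auto simp: A_def)
      have "(V q)\<^sup>2 \<le> 2 * M\<^sup>2 / T" using q(2) T by (subst (asm) ennreal_le_iff) auto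
      also have "\<dots> = (sqrt (2 / T) * M)\<^sup>2" using T by (simp add: power_mult_distrib)
      finally have Vq: "V q \<le> sqrt (2 / T) * M"
        by (rule power2_le_imp_le) (use T M0 in simp)
      have "\<bar>LINT z|lebesgue_on \<Omega>. f q z * w z\<bar> \<le> 3 * V q * nrm (H_tilde \<Omega> \<sigma>) w"
        by (rule pairing_bounded[OF qJ(1) w])
      also have "\<dots> \<le> 3 * (sqrt (2 / T) * M) * nrm (H_tilde \<Omega> \<sigma>) w"
        using Vq nn by (intro mult_right_mono mult_left_mono) auto
      finally have 1: "\<bar>LINT z|lebesgue_on \<Omega>. f q z * w z\<bar> \<le> 3 * (sqrt (2 / T) * M) * nrm (H_tilde \<Omega> \<sigma>) w" .
      have "\<bar>x - q\<bar> powr \<beta> \<le> T powr \<beta>" using qJ \<theta> by (intro powr_mono2) auto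
      then have "3 * K * N * \<bar>x - q\<bar> powr \<beta> * nrm (H_tilde \<Omega> \<sigma>) w \<le> 3 * K * M * T powr \<beta> * nrm (H_tilde \<Omega> \<sigma>) w"
        using K N_nonneg M nn by (intro mult_right_mono mult_mono) auto
      with Hoelder[OF x q(1) w] 1
      have "\<bar>LINT z|lebesgue_on \<Omega>. f x z * w z\<bar> \<le>
        3 * (sqrt (2 / T) * M) * nrm (H_tilde \<Omega> \<sigma>) w + 3 * K * M * T powr \<beta> * nrm (H_tilde \<Omega> \<sigma>) w"
        by linarith
      then show "\<bar>LINT z|lebesgue_on \<Omega>. f x z * w z\<bar> \<le>
          ((3 * sqrt (2 / T) + 3 * K * T powr \<beta>) * nrm (H_tilde \<Omega> \<sigma>) w) * M"
        by (simp add: algebra_simps)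
    qed
    then show ?thesis by (simp add: mult_ac)
  qed
  have pairing: "as_H_neg \<Omega> (- \<sigma>) (f t) w = (LINT z|lebesgue_on \<Omega>. f t z * w z)"
    if "w \<in> carr (H_tilde \<Omega> \<sigma>)" for t w
    using that by (simp add: as_H_neg_def)
  have "\<exists>g\<in>carr (continuous_space {0..T} (dual (H_tilde \<Omega> \<sigma>))). (\<forall>t\<in>A. g t = as_H_neg \<Omega> (- \<sigma>) (f t)) \<and>
    nrm (continuous_space {0..T} (dual (H_tilde \<Omega> \<sigma>))) g \<le> (3 * sqrt (2 / T) + 3 * K * T powr \<beta>) * N"
  proof (rule dual_extension)
    show "\<exists>a\<in>A. \<bar>a - t\<bar> < \<epsilon>" if t: "t \<in> {0..T}" and \<epsilon>: "0 < \<epsilon>" for t \<epsilon>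
    proof -
      \<comment> \<open>With no condition to satisfy, the selection just yields a point of
        \<open>A\<close> in the nonempty interval around \<open>t\<close>, cut off at 0 and
        \<open>T\<close>.\<close>
      have "\<exists>q\<in>A. max 0 (t - \<epsilon>) < q \<and> q < min T (t + \<epsilon>) \<and> (\<forall>i<0::nat. 0 \<le> ennreal (real (Suc 0) * 1 / (min T (t + \<epsilon>) - max 0 (t - \<epsilon>))))"
        using t \<epsilon> T by (intro select_good_point[where h = "\<lambda>_ _. 0" and c = "\<lambda>_. 1", OF _ _ _ A_AE]) auto
      then show ?thesis by (force simp: abs_less_iff)
    qed
    show "A \<subseteq> {0..T}" by (auto simp: A_def)
    show "as_H_neg \<Omega> (- \<sigma>) (f t) \<in> carr (dual (H_tilde \<Omega> \<sigma>))" if t: "t \<in> A" for t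
      unfolding dual_iff
    proof (intro conjI ballI allI impI)
      have "t \<in> J" using t by (simp add: A_def)
      then have v: "f t \<in> carr (L2_space \<Omega>)" using f_H1 H1_tilde_L2 by blast
      note L2w = H_tilde_L2[OF \<Omega> \<sigma>(1,2)]
      show "as_H_neg \<Omega> (- \<sigma>) (f t) (u + w) = as_H_neg \<Omega> (- \<sigma>) (f t) u + as_H_neg \<Omega> (- \<sigma>) (f t) w"
        if "u \<in> carr (H_tilde \<Omega> \<sigma>)" "w \<in> carr (H_tilde \<Omega> \<sigma>)" for u w
        using that H_tilde_add[OF \<Omega> \<sigma>(1,2) that] L2_mult_integrable[OF v L2w] by (simp add: pairing distrib_left)
      show "as_H_neg \<Omega> (- \<sigma>) (f t) (\<lambda>x. c * u x) = c * as_H_neg \<Omega> (- \<sigma>) (f t) u"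
        if "u \<in> carr (H_tilde \<Omega> \<sigma>)" for u c
      proof -
        have "(LINT z|lebesgue_on \<Omega>. f t z * (c * u z)) = (LINT z|lebesgue_on \<Omega>. c * (f t z * u z))"
          by (simp add: mult_ac)
        then show ?thesis using that H_tilde_scale[OF \<Omega> \<sigma>(1,2) that] by (simp add: pairing)
      qed
      show "\<exists>C. \<forall>u\<in>carr (H_tilde \<Omega> \<sigma>). \<bar>as_H_neg \<Omega> (- \<sigma>) (f t) u\<bar> \<le> C * nrm (H_tilde \<Omega> \<sigma>) u"
        using bound[OF t] by (intro exI ballI) (simp add: pairing)
      show "as_H_neg \<Omega> (- \<sigma>) (f t) u = 0" if "u \<notin> carr (H_tilde \<Omega> \<sigma>)" for u
        using that by (simp add: as_H_neg_def)
    qed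
    show "0 \<le> 3 * K * N" using K N_nonneg by simp
    show "0 < \<beta>" using \<theta> by simp
    show "0 \<le> (3 * sqrt (2 / T) + 3 * K * T powr \<beta>) * N" using K N_nonneg T by simp
  qed (use T H_tilde_zero[OF \<Omega> \<sigma>(1,2)] H_tilde_add[OF \<Omega> \<sigma>(1,2)] H_tilde_scale[OF \<Omega> \<sigma>(1,2)]
      H_tilde_nonneg[OF \<Omega> \<sigma>(1,2)] Hoelder bound in \<open>simp_all add: pairing\<close>)
  then obtain g where g: "g \<in> carr (continuous_space {0..T} (dual (H_tilde \<Omega> \<sigma>)))"
    "\<And>t. t \<in> A \<Longrightarrow> g t = as_H_neg \<Omega> (- \<sigma>) (f t)"
    "nrm (continuous_space {0..T} (dual (H_tilde \<Omega> \<sigma>))) g \<le> (3 * sqrt (2 / T) + 3 * K * T powr \<beta>) * N"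
    by blast
  show ?thesis
  proof (intro bexI[OF _ g(1)] conjI)
    show "AE t in ?M. g t = as_H_neg \<Omega> (- \<sigma>) (f t)"
      using A_AE by eventually_elim (rule g(2))
    show "nrm (continuous_space {0..T} (dual (H_tilde \<Omega> \<sigma>))) g \<le>
      (3 * sqrt (2 / T) + 120 / (1 - 2 powr (- \<beta>)) * T powr \<beta>) * N"
      using g(3) by (simp add: K_def)
  qed
qed

end

theorem corollary9:
  fixes \<Omega> :: "(real ^ 'n) set" and T \<alpha> s :: real
  assumes "lipschitz_domain \<Omega>"
    and "T > 0"
    and "\<alpha> \<in> {0<..<1}"
    and "s \<in> {-1<..0}"
    and "s < 1 - 1 / \<alpha>"
  shows "\<exists>C. \<forall>f\<in>carr (L2_H_intersection \<Omega> {0<..<T} \<alpha>).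
           \<exists>g\<in>carr (continuous_space {0..T} (H_neg \<Omega> s)).
             (AE t in lebesgue_on {0<..<T}. g t = as_H_neg \<Omega> s (f t)) \<and>
             nrm (continuous_space {0..T} (H_neg \<Omega> s)) g
               \<le> C * nrm (L2_H_intersection \<Omega> {0<..<T} \<alpha>) f"
proof -
  have \<Omega>: "open \<Omega>" using assms(1) by (simp add: lipschitz_domain_def)
  \<comment> \<open>With \<sigma> = -s the last assumption reads 1 / \<alpha> < 1 + \<sigma>. The
    constant supplied involves only \<open>T\<close>, \<alpha> and \<sigma>, so it can be chosen
    before \<open>f\<close>.\<close>
  show ?thesis
    using continuous_representative[OF \<Omega> assms(2), of \<alpha> "- s", OF _ _ _ _ _ _ refl] assms(3-5)
    by (intro exI ballI) (simp add: H_neg_def)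
qed

end
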